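(* Let $\nu\in\mathbb{R}$, $a>0$, $\kappa=1+a$, and $\zeta=\tfrac14 z^2$. Let $\mathbf{L}_\nu(z;a)$ be the generalised Struve function and let $E_{1,2}$ and $H_{1,2}$ be the formal exponential and algebraic expansions, all as defined in the context. Then $$(\tfrac12 z)^{-\nu-1}\,\mathbf{L}_\nu(z;a)\sim\begin{cases} E_{1,2}(\zeta)+E_{1,2}(\zeta e^{\mp2\pi i})+H_{1,2}(\zeta e^{\mp\pi i}) & (1<\kappa\le 2),\\[2mm] \displaystyle\sum_{n=-N}^{N}E_{1,2}(\zeta e^{2\pi i n})+H_{1,2}(\zeta e^{\mp\pi i}) & (\kappa>2)\end{cases}$$ as $|z|\to\infty$ in the sector $|\arg z|\le\tfrac12\pi$. The integer $N$ is chosen to be the smallest integer satisfying $2N+1>\tfrac12\kappa$, and the upper or lower signs are chosen according as $\arg z>0$ or $\arg z<0$, respectively.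
   Context: **Generalised Struve function.** For real $\nu$ and real $a>-1$, $$\mathbf{L}_\nu(z;a)=(\tfrac12 z)^{\nu+1}\sum_{n=0}^\infty\frac{(\frac12 z)^{2n}}{\Gamma(n+\frac32)\,\Gamma(an+\nu+\frac32)}.$$ Thus $(\tfrac12 z)^{-\nu-1}\mathbf{L}_\nu(z;a)=\sum_{n\ge0}\zeta^n/\{\Gamma(n+\frac32)\Gamma(an+\nu+\frac32)\}$ with $\zeta=\frac14z^2$, $\arg\zeta=2\arg z$. **Parameters** (for $a>0$): $$\kappa=1+a,\quad h=a^{-a},\quad \vartheta=-\nu-\tfrac32,\quad \vartheta'=1-\vartheta,\quad A_0=\frac{1}{\sqrt{2\pi}}\Bigl(\frac{\kappa}{a}\Bigr)^{\nu+1}.$$ **Algebraic expansion** (formal asymptotic sum): $$H_{1,2}(\zeta)=\frac1\pi\sum_{k=0}^\infty\frac{\Gamma(k+\frac12)\,\zeta^{-k-1}}{\Gamma(\nu+\frac32-a(1+k))}.$$ **Exponential expansion** (formal asymptotic sum): $$E_{1,2}(\zeta)=A_0Z^{\vartheta}e^{Z}\sum_{j=0}^\infty c_jZ^{-j},\qquad Z=\kappa(h\zeta)^{1/\kappa}.$$ In $E_{1,2}(\zeta e^{2\pi i n})$ the argument is not reduced modulo $2\pi$: the corresponding $Z$ has $|Z|=\kappa(h|\zeta|)^{1/\kappa}$ and $\arg Z=(\arg\zeta+2\pi n)/\kappa$. **Coefficients.** The $c_j=c_j(a,\nu)$, with $c_0=1$, are independent of $s$ and are those in the inverse factorial expansion,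 for positive integer $M$, $$\frac{1}{\Gamma(s+\frac32)\Gamma(as+\nu+\frac32)}=\kappa A_0(h\kappa^\kappa)^s\Bigl\{\sum_{j=0}^{M-1}\frac{c_j}{\Gamma(\kappa s+\vartheta'+j)}+\frac{\rho_M(s)}{\Gamma(\kappa s+\vartheta'+M)}\Bigr\},$$ with $\rho_M(s)=O(1)$ as $|s|\to\infty$ in $|\arg s|<\pi$. For example $c_1=-\frac{1}{24a}\{11+24\nu+12\nu^2-a(25+24\nu)+11a^2\}$. *)

theory Defs
  imports "HOL-Analysis.Analysis" "HOL-Library.Landau_Symbols"
begin

text \<open>
  Reciprocals of the Gamma function are written with \<^term>\<open>rGamma\<close>, the entire function
  that vanishes at the poles of \<^term>\<open>Gamma\<close>.
\<close>

definition struve_L :: "real \<Rightarrow> real \<Rightarrow> complex \<Rightarrow> complex" where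
  "struve_L \<nu> a z = (z / 2) powr of_real (\<nu> + 1) *
     (\<Sum>n. (z / 2) ^ (2 * n) * of_real (rGamma (real n + 3/2) * rGamma (a * real n + \<nu> + 3/2)))"

definition kappa :: "real \<Rightarrow> real" where
  "kappa a = 1 + a"

definition hpar :: "real \<Rightarrow> real" where
  "hpar a = a powr (- a)"

definition vartheta :: "real \<Rightarrow> real" where
  "vartheta \<nu> = - \<nu> - 3/2"

definition vartheta' :: "real \<Rightarrow> real" where
  "vartheta' \<nu> = 1 - vartheta \<nu>"

definition A0 :: "real \<Rightarrow> real \<Rightarrow> real" where
  "A0 \<nu> a = 1 / sqrt (2 * pi) * (kappa a / a) powr (\<nu> + 1)"

text \<open>
  \<open>inverse_factorial_coeffs \<nu> a c\<close> says that \<open>c\<close> is the sequence of coefficients of the inverse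
  factorial expansion. As usual, a bound as \<open>\<bar>s\<bar> \<rightarrow> \<infinity>\<close> in the open sector
  \<open>\<bar>arg s\<bar> < \<pi>\<close> means a bound that is uniform in every smaller closed sector
  \<open>\<bar>arg s\<bar> \<le> \<pi> - \<epsilon>\<close>; no such bound holds uniformly up to the negative real axis.
  The equation is only required for large \<open>s\<close> in the sector, because \<open>\<rho>\<close> is not defined at
  the poles of \<open>\<Gamma>(\<kappa>s + \<vartheta>' + M)\<close>.
\<close>

definition inverse_factorial_coeffs :: "real \<Rightarrow> real \<Rightarrow> (nat \<Rightarrow> real) \<Rightarrow> bool" where
  "inverse_factorial_coeffs \<nu> a c \<longleftrightarrow> c 0 = 1 \<and>
     (\<forall>M\<ge>1. \<exists>\<rho> :: complex \<Rightarrow> complex. \<forall>\<epsilon>>0.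
        (\<forall>\<^sub>F s in inf at_infinity (principal {s. \<bar>Arg s\<bar> \<le> pi - \<epsilon>}).
           rGamma (s + 3/2) * rGamma (of_real a * s + of_real \<nu> + 3/2) =
           of_real (kappa a * A0 \<nu> a) * of_real (hpar a * kappa a powr kappa a) powr s *
             ((\<Sum>j<M. of_real (c j) * rGamma (of_real (kappa a) * s + of_real (vartheta' \<nu>) + of_nat j))
              + \<rho> s * rGamma (of_real (kappa a) * s + of_real (vartheta' \<nu>) + of_nat M))) \<and>
        \<rho> \<in> O[inf at_infinity (principal {s. \<bar>Arg s\<bar> \<le> pi - \<epsilon>})](\<lambda>_. 1))"

text \<open>
  In the following the point \<open>\<zeta> = r e^(i\<theta>)\<close> is given by its modulus \<open>r\<close> and its argument
  \<open>\<theta>\<close>, which is not reduced modulo \<open>2\<pi>\<close>; so \<open>\<zeta> e^(2\<pi>in)\<close> is given by \<open>r\<close> and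
  \<open>\<theta> + 2\<pi>n\<close>. Real powers of \<open>Z\<close> are taken with the unreduced argument \<open>\<theta>/\<kappa>\<close>.
\<close>

definition Zmod :: "real \<Rightarrow> real \<Rightarrow> real" where
  "Zmod a r = kappa a * (hpar a * r) powr (1 / kappa a)"

definition Zarg :: "real \<Rightarrow> real \<Rightarrow> real" where
  "Zarg a \<theta> = \<theta> / kappa a"

definition Zvar :: "real \<Rightarrow> real \<Rightarrow> real \<Rightarrow> complex" where
  "Zvar a r \<theta> = rcis (Zmod a r) (Zarg a \<theta>)"

definition Zpow :: "real \<Rightarrow> real \<Rightarrow> real \<Rightarrow> real \<Rightarrow> complex" where
  "Zpow a p r \<theta> = rcis (Zmod a r powr p) (p * Zarg a \<theta>)"

text \<open>The first \<open>M\<close> terms of the exponential expansion and the first \<open>K\<close> terms of the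
  algebraic expansion.\<close>

definition E_trunc ::
  "real \<Rightarrow> real \<Rightarrow> (nat \<Rightarrow> real) \<Rightarrow> nat \<Rightarrow> real \<Rightarrow> real \<Rightarrow> complex" where
  "E_trunc \<nu> a c M r \<theta> =
     of_real (A0 \<nu> a) * Zpow a (vartheta \<nu>) r \<theta> * exp (Zvar a r \<theta>) *
       (\<Sum>j<M. of_real (c j) / Zvar a r \<theta> ^ j)"

definition H_trunc :: "real \<Rightarrow> real \<Rightarrow> nat \<Rightarrow> real \<Rightarrow> real \<Rightarrow> complex" where
  "H_trunc \<nu> a K r \<theta> =
     of_real (1 / pi) * (\<Sum>k<K. of_real (Gamma (real k + 1/2) * rGamma (\<nu> + 3/2 - a * (1 + real k)))
                               / rcis r \<theta> ^ (k + 1))"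

definition compound_trunc ::
  "real \<Rightarrow> real \<Rightarrow> (nat \<Rightarrow> real) \<Rightarrow> int \<Rightarrow> int set \<Rightarrow> (int \<Rightarrow> nat) \<Rightarrow> nat \<Rightarrow> real \<Rightarrow> real \<Rightarrow> complex" where
  "compound_trunc \<nu> a c \<sigma> I M K r \<theta> =
     (\<Sum>n\<in>I. E_trunc \<nu> a c (M n) r (\<theta> + 2 * pi * of_int n)) + H_trunc \<nu> a K r (\<theta> - of_int \<sigma> * pi)"

definition compound_error ::
  "real \<Rightarrow> real \<Rightarrow> int set \<Rightarrow> (int \<Rightarrow> nat) \<Rightarrow> nat \<Rightarrow> real \<Rightarrow> real \<Rightarrow> real" where
  "compound_error \<nu> a I M K r \<theta> =
     (\<Sum>n\<in>I. cmod (Zpow a (vartheta \<nu> - real (M n)) r (\<theta> + 2 * pi * of_int n)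
                    * exp (Zvar a r (\<theta> + 2 * pi * of_int n))))
     + 1 / r ^ (K + 1)"

text \<open>
  \<open>compound_expansion \<nu> a c \<sigma> I f\<close> is the asymptotic relation
  \<open>f(z) \<sim> (\<Sum>n\<in>I. E(\<zeta> e^(2\<pi>in))) + H(\<zeta> e^(-\<sigma>\<pi>i))\<close>, where \<open>\<zeta> = z\<^sup>2/4\<close> and
  \<open>arg \<zeta> = 2 arg z\<close>, as \<open>\<bar>z\<bar> \<rightarrow> \<infinity>\<close> uniformly in \<open>0 \<le> \<sigma> arg z \<le> \<pi>/2\<close>. In the usual sense
  for sums of several formal expansions, each of them may be truncated after any number of
  terms, and the total error is of the order of the sum of the absolute values of the
  respective first omitted powers (with the exponential factors), whether or not their
  coefficients vanish. The upper signs are \<open>\<sigma> = 1\<close> and the lower signs \<open>\<sigma> = -1\<close>; for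
  \<open>arg z = 0\<close> both are allowed.
\<close>

definition compound_expansion ::
  "real \<Rightarrow> real \<Rightarrow> (nat \<Rightarrow> real) \<Rightarrow> int \<Rightarrow> int set \<Rightarrow> (complex \<Rightarrow> complex) \<Rightarrow> bool" where
  "compound_expansion \<nu> a c \<sigma> I f \<longleftrightarrow>
     (\<forall>(M :: int \<Rightarrow> nat) (K :: nat).
        (\<lambda>z. cmod (f z - compound_trunc \<nu> a c \<sigma> I M K (cmod (z\<^sup>2 / 4)) (2 * Arg z)))
        \<in> O[inf at_infinity (principal {z. 0 \<le> of_int \<sigma> * Arg z \<and> of_int \<sigma> * Arg z \<le> pi / 2})](
          \<lambda>z. compound_error \<nu> a I M K (cmod (z\<^sup>2 / 4)) (2 * Arg z)))"

end

theory Submission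
  imports Defs "HOL-Complex_Analysis.Complex_Analysis" "HOL-Real_Asymp.Real_Asymp"
begin

text \<open>
  Write \<open>g(n)\<close> for the coefficient of \<open>\<zeta>^n\<close>. By the reflection formula, the first \<open>K\<close> terms of
  \<open>H(\<zeta> e^(-\<pi>i))\<close> are \<open>-(\<Sum>n=-K..-1. g(n) \<zeta>^n)\<close>, so one has to estimate \<open>\<Sum>n>c. g(n) \<zeta>^n\<close> with
  \<open>-K - 1 < c < -K\<close>. An Abel--Plana formula writes this sum as \<open>\<integral>g(s) \<zeta>^s ds\<close> over \<open>[c, \<infinity>)\<close>
  plus integrals along two rays from \<open>c\<close> with the weights \<open>1/(e^(\<mp>2\<pi>is) - 1)\<close>; for \<open>\<kappa> \<ge> 2\<close> the
  latter also contain \<open>\<integral>g(s) (\<zeta> e^(-2\<pi>i))^s ds\<close>. Inserting the inverse factorial expansion turns the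
  main integrals into \<open>\<integral>Z^u/\<Gamma>(u + b) du\<close>, which is \<open>Z^(1-b) e^Z\<close> up to a small error by the same
  Abel--Plana formula with \<open>\<kappa> = 1\<close>, applied to the exponential series. All other integrals are bounded
  on suitably rotated rays, where \<open>|Z^u/\<Gamma>(u)|\<close> is at most about \<open>e^(|Z| cos \<phi>)\<close>, times \<open>|Z|^(\<kappa>c)\<close>.
  Powers of \<open>|Z|\<close> lost in these crude bounds do not matter since \<open>K\<close> and \<open>M\<close> may be increased at will.
\<close>

subsection \<open>Growth of the reciprocal Gamma function\<close>

text \<open>The expansions are treated as functions of L = log Z, with Im L = \<theta>/\<kappa> not
  reduced; replacing \<zeta> by \<zeta> e^(2 pi i n) translates L by 2 pi i n/\<kappa>. On a ray of
  angle \<phi> from c the integrand carries, besides e^(|Z| cos \<phi>), an exponential in the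
  distance t with rate \<kappa> sin \<phi> (\<phi> - Im L) above the axis and \<kappa> sin \<phi>
  (\<phi> + Im L) below it. A weight of size e^(-2 pi t sin \<phi>) beats it if \<phi> < 2
  pi/\<kappa> + Im L, respectively \<phi> < 2 pi/\<kappa> - Im L. Since Im L may reach pi/\<kappa>,
  both rays can be turned towards the vertical with room to spare exactly for \<kappa> < 2. This is
  why the analysis splits at \<kappa> = 2. All errors end up below |Z|^(\<kappa> c) e^(|Z| max(0,
  cos Im L)). Where the cosine is nonnegative this is absorbed by the first omitted exponential
  term, elsewhere by the first omitted algebraic one, so no separate treatment of the transition is
  required. Only n = 0 and one neighbour can contribute visibly; every other expansion in the
  statement is shown to be negligible. The lower signs follow from the upper ones by
  conjugation.\<close>

definition stirling_exponent :: "complex \<Rightarrow> real" where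
  "stirling_exponent u = Re (u - u * Ln u)"

text \<open>Euler's integral for Gamma(x + 1), restricted to \<open>t \<ge> x\<close> and with
  \<open>t powr x\<close> lowered to \<open>x powr x\<close>, is at least x^x e^(-x).\<close>

lemma rGamma_le_real:
  fixes x :: real
  assumes x: "x > 0"
  shows "rGamma x \<le> x * exp (x - x * ln x)"
proof -
  have i1: "((\<lambda>t. t powr x / exp t) has_integral Gamma (x + 1)) {0..}"
    using Gamma_integral_real[of "x + 1"] x by simp
  have i2: "((\<lambda>t. x powr x * exp (- 1 * t)) has_integral x powr x * (exp (- 1 * x) / 1)) {x..}"
    by (intro has_integral_mult_right has_integral_exp_minus_to_infinity) auto
  define f where "f = (\<lambda>t. if t \<in> {x..} then x powr x * exp (- 1 * t) else 0)"
  have i3: "(f has_integral x powr x * (exp (- 1 * x) / 1)) {0..}"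
    unfolding f_def by (subst has_integral_restrict) (use x i2 in auto)
  have le: "x powr x * exp (- x) \<le> Gamma (x + 1)"
    using has_integral_le[OF i3 i1] x
    by (auto simp: f_def exp_minus field_simps powr_mono2)
  have "Gamma (x + 1) = x * Gamma x"
    using x by (intro Gamma_plus1) (auto elim!: nonpos_Ints_cases)
  hence "x powr x * exp (- x) \<le> x * Gamma x" using le by simp
  moreover have "Gamma x > 0" using x by (rule Gamma_real_pos)
  ultimately have "inverse (Gamma x) \<le> x / (x powr x * exp (- x))"
    using x by (simp add: field_simps)
  also have "\<dots> = x * exp (x - x * ln x)"
    using x by (simp add: powr_def exp_minus exp_diff field_simps)
  finally show ?thesis by (simp add: rGamma_inverse_Gamma)
qed

lemma stirling_exponent_derivative:
  assumes "u + of_real t \<notin> \<real>\<^sub>\<le>\<^sub>0"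
  shows "((\<lambda>t. stirling_exponent (u + of_real t)) has_real_derivative
            - ln (cmod (u + of_real t))) (at t)"
proof -
  have nz: "u + of_real t \<noteq> 0" using assms by (metis nonpos_Reals_zero_I)
  have "((\<lambda>z. z - z * Ln z) has_field_derivative - Ln (u + of_real t)) (at (u + of_real t))"
    by (rule derivative_eq_intros refl assms | use nz in simp)+
  moreover have "((\<lambda>t. u + of_real t) has_vector_derivative 1) (at t)"
    by (auto intro!: derivative_eq_intros)
  ultimately have "((\<lambda>t. (u + of_real t) - (u + of_real t) * Ln (u + of_real t)) has_vector_derivative
      1 * (- Ln (u + of_real t))) (at t)"
    using field_vector_diff_chain_at[of "\<lambda>t. u + of_real t" 1 t "\<lambda>z. z - z * Ln z"]
    unfolding o_def by blast
  from bounded_linear.has_vector_derivative[OF bounded_linear_Re this] show ?thesis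
    using nz unfolding has_real_derivative_iff_has_vector_derivative stirling_exponent_def
    by (simp add: o_def)
qed

lemma stirling_exponent_eq:
  assumes "Re u > 0"
  shows "stirling_exponent u = Re u - Re u * ln (cmod u) + Im u * arctan (Im u / Re u)"
proof -
  have "u \<noteq> 0" using assms by auto
  thus ?thesis using assms
    by (simp add: stirling_exponent_def arg_conv_arctan[symmetric] Arg_eq_Im_Ln)
qed

text \<open>A Stirling bound without error term: the exponential is |e^s s^(-s)|. In Euler's product
  the ratio of the k-th factors for s and for Re s is exp(D k). As D decreases and h is its
  antiderivative, the product of these ratios telescopes against h, and h vanishes at infinity. What
  remains is exp(- h 0), which turns the real bound at Re s into the bound at s; the factor k = 0 is
  kept as it is and yields \<open>cmod s\<close>.\<close>

lemma norm_rGamma_le: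
  assumes s: "Re s > 0"
  shows "cmod (rGamma s) \<le> cmod s * exp (stirling_exponent s)"
proof -
  define x y where "x = Re s" and "y = Im s"
  have x: "x > 0" using s by (simp add: x_def)
  define h where "h = (\<lambda>t::real. stirling_exponent (complex_of_real x + of_real t) - stirling_exponent (s + of_real t))"
  define D where "D = (\<lambda>t::real. ln (cmod (s + of_real t)) - ln (x + t))"
  have cm: "cmod (s + of_real t) = sqrt ((x + t)\<^sup>2 + y\<^sup>2)" for t
    by (simp add: cmod_def x_def y_def)
  have cmpos: "cmod (s + of_real t) > 0" if "t \<ge> 0" for t
    using x that unfolding cm by (simp add: add_pos_nonneg)
  have h_der: "(h has_real_derivative D t) (at t)" if "t \<ge> 0" for t
  proof -
    have 1: "complex_of_real x + of_real t \<notin> \<real>\<^sub>\<le>\<^sub>0" 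
      using x that by (auto simp: complex_nonpos_Reals_iff)
    have 2: "s + of_real t \<notin> \<real>\<^sub>\<le>\<^sub>0" 
      using s that by (auto simp: complex_nonpos_Reals_iff)
    have 3: "cmod (complex_of_real x + of_real t) = x + t"
      using x that by (metis abs_of_nonneg add_nonneg_nonneg less_imp_le norm_of_real of_real_add)
    show ?thesis unfolding h_def D_def
      using DERIV_diff[OF stirling_exponent_derivative[OF 1] stirling_exponent_derivative[OF 2]]
      unfolding 3 by simp
  qed
  have D_ratio: "exp (D t) = cmod (s + of_real t) / (x + t)" if "t \<ge> 0" for t
    using x that cmpos[OF that] by (simp add: D_def exp_diff)
  have D_eq: "exp (D t) = sqrt (1 + (y / (x + t))\<^sup>2)" if "t \<ge> 0" for t
  proof -
    have "(y / (x+t))\<^sup>2 = y\<^sup>2 / (x+t)\<^sup>2" by (simp add: power_divide)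
    moreover have "1 + y\<^sup>2 / (x+t)\<^sup>2 = ((x + t)\<^sup>2 + y\<^sup>2) / (x+t)\<^sup>2"
      using x that by (simp add: field_simps)
    ultimately show ?thesis using x that
      by (simp add: D_ratio[OF that] cm real_sqrt_divide)
  qed
  have D_anti: "D t \<ge> D t'" if "0 \<le> t" "t \<le> t'" for t t'
  proof -
    have "(y / (x + t'))\<^sup>2 \<le> (y / (x + t))\<^sup>2"
      using x that unfolding power_divide by (intro divide_left_mono) (auto simp: power_mono)
    hence "exp (D t') \<le> exp (D t)" using that by (simp add: D_eq)
    thus ?thesis by simp
  qed
  have step: "cmod (s + of_nat (Suc n)) / (x + real (Suc n)) \<le> exp (h (real (Suc n)) - h (real n))" for n
  proof -
    obtain z where z: "real n < z" "z < real (Suc n)" "h (real (Suc n)) - h (real n) = (real (Suc n) - real n) * D z"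
      using MVT2[of "real n" "real (Suc n)" h D] h_der by force
    have "D (real (Suc n)) \<le> h (real (Suc n)) - h (real n)"
      using z D_anti[of z "real (Suc n)"] by (simp add: algebra_simps)
    moreover have "exp (D (real (Suc n))) = cmod (s + of_nat (Suc n)) / (x + real (Suc n))"
      using D_ratio[of "real (Suc n)"] by (simp only: of_real_of_nat_eq of_nat_0_le_iff)
    ultimately show ?thesis by (metis exp_le_cancel_iff)
  qed
  have prod: "cmod (pochhammer s (n + 1)) \<le> cmod s / x * exp (h (real n) - h 0) * pochhammer x (n + 1)" for n
  proof (induction n)
    case 0
    show ?case using x by simp
  next
    case (Suc n)
    have xp: "x + real (Suc n) > 0" using x by simp
    have "cmod (pochhammer s (Suc n + 1)) = cmod (pochhammer s (n + 1)) * cmod (s + of_nat (Suc n))"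
      by (simp add: pochhammer_Suc norm_mult)
    also have "\<dots> \<le> (cmod s / x * exp (h (real n) - h 0) * pochhammer x (n + 1)) * 
                   (exp (h (real (Suc n)) - h (real n)) * (x + real (Suc n)))"
      using step[of n] xp x by (intro mult_mono Suc.IH mult_nonneg_nonneg pochhammer_nonneg) (auto simp: field_simps)
    also have "\<dots> = cmod s / x * (exp (h (real n) - h 0) * exp (h (real (Suc n)) - h (real n)))
                  * pochhammer x (Suc n + 1)"
      unfolding Suc_eq_plus1[symmetric] pochhammer_Suc[of x "Suc n"] by (simp only: mult_ac)
    also have "\<dots> = cmod s / x * exp (h (real (Suc n)) - h 0) * pochhammer x (Suc n + 1)"
      by (simp flip: exp_add)
    finally show ?case .
  qed
  have ser: "cmod (rGamma_series s n) \<le> cmod s / x * exp (h (real n) - h 0) * rGamma_series x n" for n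
  proof -
    have "cmod (exp (s * of_real (ln (real n)))) = exp (x * ln (real n))"
      by (simp add: x_def)
    hence "cmod (rGamma_series s n) = cmod (pochhammer s (n + 1)) / (fact n * exp (x * ln (real n)))"
      by (simp only: rGamma_series_def norm_divide norm_mult norm_fact)
    also have "\<dots> \<le> (cmod s / x * exp (h (real n) - h 0) * pochhammer x (n + 1)) / (fact n * exp (x * ln (real n)))"
      by (intro divide_right_mono prod) auto
    also have "\<dots> = cmod s / x * exp (h (real n) - h 0) * rGamma_series x n"
      by (simp only: rGamma_series_def times_divide_eq_right of_real_def real_scaleR_def mult_1_right)
    finally show ?thesis .
  qed
  have h_eq: "h t = (x + t) * ln (sqrt ((x+t)\<^sup>2 + y\<^sup>2)) - (x + t) * ln (x + t) - y * arctan (y / (x + t))" if "t \<ge> 0" for t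
  proof -
    have "cmod (complex_of_real x + of_real t) = x + t"
      using x that by (metis abs_of_nonneg add_nonneg_nonneg less_imp_le norm_of_real of_real_add)
    thus ?thesis
      using x that by (simp add: h_def stirling_exponent_eq x_def[symmetric] y_def[symmetric] cm)
  qed
  \<comment> \<open>The two logarithms differ by O(1/t^2), against a factor of order t, and the
    arctan is O(1/t).\<close>
  have "((\<lambda>t. (x + t) * ln (sqrt ((x+t)\<^sup>2 + y\<^sup>2)) - (x + t) * ln (x + t) - y * arctan (y / (x + t))) \<longlongrightarrow> 0) at_top"
  proof (cases y "0 :: real" rule: linorder_cases)
    case less
    thus ?thesis by real_asymp
  next
    case equal
    thus ?thesis by (auto intro!: tendsto_eventually eventually_mono[OF eventually_ge_at_top[of 0]] simp: x less_imp_le add_nonneg_nonneg)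
  next
    case greater
    thus ?thesis by real_asymp
  qed
  hence "(h \<longlongrightarrow> 0) at_top"
    by (rule Lim_transform_eventually) (auto intro!: eventually_mono[OF eventually_ge_at_top[of 0]] simp: h_eq)
  hence h_lim: "(\<lambda>n. h (real n)) \<longlonglongrightarrow> 0"
    using filterlim_real_sequentially by (rule filterlim_compose)
  have "(\<lambda>n. cmod (rGamma_series s n)) \<longlonglongrightarrow> cmod (rGamma s)"
    by (intro tendsto_intros)
  moreover have "(\<lambda>n. cmod s / x * exp (h (real n) - h 0) * rGamma_series x n) \<longlonglongrightarrow> cmod s / x * exp (0 - h 0) * rGamma x"
    by (intro tendsto_intros h_lim)
  ultimately have "cmod (rGamma s) \<le> cmod s / x * exp (0 - h 0) * rGamma x"
    using ser by (intro LIMSEQ_le[of _ _ _ ]) blast+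
  also have "\<dots> \<le> cmod s / x * exp (0 - h 0) * (x * exp (x - x * ln x))"
    using x by (intro mult_left_mono rGamma_le_real) auto
  also have "\<dots> = cmod s * exp (stirling_exponent s)"
  proof -
    have "stirling_exponent (complex_of_real x) = x - x * ln x"
      using x by (simp add: stirling_exponent_eq)
    thus ?thesis using x by (simp add: h_def exp_diff)
  qed
  finally show ?thesis .
qed

lemma cmod_le_cmod_add_of_real:
  assumes "Re u \<ge> 0" "t \<ge> 0"
  shows "cmod u \<le> cmod (u + of_real t)"
  using assms unfolding cmod_def by (auto intro!: real_sqrt_le_mono power_mono)

text \<open>Along the real direction the slope is - ln |u + t|, and |u + t| \<ge> |u| in the right
  half-plane. A shift by b therefore gains the power |u|^(-b), as expected of 1/Gamma(u + b) against
  1/Gamma(u).\<close>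

lemma stirling_exponent_shift_le:
  assumes u: "Re u \<ge> 0" "u \<noteq> 0" and b: "b > 0"
  shows "exp (stirling_exponent (u + of_real b)) \<le> cmod u powr (- b) * exp (stirling_exponent u)"
proof -
  have nin: "u + of_real t \<notin> \<real>\<^sub>\<le>\<^sub>0" if "t \<ge> 0" for t
    using u that by (auto simp: complex_nonpos_Reals_iff complex_eq_iff)
  obtain z where z: "0 < z" "z < b"
    "stirling_exponent (u + of_real b) - stirling_exponent (u + of_real 0) = (b - 0) * - ln (cmod (u + of_real z))"
    using MVT2[OF b, of "\<lambda>t. stirling_exponent (u + of_real t)" "\<lambda>t. - ln (cmod (u + of_real t))"]
      stirling_exponent_derivative[OF nin] by blast
  have "ln (cmod u) \<le> ln (cmod (u + of_real z))"
    using cmod_le_cmod_add_of_real[of u z] u z by (intro ln_mono) auto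
  hence "b * ln (cmod u) \<le> b * ln (cmod (u + of_real z))" using b by (intro mult_left_mono) auto
  hence "stirling_exponent (u + of_real b) \<le> - b * ln (cmod u) + stirling_exponent u" using z(3) by (simp add: algebra_simps)
  hence "exp (stirling_exponent (u + of_real b)) \<le> exp (- b * ln (cmod u) + stirling_exponent u)" by simp
  also have "\<dots> = cmod u powr (- b) * exp (stirling_exponent u)"
    using u by (simp add: powr_def exp_add[symmetric] del: exp_le_cancel_iff)
  finally show ?thesis .
qed

lemma Im_mult_Im_Ln_nonneg:
  assumes "u \<noteq> 0"
  shows "Im u * Im (Ln u) \<ge> 0"
proof (cases "Im u \<ge> 0")
  case True
  thus ?thesis using Im_Ln_pos_le[OF assms] by simp
next
  case False
  hence "\<not> (0 \<le> Im (Ln u))" using Im_Ln_pos_le[OF assms] Im_Ln_le_pi[OF assms] by auto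
  thus ?thesis using False by (simp add: mult_nonpos_nonpos)
qed

lemma stirling_exponent_nonneg:
  assumes "Re u \<ge> 0" "cmod u \<le> 1"
  shows "stirling_exponent u \<ge> 0"
proof (cases "u = 0")
  case False
  have 1: "Re u * ln (cmod u) \<le> 0"
    using assms False by (intro mult_nonneg_nonpos) (auto simp: ln_le_zero_iff)
  have 2: "Im u * Im (Ln u) \<ge> 0" using False by (rule Im_mult_Im_Ln_nonneg)
  show ?thesis using 1 2 False assms by (simp add: stirling_exponent_def)
qed (simp add: stirling_exponent_def)

lemma rGamma_growth_pos:
  assumes b: "b > 0"
  shows "\<exists>C. \<forall>u. Re u \<ge> 0 \<longrightarrow>
           cmod (rGamma (u + of_real b)) \<le> C * (1 + cmod u) powr (1 - b) * exp (stirling_exponent u)"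
proof -
  have "compact (cball (0::complex) 1)" by simp
  moreover have "continuous_on (cball 0 1) (\<lambda>u::complex. rGamma (u + of_real b))"
    by (intro holomorphic_on_imp_continuous_on holomorphic_intros)
  ultimately have "compact ((\<lambda>u::complex. rGamma (u + of_real b)) ` cball 0 1)"
    by (rule compact_continuous_image[rotated])
  hence "bounded ((\<lambda>u::complex. rGamma (u + of_real b)) ` cball 0 1)"
    by (rule compact_imp_bounded)
  then obtain B where "\<forall>w\<in>(\<lambda>u::complex. rGamma (u + of_real b)) ` cball 0 1. cmod w \<le> B"
    unfolding bounded_iff by blast
  hence B: "cmod (rGamma (u + of_real b)) \<le> B" if "cmod u \<le> 1" for u
    using that by simp
  have B0: "B \<ge> 0" by (rule order_trans[OF norm_ge_zero B[of 0]]) simp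
  \<comment> \<open>The first summand serves the unit disc, where B bounds the function and the
    minimum is the least value of \<open>(1 + cmod u) powr (1 - b)\<close>. The second serves |u|
    \<ge> 1; its factor 2^b comes from |u| \<ge> (1 + |u|)/2.\<close>
  define C where "C = B / min 1 (2 powr (1 - b)) + (1 + b) * 2 powr b"
  have mpos: "min 1 ((2::real) powr (1 - b)) > 0" by simp
  show ?thesis
  proof (intro exI allI impI)
    fix u :: complex assume u: "Re u \<ge> 0"
    show "cmod (rGamma (u + of_real b)) \<le> C * (1 + cmod u) powr (1 - b) * exp (stirling_exponent u)"
    proof (cases "cmod u \<le> 1")
      case True
      have m: "min 1 (2 powr (1 - b)) \<le> (1 + cmod u) powr (1 - b)"
      proof (cases "b \<le> 1")
        case True
        have "1 powr (1 - b) \<le> (1 + cmod u) powr (1 - b)" using True by (intro powr_mono2) auto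
        thus ?thesis by simp
      next
        case False
        have "2 powr (1 - b) \<le> (1 + cmod u) powr (1 - b)"
          using False \<open>cmod u \<le> 1\<close> by (intro powr_mono2') (auto simp: add_pos_nonneg)
        thus ?thesis by simp
      qed
      have "cmod (rGamma (u + of_real b)) \<le> B" using B True by blast
      also have "B = B / min 1 (2 powr (1 - b)) * min 1 (2 powr (1 - b)) * 1"
        using mpos by (simp del: min_less_iff_conj add: less_imp_neq[OF mpos, symmetric])
      also have "\<dots> \<le> C * (1 + cmod u) powr (1 - b) * exp (stirling_exponent u)"
        using m B0 mpos b stirling_exponent_nonneg[OF u True]
        by (intro mult_mono) (auto simp: C_def)
      finally show ?thesis .
    next
      case False
      hence u1: "cmod u \<ge> 1" by simp
      have u0: "u \<noteq> 0" using u1 by auto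
      have "cmod (rGamma (u + of_real b)) \<le> cmod (u + of_real b) * exp (stirling_exponent (u + of_real b))"
        using u b by (intro norm_rGamma_le) auto
      also have "\<dots> \<le> ((1 + b) * (1 + cmod u)) * (2 powr b * (1 + cmod u) powr (- b) * exp (stirling_exponent u))"
      proof (intro mult_mono)
        have "cmod (u + of_real b) \<le> cmod u + b" using norm_triangle_ineq[of u "of_real b"] b by simp
        also have "\<dots> \<le> (1 + b) * (1 + cmod u)" using b by (simp add: field_simps)
        finally show "cmod (u + of_real b) \<le> (1 + b) * (1 + cmod u)" .
        have "cmod u powr (- b) \<le> ((1 + cmod u) / 2) powr (- b)"
          using u1 b by (intro powr_mono2') auto
        also have "\<dots> = 2 powr b * (1 + cmod u) powr (- b)"
          by (simp add: powr_divide powr_minus field_simps)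
        finally have *: "cmod u powr (- b) \<le> 2 powr b * (1 + cmod u) powr (- b)" .
        have "exp (stirling_exponent (u + of_real b)) \<le> cmod u powr (- b) * exp (stirling_exponent u)"
          by (rule stirling_exponent_shift_le[OF u u0 b])
        also have "\<dots> \<le> 2 powr b * (1 + cmod u) powr (- b) * exp (stirling_exponent u)"
          using * by (intro mult_right_mono) auto
        finally show "exp (stirling_exponent (u + of_real b)) \<le> \<dots>" .
      qed (use b in auto)
      also have "\<dots> = ((1 + b) * 2 powr b) * (1 + cmod u) powr (1 - b) * exp (stirling_exponent u)"
      proof -
        have "(1 + cmod u) * (1 + cmod u) powr (- b) = (1 + cmod u) powr (1 - b)"
          by (metis add.commute add_nonneg_pos diff_conv_add_uminus norm_ge_zero powr_add powr_one zero_less_one less_imp_le)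
        thus ?thesis by (simp only: mult_ac)
      qed
      also have "\<dots> \<le> C * (1 + cmod u) powr (1 - b) * exp (stirling_exponent u)"
        using B0 mpos by (intro mult_right_mono) (auto simp: C_def)
      finally show ?thesis .
    qed
  qed
qed

text \<open>The functional equation 1/Gamma(u + b) = (u + b)/Gamma(u + b + 1) raises b until it is
  positive. Each step costs a factor of order 1 + |u|, which is exactly the change of the exponent 1
  - b.\<close>

lemma rGamma_growth:
  fixes b :: real
  shows "\<exists>C. \<forall>u. Re u \<ge> 0 \<longrightarrow>
           cmod (rGamma (u + of_real b)) \<le> C * (1 + cmod u) powr (1 - b) * exp (stirling_exponent u)"
proof -
  \<comment> \<open>Induction on the number m of unit shifts that make the parameter positive;
    \<open>b + real m - real m\<close> is just b.\<close>
  have "\<exists>C. \<forall>u. Re u \<ge> 0 \<longrightarrow> cmod (rGamma (u + of_real (b + real m - real m))) \<le>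
          C * (1 + cmod u) powr (1 - (b + real m - real m)) * exp (stirling_exponent u)" if "b + real m > 0" for m
    using that
  proof (induction m arbitrary: b)
    case 0
    thus ?case using rGamma_growth_pos[of b] by simp
  next
    case (Suc m)
    from Suc.IH[of "b + 1"] Suc.prems obtain C where
      C: "\<And>u. Re u \<ge> 0 \<Longrightarrow> cmod (rGamma (u + of_real (b + 1))) \<le> C * (1 + cmod u) powr (1 - (b + 1)) * exp (stirling_exponent u)"
      by auto
    show ?case
    proof (intro exI allI impI)
      fix u :: complex assume u: "Re u \<ge> 0"
      have "cmod (rGamma (u + of_real b)) = cmod (u + of_real b) * cmod (rGamma (u + of_real (b + 1)))"
        using rGamma_plus1[of "u + of_real b"] by (simp add: norm_mult add.assoc flip: norm_mult)
      also have "\<dots> \<le> ((1 + \<bar>b\<bar>) * (1 + cmod u)) * (C * (1 + cmod u) powr (1 - (b + 1)) * exp (stirling_exponent u))"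
      proof (rule mult_mono[OF _ C[OF u]])
        have "cmod (u + of_real b) \<le> cmod u + \<bar>b\<bar>" using norm_triangle_ineq[of u "of_real b"] by simp
        also have "\<dots> \<le> (1 + \<bar>b\<bar>) * (1 + cmod u)" by (simp add: field_simps)
        finally show "cmod (u + of_real b) \<le> (1 + \<bar>b\<bar>) * (1 + cmod u)" .
      qed auto
      also have "\<dots> = ((1 + \<bar>b\<bar>) * C) * ((1 + cmod u) * (1 + cmod u) powr (- b)) * exp (stirling_exponent u)"
        by simp
      also have "(1 + cmod u) * (1 + cmod u) powr (- b) = (1 + cmod u) powr (1 - b)"
        by (metis add.commute add_nonneg_pos diff_conv_add_uminus norm_ge_zero powr_add powr_one zero_less_one less_imp_le)
      finally show "cmod (rGamma (u + of_real (b + real (Suc m) - real (Suc m)))) \<le>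
          ((1 + \<bar>b\<bar>) * C) * (1 + cmod u) powr (1 - (b + real (Suc m) - real (Suc m))) * exp (stirling_exponent u)" by simp
    qed
  qed
  moreover obtain m :: nat where "real m > - b" using reals_Archimedean2 by blast
  hence "b + real m > 0" by simp
  ultimately show ?thesis by simp
qed

subsection \<open>Integrals along rays\<close>

definition ray_integral :: "complex \<Rightarrow> complex \<Rightarrow> (complex \<Rightarrow> complex) \<Rightarrow> complex" where
  "ray_integral c d G = d * (LINT t:{0..}|lborel. G (c + of_real t * d))"

text \<open>The common majorant of all ray integrals. As its integral is exactly 1, a bound
  \<open>B / (1 + t)\<^sup>2\<close> for an integrand along a unit direction is a bound B for the
  integral.\<close>

lemma integrable_inverse_square:
  shows "set_integrable lborel {0..} (\<lambda>t::real. 1 / (1 + t)\<^sup>2)"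
    and "(LINT t:{0..}|lborel. 1 / (1 + t)\<^sup>2) = (1 :: real)"
proof -
  have nn: "(\<integral>\<^sup>+t. ennreal (1 / (1 + t)\<^sup>2) * indicator {0..} t \<partial>lborel) = ennreal (0 - (- 1 / (1 + 0)))"
  proof (rule nn_integral_FTC_atLeast)
    show "((\<lambda>t::real. - 1 / (1 + t)) \<longlongrightarrow> 0) at_top" by real_asymp
  qed (auto intro!: derivative_eq_intros simp: power2_eq_square)
  have eq: "(\<lambda>t. ennreal (1 / (1 + t)\<^sup>2) * indicator {0..} t) = (\<lambda>t. ennreal (indicator {0..} t *\<^sub>R (1 / (1 + t)\<^sup>2)))"
    by (auto simp: fun_eq_iff indicator_def)
  have hb: "has_bochner_integral lborel (\<lambda>t::real. indicator {0..} t *\<^sub>R (1 / (1 + t)\<^sup>2)) 1"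
    by (rule has_bochner_integral_nn_integral) (use nn in \<open>auto simp: eq\<close>)
  show "set_integrable lborel {0..} (\<lambda>t::real. 1 / (1 + t)\<^sup>2)"
    using hb unfolding set_integrable_def by (auto simp: has_bochner_integral_iff)
  show "(LINT t:{0..}|lborel. 1 / (1 + t)\<^sup>2) = (1 :: real)"
    using hb unfolding set_lebesgue_integral_def by (auto simp: has_bochner_integral_iff)
qed

lemma contour_integral_linepath_segment:
  assumes X: "X > 0" and G: "continuous_on {0..X} (\<lambda>t. G (c + of_real t * d))"
  shows "contour_integral (linepath c (c + of_real X * d)) G = d * (LINT t:{0..X}|lborel. G (c + of_real t * d))"
proof -
  let ?f = "\<lambda>t. G (c + of_real t * d)"
  have int: "set_integrable lborel {0..X} ?f" by (rule borel_integrable_atLeastAtMost'[OF G])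
  have "(?f has_integral (LINT t:{0..X}|lborel. ?f t)) {0..X}"
    using set_borel_integral_eq_integral[OF int] by (simp add: has_integral_iff)
  from has_integral_stretch_real[OF this, of X] X
  have "((\<lambda>t. ?f (X * t)) has_integral (1 / X) *\<^sub>R (LINT t:{0..X}|lborel. ?f t)) ((\<lambda>x. x / X) ` {0..X})"
    by simp
  also have "(\<lambda>x. x / X) ` {0..X} = {0..1}"
    using X by (auto simp: image_iff intro!: bexI[of _ "X * _"])
  finally have "((\<lambda>t. ?f (X * t) * (of_real X * d)) has_integral ((1 / X) *\<^sub>R (LINT t:{0..X}|lborel. ?f t)) * (of_real X * d)) {0..1}"
    by (rule has_integral_mult_left)
  also have "((1 / X) *\<^sub>R (LINT t:{0..X}|lborel. ?f t)) * (of_real X * d) = d * (LINT t:{0..X}|lborel. ?f t)"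
    using X by (simp add: scaleR_conv_of_real)
  also have "(\<lambda>t. ?f (X * t) * (of_real X * d)) = (\<lambda>t. G (linepath c (c + of_real X * d) t) * (c + of_real X * d - c))"
    by (simp add: linepath_def algebra_simps scaleR_conv_of_real)
  finally have "(G has_contour_integral d * (LINT t:{0..X}|lborel. ?f t)) (linepath c (c + of_real X * d))"
    unfolding has_contour_integral_linepath .
  thus ?thesis by (rule contour_integral_unique)
qed

lemma ray_integrable:
  assumes G: "continuous_on {0..} (\<lambda>t. G (c + of_real t * d))"
    and B: "\<And>t. t \<ge> 0 \<Longrightarrow> cmod (G (c + of_real t * d)) \<le> B / (1 + t)\<^sup>2"
  shows "set_integrable lborel {0..} (\<lambda>t. G (c + of_real t * d))"
proof -
  have "set_integrable lborel {0..} (\<lambda>t::real. B * (1 / (1 + t)\<^sup>2))"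
    by (intro set_integrable_mult_right integrable_inverse_square)
  thus ?thesis unfolding set_integrable_def
  proof (rule Bochner_Integration.integrable_bound)
    show "(\<lambda>t. indicator {0..} t *\<^sub>R G (c + of_real t * d)) \<in> borel_measurable lborel"
      using borel_measurable_continuous_on_indicator[OF _ G] by simp
    show "AE t in lborel. norm (indicator {0..} t *\<^sub>R G (c + of_real t * d))
             \<le> norm (indicator {0..} t *\<^sub>R (B * (1 / (1 + t)\<^sup>2)))"
      using B by (intro AE_I2) (auto simp: indicator_def intro!: order_trans[OF B] divide_right_mono)
  qed
qed

lemma ray_integral_limit:
  assumes G: "continuous_on {0..} (\<lambda>t. G (c + of_real t * d))"
    and B: "\<And>t. t \<ge> 0 \<Longrightarrow> cmod (G (c + of_real t * d)) \<le> B / (1 + t)\<^sup>2"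
  shows "((\<lambda>X. contour_integral (linepath c (c + of_real X * d)) G) \<longlongrightarrow> ray_integral c d G) at_top"
proof -
  have int: "set_integrable lborel {0..} (\<lambda>t. G (c + of_real t * d))"
    using G B by (rule ray_integrable)
  have "((\<lambda>X. d * (LINT t:{0..X}|lborel. G (c + of_real t * d))) \<longlongrightarrow> ray_integral c d G) at_top"
    unfolding ray_integral_def
    by (intro tendsto_mult_left tendsto_set_lebesgue_integral_at_top int) auto
  thus ?thesis
  proof (rule Lim_transform_eventually)
    show "\<forall>\<^sub>F X in at_top. d * (LINT t:{0..X}|lborel. G (c + of_real t * d)) = contour_integral (linepath c (c + of_real X * d)) G"
      using eventually_gt_at_top[of 0]
      by eventually_elim (rule contour_integral_linepath_segment[symmetric], auto intro: continuous_on_subset[OF G])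
  qed
qed

lemma norm_ray_integral_le:
  assumes G: "continuous_on {0..} (\<lambda>t. G (c + of_real t * d))"
    and B: "\<And>t. t \<ge> 0 \<Longrightarrow> cmod (G (c + of_real t * d)) \<le> B / (1 + t)\<^sup>2"
  shows "cmod (ray_integral c d G) \<le> cmod d * B"
proof -
  have int: "set_integrable lborel {0..} (\<lambda>t. G (c + of_real t * d))"
    using G B by (rule ray_integrable)
  have "cmod (LINT t:{0..}|lborel. G (c + of_real t * d)) \<le> (LINT t:{0..}|lborel. cmod (G (c + of_real t * d)))"
    by (rule set_integral_norm_bound[OF int])
  also have "\<dots> \<le> (LINT t:{0..}|lborel. B * (1 / (1 + t)\<^sup>2))"
    using B by (intro set_integral_mono set_integrable_norm int set_integrable_mult_right integrable_inverse_square) auto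
  also have "\<dots> = B" unfolding set_integral_mult_right integrable_inverse_square by simp
  finally show ?thesis unfolding ray_integral_def norm_mult by (intro mult_left_mono) auto
qed

lemma ray_integral_add:
  assumes "set_integrable lborel {0..} (\<lambda>t. F (c + of_real t * d))"
    and "set_integrable lborel {0..} (\<lambda>t. G (c + of_real t * d))"
  shows "ray_integral c d (\<lambda>s. F s + G s) = ray_integral c d F + ray_integral c d G"
  unfolding ray_integral_def using assms by (simp add: set_integral_add(2) distrib_left)

lemma ray_integral_cmult: "ray_integral c d (\<lambda>s. k * F s) = k * ray_integral c d F"
  unfolding ray_integral_def by simp

subsection \<open>Abel--Plana summation in a sector\<close>

text \<open>Has a simple pole with residue 1/(2 pi i) at every integer and decays as Im s tends to
  minus infinity; \<open>upper_weight\<close> decays in the opposite direction. By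
  \<open>- lower_weight s = 1 + upper_weight s\<close>, exchanging one for the other releases the
  unweighted integral.\<close>

abbreviation lower_weight :: "complex \<Rightarrow> complex" where
  "lower_weight s \<equiv> 1 / (exp (2 * of_real pi * \<i> * s) - 1)"

abbreviation upper_weight :: "complex \<Rightarrow> complex" where
  "upper_weight s \<equiv> 1 / (exp (- (2 * of_real pi * \<i> * s)) - 1)"

lemma exp_2pi_i_eq_1_iff: "exp (2 * of_real pi * \<i> * s) = 1 \<longleftrightarrow> s \<in> \<int>"
proof
  assume "exp (2 * of_real pi * \<i> * s) = 1"
  then obtain n :: int where "Im s = 0" "2 * pi * Re s = of_int (2 * n) * pi"
    unfolding exp_eq_1 by auto
  hence "s = of_int n" by (auto simp: complex_eq_iff)
  thus "s \<in> \<int>" by simp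
next
  assume "s \<in> \<int>"
  then obtain n where "s = of_int n" by (auto elim: Ints_cases)
  thus "exp (2 * of_real pi * \<i> * s) = 1"
    using exp_integer_2pi[of "of_int n"] by (simp add: mult_ac)
qed

lemma upper_lower_weight: "s \<notin> \<int> \<Longrightarrow> - lower_weight s = 1 + upper_weight s"
  using exp_2pi_i_eq_1_iff[of s] by (simp add: exp_minus field_simps)

lemma lower_weight_cnj: "lower_weight s = cnj (upper_weight (cnj s))"
  by (simp add: exp_cnj)

text \<open>Concerns the distance of 1 from the ray with direction \<alpha>. On a vertical line e^(2
  pi i s) runs along such a ray, and \<alpha> depends only on Re s modulo 1.\<close>

lemma cmod_one_minus_cis_ge:
  assumes "t \<ge> 0"
  shows "(cmod (of_real t * cis \<alpha> - 1))\<^sup>2 \<ge> min 1 (1 - cos \<alpha>)"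
proof -
  have "(cmod (of_real t * cis \<alpha> - 1))\<^sup>2 = (t * cos \<alpha> - 1)\<^sup>2 + (t * sin \<alpha>)\<^sup>2"
    by (simp add: cmod_power2)
  also have "\<dots> = t\<^sup>2 * ((cos \<alpha>)\<^sup>2 + (sin \<alpha>)\<^sup>2) - 2 * t * cos \<alpha> + 1"
    by algebra
  also have "\<dots> = t\<^sup>2 - 2 * t * cos \<alpha> + 1" by simp
  finally have eq: "(cmod (of_real t * cis \<alpha> - 1))\<^sup>2 = t\<^sup>2 - 2 * t * cos \<alpha> + 1" .
  show ?thesis
  proof (cases "cos \<alpha> \<ge> 0")
    case True
    have "t\<^sup>2 - 2 * t * cos \<alpha> + 1 = (1 - cos \<alpha>) + (1 - cos \<alpha>) * t\<^sup>2 + cos \<alpha> * (t - 1)\<^sup>2"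
      by (simp add: power2_eq_square algebra_simps)
    also have "\<dots> \<ge> 1 - cos \<alpha>" using True by simp
    finally show ?thesis unfolding eq by simp
  next
    case False
    hence "t * cos \<alpha> \<le> 0" using assms by (simp add: mult_nonneg_nonpos)
    moreover have "t\<^sup>2 \<ge> 0" by simp
    ultimately show ?thesis unfolding eq by linarith
  qed
qed

text \<open>By periodicity the weight on the line Re s = c + m does not depend on m, and as c is not
  an integer the ray described by e^(2 pi i s) stays away from 1. Without this uniformity in m the
  receding vertical sides of the triangles could not be discarded.\<close>

lemma lower_weight_vertical_bound:
  fixes c :: real
  assumes c: "c \<notin> \<int>"
  shows "\<exists>C>0. \<forall>(m::nat) y. cmod (lower_weight (of_real c + of_nat m + \<i> * of_real y)) \<le> C"
proof -
  define \<delta> where "\<delta> = sqrt (min 1 (1 - cos (2 * pi * c)))"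
  have "cos (2 * pi * c) \<noteq> 1"
  proof
    assume "cos (2 * pi * c) = 1"
    then obtain n :: int where "2 * pi * c = of_int n * 2 * pi" by (auto simp: cos_one_2pi_int)
    hence "c = of_int n" by simp
    thus False using c by auto
  qed
  hence "cos (2 * pi * c) < 1" using cos_le_one[of "2 * pi * c"] by linarith
  hence \<delta>: "\<delta> > 0" by (simp add: \<delta>_def)
  have "cmod (lower_weight (of_real c + of_nat m + \<i> * of_real y)) \<le> 1 / \<delta>" for m :: nat and y
  proof -
    have "2 * of_real pi * \<i> * (of_real c + of_nat m + \<i> * of_real y) =
          2 * of_real pi * \<i> * of_nat m + (- of_real (2 * pi * y) + \<i> * of_real (2 * pi * c))"
      by (simp add: algebra_simps)
    hence "exp (2 * of_real pi * \<i> * (of_real c + of_nat m + \<i> * of_real y)) =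
          exp (2 * of_real pi * \<i> * of_nat m) * (exp (- of_real (2 * pi * y)) * exp (\<i> * of_real (2 * pi * c)))"
      by (simp only: exp_add)
    also have "exp (2 * of_real pi * \<i> * of_nat m) = 1"
      using exp_2pi_i_eq_1_iff by auto
    finally have "exp (2 * of_real pi * \<i> * (of_real c + of_nat m + \<i> * of_real y)) - 1 =
       of_real (exp (- (2 * pi * y))) * cis (2 * pi * c) - 1"
      by (simp add: cis_conv_exp flip: exp_of_real)
    hence "cmod (exp (2 * of_real pi * \<i> * (of_real c + of_nat m + \<i> * of_real y)) - 1) \<ge> \<delta>"
      using cmod_one_minus_cis_ge[of "exp (- (2 * pi * y))" "2 * pi * c"] unfolding \<delta>_def
      by (metis exp_ge_zero norm_ge_zero real_le_lsqrt)
    thus ?thesis using \<delta> by (simp add: norm_divide frac_le)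
  qed
  thus ?thesis using \<delta> by (intro exI[of _ "1 / \<delta>"]) auto
qed

text \<open>Uniformity in the angle matters since the rays are turned depending on |Z|. Near c the
  denominator is bounded below by continuity at the non-integer c; at distance at least \<delta>
  from c it is bounded below because |e^(2 pi i s)| has dropped below 1 by a fixed amount.\<close>

lemma weight_ray_bound:
  fixes c :: real
  assumes c: "c \<notin> \<int>" and \<phi>m: "\<phi>m > 0"
  shows "\<exists>C>0. \<forall>\<phi> t. \<phi>m \<le> \<phi> \<and> \<phi> \<le> pi / 2 \<and> t \<ge> 0 \<longrightarrow>
            cmod (upper_weight (of_real c + of_real t * cis \<phi>)) \<le> C * exp (- (2 * pi * t * sin \<phi>)) \<and>
            cmod (lower_weight (of_real c + of_real t * cis (- \<phi>))) \<le> C * exp (- (2 * pi * t * sin \<phi>))"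
proof (cases "\<phi>m \<le> pi / 2")
  case False
  thus ?thesis by (intro exI[of _ 1]) auto
next
  case m: True
  define g where "g = (\<lambda>s. 1 - exp (2 * of_real pi * \<i> * s))"
  have gc: "g (of_real c) \<noteq> 0"
    using c exp_2pi_i_eq_1_iff[of "of_real c"] by (auto simp: g_def)
  have "isCont g (of_real c)" unfolding g_def by (intro continuous_intros)
  then obtain \<delta> where \<delta>: "\<delta> > 0" "\<And>s. dist s (of_real c) < \<delta> \<Longrightarrow> dist (g s) (g (of_real c)) < cmod (g (of_real c)) / 2"
    using gc unfolding continuous_at_eps_delta by (metis half_gt_zero zero_less_norm_iff dist_commute)
  define q where "q = min (cmod (g (of_real c)) / 2) (1 - exp (- (2 * pi * (\<delta> * sin \<phi>m))))"
  have sm: "sin \<phi>m > 0" using m \<phi>m by (intro sin_gt_zero) auto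
  have q: "q > 0" using gc \<delta> sm by (auto simp: q_def)
  have main: "cmod (upper_weight (of_real c + of_real t * cis \<phi>)) \<le> 1 / q * exp (- (2 * pi * t * sin \<phi>))"
    if \<phi>: "\<phi>m \<le> \<phi>" "\<phi> \<le> pi / 2" and t: "t \<ge> 0" for \<phi> t
  proof -
    define s where "s = of_real c + of_real t * cis \<phi>"
    have sin: "sin \<phi>m \<le> sin \<phi>" using \<phi> m \<phi>m by (intro sin_monotone_2pi_le) auto
    have gs: "cmod (g s) \<ge> q"
    proof (cases "t < \<delta>")
      case True
      have "dist s (of_real c) < \<delta>" using True t by (simp add: s_def dist_norm norm_mult)
      from \<delta>(2)[OF this] have "cmod (g s) \<ge> cmod (g (of_real c)) / 2"
        unfolding dist_norm using norm_triangle_ineq3[of "g s" "g (of_real c)"] by linarith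
      thus ?thesis by (simp add: q_def)
    next
      case False
      have "\<delta> * sin \<phi>m \<le> t * sin \<phi>" using False sin \<delta> sm by (intro mult_mono) auto
      hence "2 * pi * (\<delta> * sin \<phi>m) \<le> 2 * pi * (t * sin \<phi>)" by (intro mult_left_mono) auto
      moreover have "cmod (exp (2 * of_real pi * \<i> * s)) = exp (- (2 * pi * (t * sin \<phi>)))"
        by (simp add: s_def)
      ultimately have "cmod (exp (2 * of_real pi * \<i> * s)) \<le> exp (- (2 * pi * (\<delta> * sin \<phi>m)))" by simp
      hence "cmod (g s) \<ge> 1 - exp (- (2 * pi * (\<delta> * sin \<phi>m)))"
        unfolding g_def using norm_triangle_ineq2[of 1 "exp (2 * of_real pi * \<i> * s)"]
        unfolding norm_one by linarith
      thus ?thesis by (simp add: q_def)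
    qed
    have "exp (- (2 * of_real pi * \<i> * s)) - 1 = exp (- (2 * of_real pi * \<i> * s)) * g s"
      by (simp add: g_def algebra_simps exp_minus)
    moreover have "cmod (exp (- (2 * of_real pi * \<i> * s))) = exp (2 * pi * t * sin \<phi>)"
      by (simp add: s_def mult.assoc)
    ultimately have "cmod (exp (- (2 * of_real pi * \<i> * s)) - 1) = exp (2 * pi * t * sin \<phi>) * cmod (g s)"
      by (simp only: norm_mult)
    hence "cmod (upper_weight s) = exp (- (2 * pi * t * sin \<phi>)) / cmod (g s)"
      by (simp only: norm_divide norm_one) (simp add: exp_minus field_simps)
    also have "\<dots> \<le> exp (- (2 * pi * t * sin \<phi>)) / q"
      using gs q by (intro divide_left_mono) (auto intro!: mult_pos_pos)
    finally show ?thesis by (simp add: s_def)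
  qed
  have "cmod (lower_weight (of_real c + of_real t * cis (- \<phi>))) = cmod (upper_weight (of_real c + of_real t * cis \<phi>))" for \<phi> t
    unfolding lower_weight_cnj complex_mod_cnj by (simp add: cis_cnj)
  thus ?thesis using main q by (intro exI[of _ "1 / q"]) auto
qed

lemma not_Ints_ray:
  fixes c :: real
  assumes "c \<notin> \<int>" "sin \<phi> \<noteq> 0"
  shows "of_real c + of_real t * cis \<phi> \<notin> \<int>"
proof
  assume "of_real c + of_real t * cis \<phi> \<in> \<int>"
  then obtain n where n: "of_real c + of_real t * cis \<phi> = of_int n" by (auto elim: Ints_cases)
  hence "t = 0" using assms by (simp add: complex_eq_iff)
  hence "c = of_int n" using n by (simp add: complex_eq_iff)
  thus False using assms by auto
qed

section \<open>Decay in a sector and rotation of rays\<close>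

definition decays_on_sector :: "complex \<Rightarrow> real \<Rightarrow> (complex \<Rightarrow> complex) \<Rightarrow> bool" where
  "decays_on_sector c \<phi> F \<longleftrightarrow>
     (\<exists>B. \<forall>\<rho> \<psi>. \<rho> \<ge> 0 \<and> \<bar>\<psi>\<bar> \<le> \<phi> \<longrightarrow> cmod (F (c + of_real \<rho> * cis \<psi>)) \<le> B / (1 + \<rho>)\<^sup>2)"

lemma decays_on_sector_vertical:
  assumes "decays_on_sector c \<phi> F" and \<phi>: "0 < \<phi>" "\<phi> < pi / 2"
  shows "\<exists>B\<ge>0. \<forall>x y. x > 0 \<and> \<bar>y\<bar> \<le> x * tan \<phi> \<longrightarrow> cmod (F (c + of_real x + \<i> * of_real y)) \<le> B / (1 + x)\<^sup>2"
proof -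
  obtain B where B: "\<And>\<rho> \<psi>. \<rho> \<ge> 0 \<Longrightarrow> \<bar>\<psi>\<bar> \<le> \<phi> \<Longrightarrow> cmod (F (c + of_real \<rho> * cis \<psi>)) \<le> B / (1 + \<rho>)\<^sup>2"
    using assms(1) unfolding decays_on_sector_def by blast
  have B0: "B \<ge> 0" using B[of 0 0] \<phi> by (auto intro: order_trans[OF norm_ge_zero])
  have "cmod (F (c + of_real x + \<i> * of_real y)) \<le> B / (1 + x)\<^sup>2" if x: "x > 0" and y: "\<bar>y\<bar> \<le> x * tan \<phi>" for x y
  proof -
    define w where "w = of_real x + \<i> * of_real y"
    have ar: "Arg w = arctan (y / x)" using x by (simp add: w_def arg_conv_arctan)
    have "\<bar>y / x\<bar> \<le> tan \<phi>" using y x by (simp add: abs_divide field_simps)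
    hence "- tan \<phi> \<le> y / x" "y / x \<le> tan \<phi>" by linarith+
    hence "\<bar>arctan (y / x)\<bar> \<le> \<phi>"
      using arctan_monotone'[of "y / x" "tan \<phi>"] arctan_monotone'[of "- tan \<phi>" "y / x"] \<phi>
      by (simp add: arctan_minus arctan_tan abs_le_iff)
    moreover have "w = of_real (cmod w) * cis (Arg w)"
      using rcis_cmod_Arg[of w] by (simp add: rcis_def)
    ultimately have "cmod (F (c + w)) \<le> B / (1 + cmod w)\<^sup>2"
      using B[of "cmod w" "Arg w"] by (simp add: ar)
    also have "\<dots> \<le> B / (1 + x)\<^sup>2"
    proof (intro divide_left_mono B0 power_mono)
      show "1 + x \<le> 1 + cmod w" using abs_Re_le_cmod[of w] x by (simp add: w_def)
    qed (use x in \<open>auto intro!: mult_pos_pos zero_less_power add_pos_nonneg\<close>)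
    finally show ?thesis by (simp add: w_def add.assoc)
  qed
  thus ?thesis using B0 by blast
qed

text \<open>A vertical side at distance X from the apex has length O(X), against the decay X^(-2) of
  F. The set S restricts X to the positions where W is bounded: natural numbers for the Abel--Plana
  weight, whose poles must be avoided, and all reals for W = 1.\<close>

lemma vertical_integral_tendsto_0:
  assumes F: "decays_on_sector c \<phi> F" and \<phi>: "0 < \<phi>" "\<phi> < pi / 2"
    and W: "\<And>x y. x \<in> S \<Longrightarrow> x > 0 \<Longrightarrow> cmod (W (c + of_real x + \<i> * of_real y)) \<le> C"
    and X: "filterlim X at_top sequentially" "\<And>n. X n \<in> S"
    and y: "\<And>n. \<bar>y1 n\<bar> \<le> X n * tan \<phi>" "\<And>n. \<bar>y2 n\<bar> \<le> X n * tan \<phi>"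
  assumes int: "\<And>n. X n > 0 \<Longrightarrow> (\<lambda>s. F s * W s) contour_integrable_on
                  linepath (c + of_real (X n) + \<i> * of_real (y1 n)) (c + of_real (X n) + \<i> * of_real (y2 n))"
  shows "(\<lambda>n. contour_integral (linepath (c + of_real (X n) + \<i> * of_real (y1 n)) (c + of_real (X n) + \<i> * of_real (y2 n)))
            (\<lambda>s. F s * W s)) \<longlonglongrightarrow> 0"
proof -
  obtain B where B0: "B \<ge> 0" and B: "\<And>x y. x > 0 \<Longrightarrow> \<bar>y\<bar> \<le> x * tan \<phi> \<Longrightarrow> cmod (F (c + of_real x + \<i> * of_real y)) \<le> B / (1 + x)\<^sup>2"
    using decays_on_sector_vertical[OF F \<phi>] by blast
  have lim: "((\<lambda>x::real. B / (1 + x)\<^sup>2 * C * (2 * (x * tan \<phi>))) \<longlongrightarrow> 0) at_top"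
    by real_asymp
  have evX: "\<forall>\<^sub>F n in sequentially. X n > 0"
    using X(1) unfolding filterlim_at_top_dense by blast
  show ?thesis
  proof (rule Lim_null_comparison)
    show "(\<lambda>n. B / (1 + X n)\<^sup>2 * C * (2 * (X n * tan \<phi>))) \<longlonglongrightarrow> 0"
      using filterlim_compose[OF lim X(1)] .
    show "\<forall>\<^sub>F n in sequentially. cmod (contour_integral (linepath (c + of_real (X n) + \<i> * of_real (y1 n))
             (c + of_real (X n) + \<i> * of_real (y2 n))) (\<lambda>s. F s * W s)) \<le> B / (1 + X n)\<^sup>2 * C * (2 * (X n * tan \<phi>))"
      using evX
    proof eventually_elim
      case (elim n)
      have C0: "C \<ge> 0" using W[OF X(2) elim, of 0] by (auto intro: order_trans[OF norm_ge_zero])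
      let ?a = "c + of_real (X n) + \<i> * of_real (y1 n)" and ?b = "c + of_real (X n) + \<i> * of_real (y2 n)"
      have "cmod (contour_integral (linepath ?a ?b) (\<lambda>s. F s * W s)) \<le> B / (1 + X n)\<^sup>2 * C * cmod (?b - ?a)"
      proof (rule contour_integral_bound_linepath[OF int[OF elim]])
        show "0 \<le> B / (1 + X n)\<^sup>2 * C" using B0 C0 by simp
      next
        fix s assume "s \<in> closed_segment ?a ?b"
        then obtain u where u: "0 \<le> u" "u \<le> 1" "s = (1 - u) *\<^sub>R ?a + u *\<^sub>R ?b"
          by (auto simp: closed_segment_def)
        define v where "v = (1 - u) * y1 n + u * y2 n"
        have s: "s = c + of_real (X n) + \<i> * of_real v"
          unfolding u(3) v_def by (simp add: algebra_simps scaleR_conv_of_real)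
        have "\<bar>v\<bar> \<le> (1 - u) * \<bar>y1 n\<bar> + u * \<bar>y2 n\<bar>"
          unfolding v_def using u by (intro order_trans[OF abs_triangle_ineq]) (simp add: abs_mult)
        also have "\<dots> \<le> (1 - u) * (X n * tan \<phi>) + u * (X n * tan \<phi>)"
          using u y[of n] by (intro add_mono mult_left_mono) auto
        also have "\<dots> = X n * tan \<phi>" by (simp add: algebra_simps)
        finally have "cmod (F s) \<le> B / (1 + X n)\<^sup>2" unfolding s using B elim by blast
        moreover have "cmod (W s) \<le> C" unfolding s using W X(2) elim by blast
        ultimately show "cmod (F s * W s) \<le> B / (1 + X n)\<^sup>2 * C"
          unfolding norm_mult using B0 by (intro mult_mono) auto
      qed
      also have "cmod (?b - ?a) = \<bar>y2 n - y1 n\<bar>"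
      proof -
        have "?b - ?a = \<i> * of_real (y2 n - y1 n)" by (simp add: algebra_simps)
        thus ?thesis by (simp only: norm_mult norm_ii norm_of_real mult_1_left)
      qed
      also have "B / (1 + X n)\<^sup>2 * C * \<bar>y2 n - y1 n\<bar> \<le> B / (1 + X n)\<^sup>2 * C * (2 * (X n * tan \<phi>))"
        using B0 C0 y[of n] by (intro mult_left_mono) auto
      finally show ?case .
    qed
  qed
qed

lemma ray_integral_limit_seq:
  assumes "continuous_on {0..} (\<lambda>t. G (c + of_real t * d))"
    and "\<And>t. t \<ge> 0 \<Longrightarrow> cmod (G (c + of_real t * d)) \<le> B / (1 + t)\<^sup>2"
    and "filterlim X at_top sequentially"
  shows "(\<lambda>n. contour_integral (linepath c (c + of_real (X n) * d)) G) \<longlonglongrightarrow> ray_integral c d G"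
  using filterlim_compose[OF ray_integral_limit[OF assms(1,2)] assms(3)] .

lemma of_real_div_cos_cis:
  assumes "cos \<phi> \<noteq> 0"
  shows "of_real (x / cos \<phi>) * cis \<phi> = of_real x + \<i> * of_real (x * tan \<phi>)"
  using assms by (simp add: complex_eq_iff tan_def)

text \<open>Cauchy's theorem for the triangle that a vertical line cuts off between the two rays;
  the vertical side disappears in the limit.\<close>

lemma ray_rotation:
  assumes F: "F holomorphic_on UNIV" and dec: "decays_on_sector c \<phi> F"
    and \<phi>: "0 < \<phi>" "\<phi> < pi / 2" and \<psi>: "\<bar>\<psi>\<bar> \<le> \<phi>"
  shows "ray_integral c (cis \<psi>) F = ray_integral c 1 F"
proof -
  have cosp: "cos \<psi> > 0" using \<phi> \<psi> by (intro cos_gt_zero_pi) auto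
  obtain B where B: "\<And>\<rho> \<psi>. \<rho> \<ge> 0 \<Longrightarrow> \<bar>\<psi>\<bar> \<le> \<phi> \<Longrightarrow> cmod (F (c + of_real \<rho> * cis \<psi>)) \<le> B / (1 + \<rho>)\<^sup>2"
    using dec unfolding decays_on_sector_def by blast
  have cont: "continuous_on A F" for A
    using F holomorphic_on_imp_continuous_on holomorphic_on_subset by blast
  have contray: "continuous_on {0..} (\<lambda>t. F (c + of_real t * d))" for d
    by (intro continuous_on_compose2[OF cont[of UNIV]] continuous_intros) auto
  let ?X = "\<lambda>n::nat. real n"
  define a where "a = (\<lambda>n. contour_integral (linepath c (c + of_real (real n) * 1)) F)"
  \<comment> \<open>The length \<open>n / cos \<psi>\<close> lets the slanted side end on the same
    vertical line as the horizontal side of length n.\<close>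
  define b where "b = (\<lambda>n. contour_integral (linepath c (c + of_real (real n / cos \<psi>) * cis \<psi>)) F)"
  define v where "v = (\<lambda>n. contour_integral (linepath (c + of_real (real n) + \<i> * of_real 0) (c + of_real (real n) + \<i> * of_real (real n * tan \<psi>))) F)"
  have a: "a \<longlonglongrightarrow> ray_integral c 1 F"
    unfolding a_def using B[of _ 0] \<phi>
    by (intro ray_integral_limit_seq[where B = B] contray filterlim_real_sequentially) auto
  have b: "b \<longlonglongrightarrow> ray_integral c (cis \<psi>) F"
    unfolding b_def using B \<psi>
    by (intro ray_integral_limit_seq[where B = B] contray) (auto, use cosp in real_asymp)
  have tan: "\<bar>tan \<psi>\<bar> \<le> tan \<phi>"
    using tan_mono_le[of \<psi> \<phi>] tan_mono_le[of "-\<phi>" \<psi>] \<phi> \<psi> by (auto simp: abs_le_iff)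
  have v: "v \<longlonglongrightarrow> 0"
  proof -
    have "(\<lambda>n. contour_integral (linepath (c + of_real (real n) + \<i> * of_real 0) (c + of_real (real n) + \<i> * of_real (real n * tan \<psi>))) (\<lambda>s. F s * 1)) \<longlonglongrightarrow> 0"
    proof (rule vertical_integral_tendsto_0[OF dec \<phi>, where C = 1 and S = UNIV])
      fix n :: nat
      show "\<bar>0\<bar> \<le> real n * tan \<phi>" using tan by (auto intro: order_trans[OF abs_ge_zero])
      show "\<bar>real n * tan \<psi>\<bar> \<le> real n * tan \<phi>" using tan by (simp add: abs_mult mult_left_mono)
    next
      fix n :: nat
      show "(\<lambda>s. F s * 1) contour_integrable_on
         linepath (c + of_real (real n) + \<i> * of_real 0) (c + of_real (real n) + \<i> * of_real (real n * tan \<psi>))"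
        by (intro contour_integrable_continuous_linepath continuous_intros cont)
    qed (auto simp: filterlim_real_sequentially)
    thus ?thesis by (simp add: v_def)
  qed
  have eq: "a n + v n - b n = 0" for n
  proof -
    define p q where "p = c + of_real (real n)" and "q = c + of_real (real n) + \<i> * of_real (real n * tan \<psi>)"
    have "(F has_contour_integral 0) (linepath c p +++ linepath p q +++ linepath q c)"
      by (rule Cauchy_theorem_triangle) (rule holomorphic_on_subset[OF F], auto)
    hence "contour_integral (linepath c p +++ linepath p q +++ linepath q c) F = 0"
      by (rule contour_integral_unique)
    moreover have ci: "F contour_integrable_on linepath u w" for u w
      by (intro contour_integrable_continuous_linepath cont)
    ultimately have "contour_integral (linepath c p) F + (contour_integral (linepath p q) F + contour_integral (linepath q c) F) = 0"
      by (simp add: contour_integrable_join)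
    moreover have "contour_integral (linepath q c) F = - contour_integral (linepath c q) F"
      by (intro contour_integral_reverse_linepath cont)
    moreover have "c + of_real (real n / cos \<psi>) * cis \<psi> = q"
      unfolding q_def using of_real_div_cos_cis[of \<psi> "real n"] cosp by (simp add: add.assoc)
    hence "b n = contour_integral (linepath c q) F" by (simp add: b_def)
    moreover have "a n = contour_integral (linepath c p) F" "v n = contour_integral (linepath p q) F"
      by (simp_all add: a_def v_def p_def q_def)
    ultimately show ?thesis by (simp add: algebra_simps)
  qed
  have "(\<lambda>n. a n + v n - b n) \<longlonglongrightarrow> ray_integral c 1 F + 0 - ray_integral c (cis \<psi>) F"
    by (intro tendsto_intros a b v)
  hence "(\<lambda>n::nat. 0::complex) \<longlonglongrightarrow> ray_integral c 1 F + 0 - ray_integral c (cis \<psi>) F"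
    by (simp add: eq)
  hence "ray_integral c 1 F + 0 - ray_integral c (cis \<psi>) F = 0"
    using LIMSEQ_unique tendsto_const by metis
  thus ?thesis by simp
qed

section \<open>Residues in a triangle and the summation formula\<close>

lemma sector_triangle_interior:
  fixes c x \<tau> X :: real
  assumes "0 < x" "x < X" "\<tau> > 0"
  shows "of_real (c + x) \<in> interior (convex hull {of_real c, of_real c + of_real X + \<i> * of_real (- X * \<tau>),
            of_real c + of_real X + \<i> * of_real (X * \<tau>)})" (is "_ \<in> interior (convex hull {?a, ?b, ?e})")
proof -
  define U where "U = {s. c < Re s} \<inter> {s. Re s < c + X} \<inter> {s. Im s < \<tau> * (Re s - c)} \<inter> {s. - \<tau> * (Re s - c) < Im s}"
  have "open U" unfolding U_def
    by (intro open_Int open_Collect_less continuous_intros)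
  moreover have "U \<subseteq> convex hull {?a, ?b, ?e}"
  proof
    fix s assume s: "s \<in> U"
    have X0: "X > 0" using assms by simp
    define r where "r = Re s - c"
    \<comment> \<open>Barycentric coordinates for the upper (\<beta>) and the lower (\<alpha>)
      corner; the apex receives \<open>1 - r / X\<close>.\<close>
    define \<beta> \<alpha> where "\<beta> = (r / X + Im s / (X * \<tau>)) / 2" and "\<alpha> = (r / X - Im s / (X * \<tau>)) / 2"
    have "Im s / \<tau> \<le> r" "- r \<le> Im s / \<tau>"
      using s assms by (auto simp: U_def r_def field_simps)
    hence "Im s / \<tau> / X \<le> r / X" "- r / X \<le> Im s / \<tau> / X"
      using X0 by (blast intro: divide_right_mono less_imp_le)+
    hence "Im s / (X * \<tau>) \<le> r / X" "- r / X \<le> Im s / (X * \<tau>)"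
      by (simp_all add: mult.commute)
    hence "Im s / (X * \<tau>) \<le> r / X" "- (r / X) \<le> Im s / (X * \<tau>)" by simp_all
    hence nn: "0 \<le> \<alpha>" "0 \<le> \<beta>" by (auto simp: \<alpha>_def \<beta>_def)
    have sum: "\<alpha> + \<beta> = r / X" by (simp add: \<alpha>_def \<beta>_def field_simps)
    have dif: "(\<beta> - \<alpha>) * (X * \<tau>) = Im s" using assms X0 by (simp add: \<alpha>_def \<beta>_def field_simps)
    have "r / X \<le> 1" using s X0 by (simp add: U_def r_def)
    have "s = (1 - r / X) *\<^sub>R ?a + \<alpha> *\<^sub>R ?b + \<beta> *\<^sub>R ?e"
    proof (rule complex_eqI)
      have "Re ((1 - r / X) *\<^sub>R ?a + \<alpha> *\<^sub>R ?b + \<beta> *\<^sub>R ?e) = (1 - r / X) * c + (\<alpha> + \<beta>) * (c + X)"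
        by (simp add: algebra_simps)
      also have "\<dots> = Re s" unfolding sum using X0 by (simp add: r_def field_simps)
      finally show "Re s = Re ((1 - r / X) *\<^sub>R ?a + \<alpha> *\<^sub>R ?b + \<beta> *\<^sub>R ?e)" ..
      have "Im ((1 - r / X) *\<^sub>R ?a + \<alpha> *\<^sub>R ?b + \<beta> *\<^sub>R ?e) = (\<beta> - \<alpha>) * (X * \<tau>)"
        by (simp add: algebra_simps)
      thus "Im s = Im ((1 - r / X) *\<^sub>R ?a + \<alpha> *\<^sub>R ?b + \<beta> *\<^sub>R ?e)" using dif by simp
    qed
    moreover have "(1 - r / X) + \<alpha> + \<beta> = 1" using sum by simp
    ultimately show "s \<in> convex hull {?a, ?b, ?e}"
      unfolding convex_hull_3 mem_Collect_eq using nn \<open>r / X \<le> 1\<close> by (metis diff_ge_0_iff_ge)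
  qed
  ultimately have "U \<subseteq> interior (convex hull {?a, ?b, ?e})" by (rule interior_maximal[rotated])
  moreover have "of_real (c + x) \<in> U" using assms by (auto simp: U_def)
  ultimately show ?thesis by blast
qed

text \<open>Where F vanishes there is no pole, and the derivative formula for simple poles does not
  apply directly. There the residue is the difference of those belonging to F + 1 and to the
  constant 1, neither of which vanishes at the point.\<close>

lemma residue_lower_weight:
  assumes F: "F holomorphic_on UNIV"
  shows "residue (\<lambda>s. F s * lower_weight s) (of_int n) = F (of_int n) / (2 * of_real pi * \<i>)"
proof -
  have nonzero: "residue (\<lambda>w. G w / (exp (2 * of_real pi * \<i> * w) - 1)) (of_int n) = G (of_int n) / (2 * of_real pi * \<i>)"
    if G: "G holomorphic_on UNIV" "G (of_int n) \<noteq> 0" for G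
  proof (rule residue_simple_pole_deriv[where s = UNIV])
    show "((\<lambda>w. exp (2 * of_real pi * \<i> * w) - 1) has_field_derivative 2 * of_real pi * \<i>) (at (of_int n))"
      using exp_2pi_i_eq_1_iff[of "of_int n"] by (auto intro!: derivative_eq_intros)
    show "exp (2 * of_real pi * \<i> * of_int n) - 1 = 0" using exp_2pi_i_eq_1_iff[of "of_int n"] by simp
  qed (use G in \<open>auto intro!: holomorphic_intros\<close>)
  show ?thesis
  proof (cases "F (of_int n) = 0")
    case False
    thus ?thesis using nonzero[OF F] by simp
  next
    case True
    define U :: "complex set" where "U = ball (of_int n) 1"
    have nz: "exp (2 * of_real pi * \<i> * w) \<noteq> 1" if w: "w \<in> U - {of_int n}" for w
    proof
      assume "exp (2 * of_real pi * \<i> * w) = 1"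
      then obtain k where k: "w = of_int k" unfolding exp_2pi_i_eq_1_iff by (auto elim: Ints_cases)
      have "cmod (of_int (k - n)) < 1" using w unfolding U_def k by (simp add: dist_norm norm_minus_commute)
      hence "k = n" unfolding norm_of_int by linarith
      thus False using w k by simp
    qed
    have "residue (\<lambda>s. (F s + 1) / (exp (2 * of_real pi * \<i> * s) - 1) - 1 / (exp (2 * of_real pi * \<i> * s) - 1)) (of_int n)
       = residue (\<lambda>s. (F s + 1) / (exp (2 * of_real pi * \<i> * s) - 1)) (of_int n) - residue (\<lambda>s. 1 / (exp (2 * of_real pi * \<i> * s) - 1)) (of_int n)"
      using nz by (intro residue_diff[where s = U] holomorphic_intros holomorphic_on_subset[OF F]) (auto simp: U_def)
    also have "\<dots> = (F (of_int n) + 1) / (2 * of_real pi * \<i>) - 1 / (2 * of_real pi * \<i>)"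
      using nonzero[of "\<lambda>s. F s + 1"] nonzero[of "\<lambda>_. 1"] F True by (simp add: holomorphic_intros)
    finally show ?thesis by (simp add: diff_divide_distrib[symmetric])
  qed
qed

lemma triangle_residues:
  fixes c \<tau> :: real and m :: nat
  assumes F: "F holomorphic_on UNIV" and c: "c \<notin> \<int>" and \<tau>: "\<tau> > 0" and m: "m > 0"
  defines "b \<equiv> of_real c + of_real (real m) + \<i> * of_real (- real m * \<tau>)"
    and "e \<equiv> of_real c + of_real (real m) + \<i> * of_real (real m * \<tau>)"
  shows "contour_integral (linepath (of_real c) b +++ linepath b e +++ linepath e (of_real c)) (\<lambda>s. F s * lower_weight s)
           = (\<Sum>j<m. F (of_int (\<lfloor>c\<rfloor> + 1 + int j)))"
proof -
  \<comment> \<open>An open convex strip that contains the triangle and no integers besides the m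
    enclosed ones.\<close>
  define S where "S = {s. of_int \<lfloor>c\<rfloor> < Re s} \<inter> {s. Re s < of_int \<lfloor>c\<rfloor> + real m + 1}"
  define pt where "pt = (\<lambda>j::nat. complex_of_int (\<lfloor>c\<rfloor> + 1 + int j))"
  define pts where "pts = pt ` {..<m}"
  have inj: "inj_on pt A" for A by (auto simp: inj_on_def pt_def)
  have fl: "of_int \<lfloor>c\<rfloor> < c" "c < of_int \<lfloor>c\<rfloor> + 1"
    using c by (metis Ints_of_int of_int_floor_le order_le_less, linarith)
  let ?g = "linepath (of_real c) b +++ linepath b e +++ linepath e (of_real c)"
  have conv: "convex S" unfolding S_def
    by (intro convex_Int convex_halfspace_Re_gt convex_halfspace_Re_lt)
  have vertices: "of_real c \<in> S" "b \<in> S" "e \<in> S" using fl m unfolding S_def b_def e_def by (auto intro!: less_le_trans[OF fl(2)])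
  have int_S: "s \<in> pts" if "s \<in> S" "s \<in> \<int>" for s
  proof -
    from that obtain n where n: "s = of_int n" by (auto elim: Ints_cases)
    have "\<lfloor>c\<rfloor> < n" "n < \<lfloor>c\<rfloor> + int m + 1" using that unfolding n S_def by auto
    hence "n = \<lfloor>c\<rfloor> + 1 + int (nat (n - \<lfloor>c\<rfloor> - 1))" "nat (n - \<lfloor>c\<rfloor> - 1) < m" by auto
    thus ?thesis unfolding n pts_def pt_def by (metis imageI lessThan_iff)
  qed
  have hull_S: "convex hull {of_real c, b, e} \<subseteq> S"
    using vertices conv by (intro hull_minimal) auto
  have inter: "pt j \<in> interior (convex hull {of_real c, b, e})" if "j < m" for j
  proof -
    have "of_real (c + (of_int \<lfloor>c\<rfloor> + 1 + real j - c)) \<in> interior (convex hull {of_real c, b, e})"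
      unfolding b_def e_def using fl that by (intro sector_triangle_interior \<tau>) linarith+
    thus ?thesis by (simp add: pt_def add.assoc)
  qed
  have path: "path_image ?g = closed_segment (of_real c) b \<union> closed_segment b e \<union> closed_segment e (of_real c)"
    by (simp add: path_image_join Un_assoc)
  have seg_hull: "path_image ?g \<subseteq> convex hull {of_real c, b, e}"
    unfolding path by (intro Un_least closed_segment_subset_convex_hull hull_inc) auto
  have seg_pts: "path_image ?g \<inter> pts = {}"
    unfolding path using inter by (auto simp: pts_def interior_of_triangle closed_segment_commute)
  have "contour_integral ?g (\<lambda>s. F s * lower_weight s)
      = 2 * pi * \<i> * (\<Sum>p\<in>pts. winding_number ?g p * residue (\<lambda>s. F s * lower_weight s) p)"
  proof (rule Residue_theorem[where S = S])
    show "open S" unfolding S_def by (intro open_Int open_halfspace_Re_gt open_halfspace_Re_lt)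
    show "connected S" using conv by (rule convex_connected)
    show "finite pts" by (simp add: pts_def)
    show "(\<lambda>s. F s * lower_weight s) holomorphic_on S - pts"
      using int_S by (intro holomorphic_intros holomorphic_on_subset[OF F]) (auto simp: exp_2pi_i_eq_1_iff)
    show "path_image ?g \<subseteq> S - pts" using seg_hull hull_S seg_pts by blast
    show "\<forall>z. z \<notin> S \<longrightarrow> winding_number ?g z = 0"
      using seg_hull hull_S conv by (intro allI impI winding_number_zero_outside[OF _ conv]) auto
  qed auto
  also have "(\<Sum>p\<in>pts. winding_number ?g p * residue (\<lambda>s. F s * lower_weight s) p) =
             (\<Sum>j<m. winding_number ?g (pt j) * residue (\<lambda>s. F s * lower_weight s) (pt j))"
    unfolding pts_def by (rule sum.reindex_cong[OF inj]) auto
  also have "\<dots> = (\<Sum>j<m. F (pt j) / (2 * of_real pi * \<i>))"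
  proof (rule sum.cong)
    fix j assume j: "j \<in> {..<m}"
    \<comment> \<open>The sign decides the orientation: a positive value means that the triangle is
      traversed counterclockwise, so that the winding number is 1 and not -1.\<close>
    have "Im ((b - of_real c) * cnj (b - pt j)) = real m * \<tau> * (of_int \<lfloor>c\<rfloor> + 1 + real j - c)"
      by (simp add: b_def pt_def algebra_simps)
    also have "\<dots> > 0" using m \<tau> by (intro mult_pos_pos) (auto intro!: less_le_trans[OF fl(2)])
    finally have "winding_number ?g (pt j) = 1"
      using winding_number_triangle[OF inter[of j]] j by simp
    moreover have "residue (\<lambda>s. F s * lower_weight s) (pt j) = F (pt j) / (2 * of_real pi * \<i>)"
      unfolding pt_def by (rule residue_lower_weight[OF F])
    ultimately show "winding_number ?g (pt j) * residue (\<lambda>s. F s * lower_weight s) (pt j) = F (pt j) / (2 * of_real pi * \<i>)"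
      by simp
  qed auto
  also have "2 * pi * \<i> * (\<Sum>j<m. F (pt j) / (2 * of_real pi * \<i>)) = (\<Sum>j<m. F (pt j))"
    by (simp add: sum_divide_distrib[symmetric])
  finally show ?thesis by (simp add: pt_def)
qed

text \<open>Integrate \<open>F s * lower_weight s\<close> around a triangle with apex c. The
  vertical side vanishes in the limit, and on the upper side \<open>- lower_weight\<close> is
  replaced by \<open>1 + upper_weight\<close>; the 1 contributes the integral of F along the upper
  ray, which is rotated to the real axis. A sector replaces the half-plane of the classical formula,
  since the functions summed later are only known to decay at angles below a right angle.\<close>

theorem abel_plana_sector:
  fixes c \<phi> :: real
  assumes F: "F holomorphic_on UNIV" and dec: "decays_on_sector (of_real c) \<phi> F"
    and c: "c \<notin> \<int>" and \<phi>: "0 < \<phi>" "\<phi> < pi / 2"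
  shows "(\<lambda>j. F (of_int (\<lfloor>c\<rfloor> + 1 + int j))) sums
           (ray_integral (of_real c) 1 F + ray_integral (of_real c) (cis \<phi>) (\<lambda>s. F s * upper_weight s)
             + ray_integral (of_real c) (cis (- \<phi>)) (\<lambda>s. F s * lower_weight s))"
proof -
  have cosp: "cos \<phi> > 0" and sinp: "sin \<phi> > 0"
    using \<phi> by (auto intro!: cos_gt_zero_pi sin_gt_zero)
  define \<tau> where "\<tau> = tan \<phi>"
  have \<tau>: "\<tau> > 0" using \<phi> by (simp add: \<tau>_def tan_gt_zero)
  obtain B where B: "\<And>\<rho> \<psi>. \<rho> \<ge> 0 \<Longrightarrow> \<bar>\<psi>\<bar> \<le> \<phi> \<Longrightarrow> cmod (F (of_real c + of_real \<rho> * cis \<psi>)) \<le> B / (1 + \<rho>)\<^sup>2"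
    using dec unfolding decays_on_sector_def by blast
  have B0: "B \<ge> 0" using B[of 0 0] \<phi> by (auto intro: order_trans[OF norm_ge_zero])
  obtain C where C0: "C > 0" and C: "\<And>t. t \<ge> 0 \<Longrightarrow> cmod (upper_weight (of_real c + of_real t * cis \<phi>)) \<le> C * exp (- (2 * pi * t * sin \<phi>))"
     "\<And>t. t \<ge> 0 \<Longrightarrow> cmod (lower_weight (of_real c + of_real t * cis (- \<phi>))) \<le> C * exp (- (2 * pi * t * sin \<phi>))"
    using weight_ray_bound[OF c \<phi>(1)] \<phi> by (metis order_refl less_imp_le)
  have eC: "C * exp (- (2 * pi * t * sin \<phi>)) \<le> C" if "t \<ge> 0" for t
    using C0 sinp that by simp
  have notint: "of_real c + of_real t * cis \<phi> \<notin> \<int>" "of_real c + of_real t * cis (- \<phi>) \<notin> \<int>" for t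
    using not_Ints_ray[OF c, of \<phi>] not_Ints_ray[OF c, of "-\<phi>"] sinp by auto
  have contF: "continuous_on A F" for A
    using F holomorphic_on_imp_continuous_on holomorphic_on_subset by blast
  have cont_wm: "continuous_on A (\<lambda>s. F s * lower_weight s)" if "A \<inter> \<int> = {}" for A
    using that by (intro continuous_intros contF) (auto simp: exp_2pi_i_eq_1_iff)
  have cont_ray: "continuous_on {0..} (\<lambda>t. G (of_real c + of_real t * cis \<psi>))"
    if "\<psi> = \<phi> \<or> \<psi> = - \<phi>" "\<And>A. A \<inter> \<int> = {} \<Longrightarrow> continuous_on A G" for G :: "complex \<Rightarrow> complex" and \<psi>
  proof (rule continuous_on_compose2[where g = G])
    show "continuous_on (range (\<lambda>t. of_real c + of_real t * cis \<psi>)) G"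
      using that(1) notint by (intro that(2)) auto
  qed (auto intro!: continuous_intros)
  \<comment> \<open>Natural distances put the vertical side at real part c + n + 1, which is not an
    integer, and make the triangle enclose exactly n + 1 integers.\<close>
  define X where "X = (\<lambda>n. real (Suc n))"
  have X: "filterlim X at_top sequentially" unfolding X_def by real_asymp
  have XS: "X n \<in> range real" for n unfolding X_def by (rule rangeI)
  have Xc: "filterlim (\<lambda>n. X n / cos \<phi>) at_top sequentially"
    unfolding X_def using cosp by real_asymp
  define bb ee where "bb = (\<lambda>n. of_real c + of_real (X n) + \<i> * of_real (- X n * \<tau>))"
    and "ee = (\<lambda>n. of_real c + of_real (X n) + \<i> * of_real (X n * \<tau>))"
  let ?G = "\<lambda>s. F s * lower_weight s"
  have bb: "bb n = of_real c + of_real (X n / cos \<phi>) * cis (- \<phi>)" for n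
    unfolding bb_def using of_real_div_cos_cis[of "- \<phi>" "X n"] cosp by (simp add: \<tau>_def add.assoc)
  have ee: "ee n = of_real c + of_real (X n / cos \<phi>) * cis \<phi>" for n
    unfolding ee_def using of_real_div_cos_cis[of "\<phi>" "X n"] cosp by (simp add: \<tau>_def add.assoc)
  have seg: "closed_segment (of_real c) (of_real c + of_real x * cis \<psi>) \<inter> \<int> = {}" if "\<psi> = \<phi> \<or> \<psi> = - \<phi>" for x \<psi>
  proof -
    have "(1 - u) *\<^sub>R of_real c + u *\<^sub>R (of_real c + of_real x * cis \<psi>) = of_real c + of_real (u * x) * cis \<psi>" for u
      by (simp add: scaleR_conv_of_real algebra_simps)
    thus ?thesis using notint that by (auto simp: closed_segment_def simp del: of_real_mult)
  qed
  have vseg: "closed_segment (bb n) (ee n) \<inter> \<int> = {}" for n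
  proof -
    have "s \<notin> \<int>" if "s \<in> closed_segment (bb n) (ee n)" for s
    proof
      assume "s \<in> \<int>"
      then obtain k where k: "s = of_int k" by (auto elim: Ints_cases)
      obtain u where "s = (1 - u) *\<^sub>R bb n + u *\<^sub>R ee n"
        using \<open>s \<in> closed_segment (bb n) (ee n)\<close> unfolding closed_segment_def by auto
      hence "Re s = (1 - u) * (c + X n) + u * (c + X n)" by (simp add: bb_def ee_def)
      hence "Re s = c + X n" by (simp add: algebra_simps)
      hence "c = of_int (k - int (Suc n))" using k by (simp add: X_def)
      thus False using c by auto
    qed
    thus ?thesis by auto
  qed
  define lo hi vv where
    "lo = (\<lambda>n. contour_integral (linepath (of_real c) (bb n)) ?G)" and
    "hi = (\<lambda>n. contour_integral (linepath (of_real c) (ee n)) ?G)" and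
    "vv = (\<lambda>n. contour_integral (linepath (bb n) (ee n)) ?G)"
  have sum_eq: "(\<Sum>j<Suc n. F (of_int (\<lfloor>c\<rfloor> + 1 + int j))) = lo n + vv n - hi n" for n
  proof -
    have 1: "?G contour_integrable_on linepath (of_real c) (bb n)"
      unfolding bb by (intro contour_integrable_continuous_linepath cont_wm seg) simp
    have 2: "?G contour_integrable_on linepath (bb n) (ee n)"
      by (intro contour_integrable_continuous_linepath cont_wm vseg)
    have 3: "?G contour_integrable_on linepath (ee n) (of_real c)"
      unfolding ee by (subst contour_integrable_continuous_linepath)
        (simp_all only: closed_segment_commute[of _ "of_real c"], intro cont_wm seg, simp)
    have "contour_integral (linepath (of_real c) (bb n) +++ linepath (bb n) (ee n) +++ linepath (ee n) (of_real c)) ?G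
        = (\<Sum>j<Suc n. F (of_int (\<lfloor>c\<rfloor> + 1 + int j)))"
      unfolding bb_def ee_def X_def by (rule triangle_residues[OF F c \<tau>]) simp
    moreover have "contour_integral (linepath (ee n) (of_real c)) ?G = - hi n"
      unfolding hi_def ee by (intro contour_integral_reverse_linepath)
        (simp only: closed_segment_commute[of _ "of_real c"], intro cont_wm seg, simp)
    ultimately show ?thesis using 1 2 3
      by (simp add: contour_integrable_join lo_def vv_def algebra_simps)
  qed
  have lo: "lo \<longlonglongrightarrow> ray_integral (of_real c) (cis (- \<phi>)) ?G"
    unfolding lo_def bb
  proof (rule ray_integral_limit_seq[where B = "B * C", OF _ _ Xc])
    show "continuous_on {0..} (\<lambda>t. ?G (of_real c + of_real t * cis (- \<phi>)))"
      by (rule cont_ray[where G = ?G]) (simp, erule cont_wm)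
    fix t :: real assume t: "t \<ge> 0"
    have "cmod (?G (of_real c + of_real t * cis (- \<phi>))) \<le> B / (1 + t)\<^sup>2 * C"
      unfolding norm_mult using B[of t "-\<phi>"] \<phi> t C(2)[OF t] eC[OF t] B0 by (intro mult_mono) auto
    thus "cmod (?G (of_real c + of_real t * cis (- \<phi>))) \<le> B * C / (1 + t)\<^sup>2" by simp
  qed
  \<comment> \<open>In the upper half-plane \<open>lower_weight\<close> tends to -1 instead of
    decaying; boundedness is enough here because F itself decays.\<close>
  have wm_hi: "cmod (lower_weight (of_real c + of_real t * cis \<phi>)) \<le> 1 + C" if t: "t \<ge> 0" for t
  proof -
    have "cmod (lower_weight (of_real c + of_real t * cis \<phi>)) = cmod (1 + upper_weight (of_real c + of_real t * cis \<phi>))"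
      using upper_lower_weight[OF notint(1)[of t]] by (metis norm_minus_cancel)
    also have "\<dots> \<le> 1 + cmod (upper_weight (of_real c + of_real t * cis \<phi>))"
      using norm_triangle_ineq[of 1] by (metis norm_one)
    finally show ?thesis using C(1)[OF t] eC[OF t] by linarith
  qed
  have hi: "hi \<longlonglongrightarrow> ray_integral (of_real c) (cis \<phi>) ?G"
    unfolding hi_def ee
  proof (rule ray_integral_limit_seq[where B = "B * (1 + C)", OF _ _ Xc])
    show "continuous_on {0..} (\<lambda>t. ?G (of_real c + of_real t * cis \<phi>))"
      by (rule cont_ray[where G = ?G]) (simp, erule cont_wm)
    fix t :: real assume t: "t \<ge> 0"
    have "cmod (?G (of_real c + of_real t * cis \<phi>)) \<le> B / (1 + t)\<^sup>2 * (1 + C)"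
      unfolding norm_mult using B[of t "\<phi>"] \<phi> t wm_hi[OF t] B0 by (intro mult_mono) auto
    thus "cmod (?G (of_real c + of_real t * cis \<phi>)) \<le> B * (1 + C) / (1 + t)\<^sup>2" by simp
  qed
  obtain C' where C': "\<And>(m::nat) y. cmod (lower_weight (of_real c + of_nat m + \<i> * of_real y)) \<le> C'"
    using lower_weight_vertical_bound[OF c] by blast
  have vv: "vv \<longlonglongrightarrow> 0"
    unfolding vv_def bb_def ee_def
  proof (rule vertical_integral_tendsto_0[OF dec \<phi> _ X XS])
    show "\<bar>- X n * \<tau>\<bar> \<le> X n * tan \<phi>" "\<bar>X n * \<tau>\<bar> \<le> X n * tan \<phi>" for n
      using \<tau> by (simp_all add: X_def \<tau>_def abs_mult)
    show "cmod (lower_weight (of_real c + of_real x + \<i> * of_real y)) \<le> C'" if "x \<in> range real" for x y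
      using that C' by auto
    show "?G contour_integrable_on linepath (of_real c + of_real (X n) + \<i> * of_real (- X n * \<tau>)) (of_real c + of_real (X n) + \<i> * of_real (X n * \<tau>))" for n
      using vseg[of n] by (intro contour_integrable_continuous_linepath cont_wm) (simp add: bb_def ee_def)
  qed
  have "(\<lambda>n. lo n + vv n - hi n) \<longlonglongrightarrow> ray_integral (of_real c) (cis (- \<phi>)) ?G + 0 - ray_integral (of_real c) (cis \<phi>) ?G"
    by (intro tendsto_intros lo hi vv)
  hence "(\<lambda>n. \<Sum>j<Suc n. F (of_int (\<lfloor>c\<rfloor> + 1 + int j))) \<longlonglongrightarrow> ray_integral (of_real c) (cis (- \<phi>)) ?G + 0 - ray_integral (of_real c) (cis \<phi>) ?G"
    by (simp only: sum_eq)
  hence "(\<lambda>j. F (of_int (\<lfloor>c\<rfloor> + 1 + int j))) sums (ray_integral (of_real c) (cis (- \<phi>)) ?G - ray_integral (of_real c) (cis \<phi>) ?G)"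
    unfolding sums_def filterlim_sequentially_Suc[of "\<lambda>n. \<Sum>j<n. F (of_int (\<lfloor>c\<rfloor> + 1 + int j))"]
    by simp
  moreover have "- ray_integral (of_real c) (cis \<phi>) ?G = ray_integral (of_real c) (cis \<phi>) (\<lambda>s. F s + F s * upper_weight s)"
  proof -
    have "F (of_real c + of_real t * cis \<phi>) + F (of_real c + of_real t * cis \<phi>) * upper_weight (of_real c + of_real t * cis \<phi>) =
          - 1 * ?G (of_real c + of_real t * cis \<phi>)" for t
    proof -
      have aux: "f + f * A = - 1 * (f * B)" if "- B = 1 + A" for f A B :: complex
      proof -
        have "- 1 * (f * B) = f * (- B)" by simp
        thus ?thesis unfolding that by (simp add: distrib_left)
      qed
      have "F s + F s * upper_weight s = - 1 * (F s * lower_weight s)" if "s \<notin> \<int>" for s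
        by (rule aux) (rule upper_lower_weight[OF that])
      thus ?thesis using notint by blast
    qed
    hence "ray_integral (of_real c) (cis \<phi>) (\<lambda>s. F s + F s * upper_weight s) = ray_integral (of_real c) (cis \<phi>) (\<lambda>s. - 1 * ?G s)"
      unfolding ray_integral_def by presburger
    also have "\<dots> = - 1 * ray_integral (of_real c) (cis \<phi>) ?G" by (rule ray_integral_cmult)
    finally show ?thesis by simp
  qed
  moreover have "ray_integral (of_real c) (cis \<phi>) (\<lambda>s. F s + F s * upper_weight s) =
       ray_integral (of_real c) (cis \<phi>) F + ray_integral (of_real c) (cis \<phi>) (\<lambda>s. F s * upper_weight s)"
  proof (rule ray_integral_add; rule ray_integrable)
    show "continuous_on {0..} (\<lambda>t. F (of_real c + of_real t * cis \<phi>))"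
      by (rule cont_ray) (auto intro: contF)
    show "cmod (F (of_real c + of_real t * cis \<phi>)) \<le> B / (1 + t)\<^sup>2" if "t \<ge> 0" for t
      using B[of t \<phi>] that \<phi> by simp
    show "continuous_on {0..} (\<lambda>t. F (of_real c + of_real t * cis \<phi>) * upper_weight (of_real c + of_real t * cis \<phi>))"
    proof (rule cont_ray)
      show "continuous_on A (\<lambda>s. F s * upper_weight s)" if "A \<inter> \<int> = {}" for A
        using that exp_2pi_i_eq_1_iff[of "- _"] by (intro continuous_intros contF) auto
    qed simp
    fix t :: real assume t: "t \<ge> 0"
    have "cmod (F (of_real c + of_real t * cis \<phi>) * upper_weight (of_real c + of_real t * cis \<phi>)) \<le> B / (1 + t)\<^sup>2 * C"
      unfolding norm_mult using B[of t "\<phi>"] \<phi> t C(1)[OF t] eC[OF t] B0 by (intro mult_mono) auto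
    thus "cmod (F (of_real c + of_real t * cis \<phi>) * upper_weight (of_real c + of_real t * cis \<phi>)) \<le> B * C / (1 + t)\<^sup>2" by simp
  qed
  moreover have "ray_integral (of_real c) (cis \<phi>) F = ray_integral (of_real c) 1 F"
    using \<phi> by (intro ray_rotation[OF F dec \<phi>]) auto
  ultimately show ?thesis by (simp only: diff_conv_add_uminus ac_simps)
qed

subsection \<open>Functions of Gamma type\<close>

text \<open>In the variable u = \<kappa> (s - c), and to the right of c, q is at most of the size
  that Stirling's formula gives for 1/Gamma(u + 1 - d). Thus \<kappa> is the rate of factorial decay
  and d measures the power of |u| in addition to it.\<close>

definition gamma_growth :: "real \<Rightarrow> real \<Rightarrow> real \<Rightarrow> (complex \<Rightarrow> complex) \<Rightarrow> bool" where
  "gamma_growth \<kappa> c d q \<longleftrightarrow> q holomorphic_on UNIV \<and>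
     (\<exists>B\<ge>0. \<forall>u. Re u \<ge> 0 \<longrightarrow>
        cmod (q (of_real c + u / of_real \<kappa>)) \<le> B * (1 + cmod u) powr d * exp (stirling_exponent u))"

text \<open>L stands for log Z, so the new factor is Z^(\<kappa> s). Working with L instead of Z
  keeps the argument of Z unreduced.\<close>

definition twist :: "real \<Rightarrow> (complex \<Rightarrow> complex) \<Rightarrow> complex \<Rightarrow> complex \<Rightarrow> complex" where
  "twist \<kappa> q L s = q s * exp (of_real \<kappa> * s * L)"

lemma bounded_above_on_atLeast_0:
  fixes f :: "real \<Rightarrow> real"
  assumes "continuous_on {0..} f" "(f \<longlongrightarrow> 0) at_top"
  shows "\<exists>C>0. \<forall>t\<ge>0. f t \<le> C"
proof -
  have "\<forall>\<^sub>F t in at_top. f t < 1" using assms(2) by (rule order_tendstoD) simp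
  then obtain X where X: "\<And>t. t \<ge> X \<Longrightarrow> f t < 1" unfolding eventually_at_top_linorder by blast
  have "compact (f ` {0..X})"
    by (rule compact_continuous_image) (auto intro: continuous_on_subset[OF assms(1)])
  hence "bounded (f ` {0..X})" by (rule compact_imp_bounded)
  then obtain M where "\<forall>y\<in>f ` {0..X}. norm y \<le> M" unfolding bounded_iff by blast
  hence M: "\<bar>f t\<bar> \<le> M" if "0 \<le> t" "t \<le> X" for t using that by auto
  have "f t \<le> max 1 M" if "t \<ge> 0" for t
  proof (cases "t \<ge> X")
    case True
    thus ?thesis using X[of t] by simp
  next
    case False
    thus ?thesis using M[of t] that by linarith
  qed
  thus ?thesis by (intro exI[of _ "max 1 M"]) auto
qed

lemma stirling_exponent_polar:
  assumes "\<rho> > 0" "\<bar>\<phi>\<bar> \<le> pi / 2"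
  shows "stirling_exponent (of_real \<rho> * cis \<phi>) + Re (of_real \<rho> * cis \<phi> * L) =
           \<rho> * cos \<phi> * (Re L - ln \<rho> + 1) - \<rho> * sin \<phi> * (Im L - \<phi>)"
proof -
  have "- pi < \<phi>" "\<phi> \<le> pi" using assms pi_gt_zero by linarith+
  hence "Arg (of_real \<rho> * cis \<phi>) = \<phi>" using assms by (subst Arg_times_of_real) (auto intro!: Arg_cis)
  hence "Ln (of_real \<rho> * cis \<phi>) = of_real (ln \<rho>) + \<i> * of_real \<phi>"
    using assms Arg_eq_Im_Ln[of "of_real \<rho> * cis \<phi>"]
    by (intro complex_eqI) (auto simp: norm_mult)
  thus ?thesis by (simp add: stirling_exponent_def algebra_simps)
qed

text \<open>The right-hand side is the maximum over \<rho>, attained at \<rho> = e^x. With x = ln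
  |Z| this is the saddle point |u| = |Z| of Z^u/Gamma(u).\<close>

lemma mult_one_minus_ln_le:
  fixes \<rho> x :: real
  assumes "\<rho> > 0"
  shows "\<rho> * (x - ln \<rho> + 1) \<le> exp x"
proof -
  have "ln (exp x / \<rho>) \<le> exp x / \<rho> - 1" using assms by (intro ln_le_minus_one) auto
  hence "x - ln \<rho> + 1 \<le> exp x / \<rho>" using assms by (simp add: ln_div)
  thus ?thesis using assms by (simp add: field_simps)
qed

text \<open>The cosine part is at most its value at the saddle point. The sine part is linear in
  \<rho>, and the sign of \<open>sin \<phi> * (Im L - \<phi>)\<close> tells whether it helps or has
  to be beaten by a weight. All later choices of angles trade these two parts off.\<close>

lemma stirling_exponent_polar_le:
  assumes "\<rho> \<ge> 0" "\<bar>\<phi>\<bar> \<le> pi / 2"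
  shows "stirling_exponent (of_real \<rho> * cis \<phi>) + Re (of_real \<rho> * cis \<phi> * L) \<le>
           exp (Re L) * cos \<phi> - \<rho> * sin \<phi> * (Im L - \<phi>)"
proof -
  have c: "cos \<phi> \<ge> 0" using assms by (intro cos_ge_zero) auto
  show ?thesis
  proof (cases "\<rho> = 0")
    case True
    thus ?thesis using c by (simp add: stirling_exponent_def)
  next
    case False
    hence \<rho>: "\<rho> > 0" using assms by simp
    have "cos \<phi> * (\<rho> * (Re L - ln \<rho> + 1)) \<le> cos \<phi> * exp (Re L)"
      by (intro mult_left_mono c mult_one_minus_ln_le \<rho>)
    thus ?thesis using stirling_exponent_polar[OF \<rho> assms(2), of L] by (simp add: mult_ac)
  qed
qed

lemma cmod_twist_eq:
  assumes "\<kappa> > 0"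
  shows "cmod (twist \<kappa> q L (of_real c + of_real t * cis \<phi>)) =
           exp (\<kappa> * c * Re L) * (cmod (q (of_real c + of_real (\<kappa> * t) * cis \<phi> / of_real \<kappa>)) *
             exp (Re (of_real (\<kappa> * t) * cis \<phi> * L)))"
proof -
  have "of_real \<kappa> * (of_real c + of_real t * cis \<phi>) * L = of_real (\<kappa> * c) * L + of_real (\<kappa> * t) * cis \<phi> * L"
    by (simp add: algebra_simps)
  hence "cmod (exp (of_real \<kappa> * (of_real c + of_real t * cis \<phi>) * L)) =
         exp (\<kappa> * c * Re L) * exp (Re (of_real (\<kappa> * t) * cis \<phi> * L))"
    by (simp only: norm_exp_eq_Re exp_add[symmetric]) simp
  thus ?thesis using assms by (simp add: twist_def norm_mult)
qed

lemma gamma_growth_twist_le: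
  assumes \<kappa>: "\<kappa> > 0" and q: "gamma_growth \<kappa> c d q"
  shows "\<exists>B\<ge>0. \<forall>L \<phi> t. t \<ge> 0 \<and> \<bar>\<phi>\<bar> \<le> pi / 2 \<longrightarrow>
           cmod (twist \<kappa> q L (of_real c + of_real t * cis \<phi>)) \<le>
             exp (\<kappa> * c * Re L) * (B * (1 + \<kappa> * t) powr d *
               exp (exp (Re L) * cos \<phi> - \<kappa> * t * sin \<phi> * (Im L - \<phi>)))"
proof -
  obtain B where B: "B \<ge> 0" "\<And>u. Re u \<ge> 0 \<Longrightarrow>
        cmod (q (of_real c + u / of_real \<kappa>)) \<le> B * (1 + cmod u) powr d * exp (stirling_exponent u)"
    using q unfolding gamma_growth_def by blast
  have "cmod (twist \<kappa> q L (of_real c + of_real t * cis \<phi>)) \<le>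
             exp (\<kappa> * c * Re L) * (B * (1 + \<kappa> * t) powr d *
               exp (exp (Re L) * cos \<phi> - \<kappa> * t * sin \<phi> * (Im L - \<phi>)))"
    if t: "t \<ge> 0" and \<phi>: "\<bar>\<phi>\<bar> \<le> pi / 2" for L \<phi> t
  proof -
    define u where "u = of_real (\<kappa> * t) * cis \<phi>"
    have c: "cos \<phi> \<ge> 0" using \<phi> by (intro cos_ge_zero) auto
    have kt: "\<kappa> * t \<ge> 0" using \<kappa> t by simp
    have Re: "Re u \<ge> 0" using c kt by (simp add: u_def)
    have cm: "cmod u = \<kappa> * t" using \<kappa> t by (simp add: u_def norm_mult)
    have "cmod (q (of_real c + u / of_real \<kappa>)) * exp (Re (u * L)) \<le>
          B * (1 + cmod u) powr d * exp (stirling_exponent u) * exp (Re (u * L))"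
      by (intro mult_right_mono B Re) auto
    also have "\<dots> = B * (1 + \<kappa> * t) powr d * exp (stirling_exponent u + Re (u * L))"
      by (simp add: cm exp_add)
    also have "\<dots> \<le> B * (1 + \<kappa> * t) powr d * exp (exp (Re L) * cos \<phi> - \<kappa> * t * sin \<phi> * (Im L - \<phi>))"
      using stirling_exponent_polar_le[OF kt \<phi>, of L] B(1) unfolding u_def[symmetric]
      by (intro mult_left_mono) auto
    finally show ?thesis
      unfolding cmod_twist_eq[OF \<kappa>] u_def by (intro mult_left_mono) (auto simp: mult.assoc)
  qed
  thus ?thesis using B(1) by blast
qed

lemma holomorphic_twist [holomorphic_intros]:
  assumes "gamma_growth \<kappa> c d q"
  shows "twist \<kappa> q L holomorphic_on A"
proof -
  have "q holomorphic_on A" using assms holomorphic_on_subset unfolding gamma_growth_def by blast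
  thus ?thesis unfolding twist_def by (intro holomorphic_intros)
qed

text \<open>Serves convergence only, so the constant may depend on L. The factorial decay, with
  exponent at most - \<kappa> t cos \<phi> ln(\<kappa> t) up to linear terms, beats every power and
  every exponential as long as cos \<phi> > 0.\<close>

lemma decays_on_sector_twist:
  assumes \<kappa>: "\<kappa> > 0" and q: "gamma_growth \<kappa> c d q" and \<phi>: "0 < \<phi>" "\<phi> < pi / 2"
  shows "decays_on_sector (of_real c) \<phi> (twist \<kappa> q L)"
proof -
  obtain B where B: "B \<ge> 0" "\<And>u. Re u \<ge> 0 \<Longrightarrow>
        cmod (q (of_real c + u / of_real \<kappa>)) \<le> B * (1 + cmod u) powr d * exp (stirling_exponent u)"
    using q unfolding gamma_growth_def by blast
  define a where "a = cos \<phi>"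
  have a: "a > 0" using \<phi> unfolding a_def by (intro cos_gt_zero_pi) auto
  define b where "b = a * (Re L + 1) + (\<bar>Im L\<bar> + pi / 2)"
  define f where "f = (\<lambda>t::real. (1 + \<kappa> * t) powr d * (1 + t)\<^sup>2 * exp (exp (Re L) + \<kappa> * t * (b - a * ln (\<kappa> * t))))"
  have lim: "(f \<longlongrightarrow> 0) at_top"
    unfolding f_def using \<kappa> a by real_asymp
  have "\<forall>\<^sub>F t in at_top. f t < 1 \<and> t \<ge> 0"
    using order_tendstoD(2)[OF lim, of 1] eventually_ge_at_top[of 0] by (auto elim: eventually_conj)
  then obtain X where X: "\<And>t. t \<ge> X \<Longrightarrow> f t < 1" "X \<ge> 0" unfolding eventually_at_top_linorder by blast
  define M where "M = (1 + \<kappa> * X) powr \<bar>d\<bar> * (1 + X)\<^sup>2 * exp (exp (Re L) + \<kappa> * X * \<bar>b\<bar> + a)"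
  have M: "f t \<le> M" if t: "0 < t" "t \<le> X" for t
  proof -
    have "\<kappa> * t * (0 - ln (\<kappa> * t) + 1) \<le> exp 0"
      using \<kappa> t by (intro mult_one_minus_ln_le) auto
    hence "- (\<kappa> * t * ln (\<kappa> * t)) \<le> 1" using \<kappa> t by (simp add: algebra_simps) (smt (verit) mult_pos_pos)
    hence "a * (- (\<kappa> * t * ln (\<kappa> * t))) \<le> a * 1" using a by (intro mult_left_mono) auto
    moreover have "\<kappa> * t * b \<le> \<kappa> * t * \<bar>b\<bar>" using \<kappa> t by (intro mult_left_mono) auto
    moreover have "\<kappa> * t * \<bar>b\<bar> \<le> \<kappa> * X * \<bar>b\<bar>" using \<kappa> t by (intro mult_right_mono mult_left_mono) auto
    ultimately have "exp (Re L) + \<kappa> * t * (b - a * ln (\<kappa> * t)) \<le> exp (Re L) + \<kappa> * X * \<bar>b\<bar> + a"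
      by (simp add: algebra_simps)
    moreover have "(1 + \<kappa> * t) powr d \<le> (1 + \<kappa> * X) powr \<bar>d\<bar>"
    proof -
      have "(1 + \<kappa> * t) powr d \<le> (1 + \<kappa> * t) powr \<bar>d\<bar>" using \<kappa> t by (intro powr_mono) auto
      also have "\<dots> \<le> (1 + \<kappa> * X) powr \<bar>d\<bar>" using \<kappa> t by (intro powr_mono2) auto
      finally show ?thesis .
    qed
    ultimately show ?thesis using t unfolding f_def M_def by (intro mult_mono power_mono) auto
  qed
  define K where "K = max (max 1 M) (exp (exp (Re L)))"
  have fK: "f t \<le> K" if "t \<ge> 0" for t
  proof (cases "t = 0")
    case True
    thus ?thesis by (simp add: f_def K_def)
  next
    case False
    show ?thesis
    proof (cases "t \<ge> X")
      case True
      thus ?thesis using X(1)[of t] unfolding K_def by simp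
    next
      case F: False
      thus ?thesis using M[of t] that False unfolding K_def by simp
    qed
  qed
  have main: "cmod (twist \<kappa> q L (of_real c + of_real t * cis \<psi>)) \<le> (exp (\<kappa> * c * Re L) * (B * K)) / (1 + t)\<^sup>2"
    if t: "t \<ge> 0" and \<psi>: "\<bar>\<psi>\<bar> \<le> \<phi>" for t \<psi>
  proof -
    define u where "u = of_real (\<kappa> * t) * cis \<psi>"
    have \<psi>2: "\<bar>\<psi>\<bar> \<le> pi / 2" using \<psi> \<phi> by linarith
    have c: "cos \<psi> \<ge> a" unfolding a_def using \<psi> \<phi> cos_monotone_0_pi_le[of "\<bar>\<psi>\<bar>" \<phi>] by simp
    have kt: "\<kappa> * t \<ge> 0" using \<kappa> t by simp
    have Re: "Re u \<ge> 0" using c kt a by (simp add: u_def)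
    have cm: "cmod u = \<kappa> * t" using \<kappa> t by (simp add: u_def norm_mult)
    have expo: "stirling_exponent u + Re (u * L) \<le> exp (Re L) + \<kappa> * t * (b - a * ln (\<kappa> * t))"
    proof (cases "t = 0")
      case True
      thus ?thesis by (simp add: u_def stirling_exponent_def)
    next
      case False
      hence kt': "\<kappa> * t > 0" using \<kappa> t by simp
      define e where "e = Re L - ln (\<kappa> * t) + 1"
      \<comment> \<open>The cosine may be replaced by its minimum a over the sector only where e is
        negative. Where e is nonnegative the whole product is at most e^(Re L) by the saddle point
        bound.\<close>
      have 1: "\<kappa> * t * cos \<psi> * e \<le> exp (Re L) + \<kappa> * t * a * e"
      proof (cases "e \<ge> 0")
        case True
        have "\<kappa> * t * cos \<psi> * e \<le> \<kappa> * t * 1 * e" using True kt by (intro mult_right_mono mult_left_mono cos_le_one)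
        also have "\<dots> \<le> exp (Re L)" using mult_one_minus_ln_le[OF kt', of "Re L"] by (simp add: e_def)
        also have "\<dots> \<le> exp (Re L) + \<kappa> * t * a * e" using True kt a by simp
        finally show ?thesis .
      next
        case F: False
        have "\<kappa> * t * e * cos \<psi> \<le> \<kappa> * t * e * a" using F kt c by (intro mult_left_mono_neg) (auto simp: mult_nonneg_nonpos)
        thus ?thesis by (simp add: mult_ac) (smt (verit) exp_gt_zero)
      qed
      have "\<bar>sin \<psi> * (Im L - \<psi>)\<bar> \<le> 1 * (\<bar>Im L\<bar> + pi / 2)"
        unfolding abs_mult using \<psi>2 by (intro mult_mono) auto
      hence "- (sin \<psi> * (Im L - \<psi>)) \<le> \<bar>Im L\<bar> + pi / 2"
        by (intro order_trans[OF abs_ge_minus_self]) simp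
      hence "\<kappa> * t * - (sin \<psi> * (Im L - \<psi>)) \<le> \<kappa> * t * (\<bar>Im L\<bar> + pi / 2)" using kt by (intro mult_left_mono) auto
      with 1 show ?thesis
        unfolding u_def stirling_exponent_polar[OF kt' \<psi>2] b_def e_def by (simp add: algebra_simps)
    qed
    have "cmod (q (of_real c + u / of_real \<kappa>)) * exp (Re (u * L)) \<le>
          B * (1 + cmod u) powr d * exp (stirling_exponent u) * exp (Re (u * L))"
      by (intro mult_right_mono B Re) auto
    also have "\<dots> = B * ((1 + \<kappa> * t) powr d * exp (stirling_exponent u + Re (u * L)))"
      by (simp add: cm exp_add)
    also have "\<dots> \<le> B * ((1 + \<kappa> * t) powr d * exp (exp (Re L) + \<kappa> * t * (b - a * ln (\<kappa> * t))))"
      using expo B(1) by (intro mult_left_mono) auto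
    also have "\<dots> = B * f t / (1 + t)\<^sup>2" using t by (simp add: f_def)
    also have "\<dots> \<le> B * K / (1 + t)\<^sup>2" using fK[OF t] B(1) by (intro divide_right_mono mult_left_mono) auto
    finally have "exp (\<kappa> * c * Re L) * (cmod (q (of_real c + u / of_real \<kappa>)) * exp (Re (u * L))) \<le>
                  exp (\<kappa> * c * Re L) * (B * K / (1 + t)\<^sup>2)" by (intro mult_left_mono) auto
    thus ?thesis unfolding cmod_twist_eq[OF \<kappa>] u_def by simp
  qed
  show ?thesis unfolding decays_on_sector_def using main by blast
qed

section \<open>Uniform estimates for sums and integrals with a large parameter\<close>

lemma continuous_on_ray:
  fixes c d :: complex
  assumes "continuous_on (range (\<lambda>t. c + of_real t * d)) G"
  shows "continuous_on {0..} (\<lambda>t. G (c + of_real t * d))"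
  by (rule continuous_on_compose2[OF assms]) (auto intro!: continuous_intros)

text \<open>The sign sg selects the ray above or below the axis, and l is the decay rate of the
  weight. Together, weight and integrand leave an exponential with rate - \<kappa> sin \<phi> (sg Im
  L + l/\<kappa> - \<phi>). The gap \<eta> keeps this rate negative uniformly, so the constant
  depends on neither L nor \<phi>.\<close>

lemma weighted_ray_integral_bound:
  assumes \<kappa>: "\<kappa> > 0" and q: "gamma_growth \<kappa> c d q"
    and pos: "\<eta> > 0" "\<phi>m > 0" "C0 \<ge> 0"
  shows "\<exists>C\<ge>0. \<forall>L sg \<phi> w. (sg = 1 \<or> sg = - 1) \<and> \<phi>m \<le> \<phi> \<and> \<phi> \<le> pi / 2 \<and>
           (\<forall>t\<ge>0. cmod (w (of_real c + of_real t * cis (sg * \<phi>))) \<le> C0 * exp (- (l * t * sin \<phi>))) \<and>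
           continuous_on (range (\<lambda>t. of_real c + of_real t * cis (sg * \<phi>))) w \<and>
           sg * Im L + l / \<kappa> - \<phi> \<ge> \<eta> \<longrightarrow>
           set_integrable lborel {0..} (\<lambda>t. twist \<kappa> q L (of_real c + of_real t * cis (sg * \<phi>)) * w (of_real c + of_real t * cis (sg * \<phi>))) \<and>
           cmod (ray_integral (of_real c) (cis (sg * \<phi>)) (\<lambda>s. twist \<kappa> q L s * w s)) \<le>
             C * exp (\<kappa> * c * Re L + exp (Re L) * cos \<phi>)"
proof (cases "\<phi>m \<le> pi / 2")
  case False
  thus ?thesis by (intro exI[of _ 0]) auto
next
  case m: True
  obtain B where B: "B \<ge> 0" "\<And>L \<phi> t. t \<ge> 0 \<Longrightarrow> \<bar>\<phi>\<bar> \<le> pi / 2 \<Longrightarrow>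
           cmod (twist \<kappa> q L (of_real c + of_real t * cis \<phi>)) \<le>
             exp (\<kappa> * c * Re L) * (B * (1 + \<kappa> * t) powr d *
               exp (exp (Re L) * cos \<phi> - \<kappa> * t * sin \<phi> * (Im L - \<phi>)))"
    using gamma_growth_twist_le[OF \<kappa> q] by blast
  define s0 where "s0 = sin \<phi>m"
  have s0: "s0 > 0" unfolding s0_def using m pos by (intro sin_gt_zero) auto
  have "\<exists>C>0. \<forall>t\<ge>0. (1 + \<kappa> * t) powr d * (1 + t)\<^sup>2 * exp (- (\<kappa> * t * (s0 * \<eta>))) \<le> C"
  proof (rule bounded_above_on_atLeast_0)
    have "\<kappa> * (s0 * \<eta>) > 0" using \<kappa> s0 pos by simp
    thus "((\<lambda>t. (1 + \<kappa> * t) powr d * (1 + t)\<^sup>2 * exp (- (\<kappa> * t * (s0 * \<eta>)))) \<longlongrightarrow> 0) at_top"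
      using \<kappa> s0 pos by real_asymp
    show "continuous_on {0..} (\<lambda>t. (1 + \<kappa> * t) powr d * (1 + t)\<^sup>2 * exp (- (\<kappa> * t * (s0 * \<eta>))))"
      using \<kappa> by (intro continuous_intros) (auto simp: add_nonneg_eq_0_iff)
  qed
  then obtain C1 where C1: "C1 > 0" "\<And>t. t \<ge> 0 \<Longrightarrow> (1 + \<kappa> * t) powr d * (1 + t)\<^sup>2 * exp (- (\<kappa> * t * (s0 * \<eta>))) \<le> C1"
    by blast
  show ?thesis
  proof (intro exI[of _ "B * C0 * C1"] conjI allI impI; (elim conjE)?)
    show "0 \<le> B * C0 * C1" using B(1) C1(1) pos by simp
  next
    fix L :: complex and sg \<phi> :: real and w :: "complex \<Rightarrow> complex"
    assume sg: "sg = 1 \<or> sg = -1" and \<phi>: "\<phi>m \<le> \<phi>" "\<phi> \<le> pi / 2"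
      and w: "\<forall>t\<ge>0. cmod (w (of_real c + of_real t * cis (sg * \<phi>))) \<le> C0 * exp (- (l * t * sin \<phi>))"
      and wc: "continuous_on (range (\<lambda>t. of_real c + of_real t * cis (sg * \<phi>))) w"
      and gap: "\<eta> \<le> sg * Im L + l / \<kappa> - \<phi>"
    let ?G = "\<lambda>s. twist \<kappa> q L s * w s"
    have sin: "s0 \<le> sin \<phi>" unfolding s0_def using \<phi> m pos by (intro sin_monotone_2pi_le) auto
    have cont: "continuous_on {0..} (\<lambda>t. ?G (of_real c + of_real t * cis (sg * \<phi>)))"
      by (intro continuous_on_ray continuous_intros wc holomorphic_on_imp_continuous_on holomorphic_twist[OF q])
    have bound: "cmod (?G (of_real c + of_real t * cis (sg * \<phi>))) \<le>
        (B * C0 * C1 * exp (\<kappa> * c * Re L + exp (Re L) * cos \<phi>)) / (1 + t)\<^sup>2" if t: "t \<ge> 0" for t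
    proof -
      have ab: "\<bar>sg * \<phi>\<bar> \<le> pi / 2" using sg \<phi> pos by auto
      have sgn: "cos (sg * \<phi>) = cos \<phi>" "sin (sg * \<phi>) * (Im L - sg * \<phi>) = sin \<phi> * (sg * Im L - \<phi>)"
        using sg by auto (simp add: algebra_simps)
      have g2: "\<kappa> * t * (s0 * \<eta>) \<le> \<kappa> * t * (sin \<phi> * (sg * Im L + l / \<kappa> - \<phi>))"
        using \<kappa> t sin gap s0 pos by (intro mult_left_mono mult_mono) auto
      have "cmod (?G (of_real c + of_real t * cis (sg * \<phi>))) \<le>
          (exp (\<kappa> * c * Re L) * (B * (1 + \<kappa> * t) powr d *
               exp (exp (Re L) * cos (sg * \<phi>) - \<kappa> * t * sin (sg * \<phi>) * (Im L - sg * \<phi>)))) * (C0 * exp (- (l * t * sin \<phi>)))"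
        unfolding norm_mult using B w t ab by (intro mult_mono) auto
      also have "\<kappa> * t * sin (sg * \<phi>) * (Im L - sg * \<phi>) = \<kappa> * t * (sin \<phi> * (sg * Im L - \<phi>))"
        using sgn(2) by (simp add: mult.assoc)
      also have "(exp (\<kappa> * c * Re L) * (B * (1 + \<kappa> * t) powr d *
               exp (exp (Re L) * cos (sg * \<phi>) - \<kappa> * t * (sin \<phi> * (sg * Im L - \<phi>))))) * (C0 * exp (- (l * t * sin \<phi>)))
          = B * C0 * exp (\<kappa> * c * Re L + exp (Re L) * cos \<phi>) *
             ((1 + \<kappa> * t) powr d * exp (- (\<kappa> * t * (sin \<phi> * (sg * Im L + l / \<kappa> - \<phi>)))))"
      proof -
        have "\<kappa> * t * (sin \<phi> * (sg * Im L + l / \<kappa> - \<phi>)) = \<kappa> * t * (sin \<phi> * (sg * Im L - \<phi>)) + l * t * sin \<phi>"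
          using \<kappa> by (simp add: field_simps)
        thus ?thesis unfolding sgn(1) by (simp add: exp_add exp_diff exp_minus field_simps)
      qed
      also have "\<dots> \<le> B * C0 * exp (\<kappa> * c * Re L + exp (Re L) * cos \<phi>) *
             ((1 + \<kappa> * t) powr d * exp (- (\<kappa> * t * (s0 * \<eta>))))"
        using g2 B(1) pos by (intro mult_left_mono) auto
      also have "\<dots> \<le> B * C0 * exp (\<kappa> * c * Re L + exp (Re L) * cos \<phi>) * (C1 / (1 + t)\<^sup>2)"
      proof -
        have "(1 + \<kappa> * t) powr d * exp (- (\<kappa> * t * (s0 * \<eta>))) \<le> C1 / (1 + t)\<^sup>2"
          using C1(2)[OF t] t by (simp add: field_simps)
        thus ?thesis using B(1) pos by (intro mult_left_mono) auto
      qed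
      finally show ?thesis by (simp add: mult_ac)
    qed
    show "set_integrable lborel {0..} (\<lambda>t. ?G (of_real c + of_real t * cis (sg * \<phi>)))"
      by (rule ray_integrable[OF cont bound])
    show "cmod (ray_integral (of_real c) (cis (sg * \<phi>)) ?G) \<le> B * C0 * C1 * exp (\<kappa> * c * Re L + exp (Re L) * cos \<phi>)"
      using norm_ray_integral_le[OF cont bound] by simp
  qed
qed

text \<open>The rays must stay strictly inside the right half-plane. At an angle of at most e^(-x)
  from the vertical, the factor e^(|Z| cos \<phi>) with |Z| = e^x is no larger than e.\<close>

lemma exists_angle_near_right:
  "\<exists>\<phi>. pi / 4 \<le> \<phi> \<and> \<phi> < pi / 2 \<and> exp x * cos \<phi> \<le> (1 :: real)"
proof -
  define \<delta> where "\<delta> = min (pi / 4) (exp (- x))"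
  have \<delta>: "\<delta> > 0" "\<delta> \<le> pi / 4" "\<delta> \<le> exp (- x)" by (auto simp: \<delta>_def)
  have "cos (pi / 2 - \<delta>) = sin \<delta>" by (simp add: cos_diff)
  also have "\<dots> \<le> \<delta>" using \<delta> by (intro sin_x_le_x) auto
  also have "\<dots> \<le> exp (- x)" by (rule \<delta>)
  finally have "exp x * cos (pi / 2 - \<delta>) \<le> exp x * exp (- x)" by (intro mult_left_mono) auto
  also have "\<dots> = 1" by (simp add: exp_minus)
  finally show ?thesis using \<delta> by (intro exI[of _ "pi / 2 - \<delta>"]) auto
qed

lemma continuous_on_weight_ray:
  fixes c \<phi> :: real
  assumes "c \<notin> \<int>" "0 < \<phi>" "\<phi> < pi / 2"
  shows "continuous_on (range (\<lambda>t. of_real c + of_real t * cis \<phi>)) upper_weight"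
    and "continuous_on (range (\<lambda>t. of_real c + of_real t * cis (- \<phi>))) lower_weight"
proof -
  have s: "sin \<phi> > 0" using assms by (intro sin_gt_zero) auto
  have "of_real c + of_real t * cis \<phi> \<notin> \<int>" "of_real c + of_real t * cis (- \<phi>) \<notin> \<int>" for t
    using not_Ints_ray[OF assms(1), of \<phi>] not_Ints_ray[OF assms(1), of "-\<phi>"] s by auto
  hence n: "range (\<lambda>t. of_real c + of_real t * cis \<phi>) \<inter> \<int> = {}" "range (\<lambda>t. of_real c + of_real t * cis (- \<phi>)) \<inter> \<int> = {}"
    by auto
  show "continuous_on (range (\<lambda>t. of_real c + of_real t * cis \<phi>)) upper_weight"
    using n(1) exp_2pi_i_eq_1_iff[of "- _"] by (intro continuous_intros) auto
  show "continuous_on (range (\<lambda>t. of_real c + of_real t * cis (- \<phi>))) lower_weight"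
    using n(2) exp_2pi_i_eq_1_iff by (intro continuous_intros) auto
qed

text \<open>The bound on Im L is the gap condition of both weighted rays for all angles up to pi/2.
  Both rays may then be almost vertical and contribute only the power |Z|^(\<kappa> c).\<close>

lemma sum_eq_ray_integral:
  fixes c :: real
  assumes \<kappa>: "\<kappa> > 0" and q: "gamma_growth \<kappa> c d q" and c: "c \<notin> \<int>" and \<eta>: "\<eta> > 0"
  shows "\<exists>C\<ge>0. \<forall>L. \<bar>Im L\<bar> \<le> 2 * pi / \<kappa> - pi / 2 - \<eta> \<longrightarrow>
           summable (\<lambda>j. twist \<kappa> q L (of_int (\<lfloor>c\<rfloor> + 1 + int j))) \<and>
           cmod ((\<Sum>j. twist \<kappa> q L (of_int (\<lfloor>c\<rfloor> + 1 + int j))) - ray_integral (of_real c) 1 (twist \<kappa> q L))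
             \<le> C * exp (\<kappa> * c * Re L)"
proof -
  have p4: "pi / 4 > 0" by simp
  obtain C0 where C0: "C0 > 0" "\<And>\<phi> t. pi / 4 \<le> \<phi> \<Longrightarrow> \<phi> \<le> pi / 2 \<Longrightarrow> t \<ge> 0 \<Longrightarrow>
            cmod (upper_weight (of_real c + of_real t * cis \<phi>)) \<le> C0 * exp (- (2 * pi * t * sin \<phi>)) \<and>
            cmod (lower_weight (of_real c + of_real t * cis (- \<phi>))) \<le> C0 * exp (- (2 * pi * t * sin \<phi>))"
    using weight_ray_bound[OF c p4] by blast
  obtain C where C: "C \<ge> 0" "\<And>L sg \<phi> w. (sg = 1 \<or> sg = - 1) \<Longrightarrow> pi / 4 \<le> \<phi> \<Longrightarrow> \<phi> \<le> pi / 2 \<Longrightarrow>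
           (\<forall>t\<ge>0. cmod (w (of_real c + of_real t * cis (sg * \<phi>))) \<le> C0 * exp (- (2 * pi * t * sin \<phi>))) \<Longrightarrow>
           continuous_on (range (\<lambda>t. of_real c + of_real t * cis (sg * \<phi>))) w \<Longrightarrow>
           sg * Im L + 2 * pi / \<kappa> - \<phi> \<ge> \<eta> \<Longrightarrow>
           cmod (ray_integral (of_real c) (cis (sg * \<phi>)) (\<lambda>s. twist \<kappa> q L s * w s)) \<le>
             C * exp (\<kappa> * c * Re L + exp (Re L) * cos \<phi>)"
    using weighted_ray_integral_bound[OF \<kappa> q \<eta> p4 less_imp_le[OF C0(1)], of "2 * pi"] by blast
  show ?thesis
  proof (intro exI[of _ "2 * C * exp 1"] conjI allI impI)
    show "0 \<le> 2 * C * exp 1" using C(1) by simp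
  next
    fix L assume L: "\<bar>Im L\<bar> \<le> 2 * pi / \<kappa> - pi / 2 - \<eta>"
    obtain \<phi> where \<phi>: "pi / 4 \<le> \<phi>" "\<phi> < pi / 2" "exp (Re L) * cos \<phi> \<le> 1"
      using exists_angle_near_right by blast
    have \<phi>0: "0 < \<phi>" using \<phi> pi_gt_zero by linarith
    have sums: "(\<lambda>j. twist \<kappa> q L (of_int (\<lfloor>c\<rfloor> + 1 + int j))) sums
           (ray_integral (of_real c) 1 (twist \<kappa> q L) + ray_integral (of_real c) (cis \<phi>) (\<lambda>s. twist \<kappa> q L s * upper_weight s)
             + ray_integral (of_real c) (cis (- \<phi>)) (\<lambda>s. twist \<kappa> q L s * lower_weight s))"
      by (rule abel_plana_sector[OF holomorphic_twist[OF q] decays_on_sector_twist[OF \<kappa> q \<phi>0 \<phi>(2)] c \<phi>0 \<phi>(2)])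
    have gap: "1 * Im L + 2 * pi / \<kappa> - \<phi> \<ge> \<eta>" "- 1 * Im L + 2 * pi / \<kappa> - \<phi> \<ge> \<eta>"
      using L \<phi> by (auto simp: abs_le_iff)
    have bd: "C * exp (\<kappa> * c * Re L + exp (Re L) * cos \<phi>) \<le> C * exp 1 * exp (\<kappa> * c * Re L)"
    proof -
      have "exp (\<kappa> * c * Re L + exp (Re L) * cos \<phi>) \<le> exp (\<kappa> * c * Re L + 1)" using \<phi> by simp
      also have "\<dots> = exp 1 * exp (\<kappa> * c * Re L)" by (simp add: exp_add)
      finally show ?thesis using C(1) by (simp only: mult.assoc mult_left_mono)
    qed
    have b1: "cmod (ray_integral (of_real c) (cis \<phi>) (\<lambda>s. twist \<kappa> q L s * upper_weight s)) \<le> C * exp 1 * exp (\<kappa> * c * Re L)"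
      using C(2)[of 1 \<phi> upper_weight L] C0(2)[of \<phi>] \<phi> gap(1) continuous_on_weight_ray(1)[OF c \<phi>0 \<phi>(2)] bd
      by (auto intro: order_trans)
    have b2: "cmod (ray_integral (of_real c) (cis (- \<phi>)) (\<lambda>s. twist \<kappa> q L s * lower_weight s)) \<le> C * exp 1 * exp (\<kappa> * c * Re L)"
      using C(2)[of "- 1" \<phi> lower_weight L] C0(2)[of \<phi>] \<phi> gap(2) continuous_on_weight_ray(2)[OF c \<phi>0 \<phi>(2)] bd
      by (auto intro: order_trans)
    show "summable (\<lambda>j. twist \<kappa> q L (of_int (\<lfloor>c\<rfloor> + 1 + int j)))" using sums by (rule sums_summable)
    have "cmod ((\<Sum>j. twist \<kappa> q L (of_int (\<lfloor>c\<rfloor> + 1 + int j))) - ray_integral (of_real c) 1 (twist \<kappa> q L))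
       = cmod (ray_integral (of_real c) (cis \<phi>) (\<lambda>s. twist \<kappa> q L s * upper_weight s)
             + ray_integral (of_real c) (cis (- \<phi>)) (\<lambda>s. twist \<kappa> q L s * lower_weight s))"
      unfolding sums_unique[OF sums, symmetric] by (simp only: add.assoc add_diff_cancel_left')
    also have "\<dots> \<le> 2 * C * exp 1 * exp (\<kappa> * c * Re L)"
      by (rule order_trans[OF norm_triangle_ineq order_trans[OF add_mono[OF b1 b2]]]) simp
    finally show "cmod ((\<Sum>j. twist \<kappa> q L (of_int (\<lfloor>c\<rfloor> + 1 + int j))) - ray_integral (of_real c) 1 (twist \<kappa> q L))
             \<le> 2 * C * exp 1 * exp (\<kappa> * c * Re L)" .
  qed
qed

text \<open>In terms of \<zeta> the factor turns \<zeta>^s into (\<zeta> e^(-2 pi i))^s; this is how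
  the neighbouring exponential expansion comes in.\<close>

lemma twist_shift:
  assumes "\<kappa> \<noteq> 0"
  shows "twist \<kappa> q L s * exp (- (2 * of_real pi * \<i> * s)) = twist \<kappa> q (L - of_real (2 * pi / \<kappa>) * \<i>) s"
  using assms by (simp add: twist_def mult.assoc exp_add[symmetric]) (simp add: algebra_simps)

text \<open>
  For \<open>\<kappa> \<ge> 2\<close> the weight of the lower ray is split further, \<open>1/(w - 1) = 1/w + 1/(w(w - 1))\<close>
  with \<open>w = e^(2\<pi>is)\<close>; the first part yields the second exponential expansion.
\<close>

lemma sum_eq_two_ray_integrals:
  fixes c :: real
  assumes \<kappa>: "\<kappa> \<ge> 2" and q: "gamma_growth \<kappa> c d q" and c: "c \<notin> \<int>"
  shows "\<exists>C\<ge>0. \<forall>L. 0 \<le> Im L \<and> Im L \<le> pi / \<kappa> \<longrightarrow>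
           summable (\<lambda>j. twist \<kappa> q L (of_int (\<lfloor>c\<rfloor> + 1 + int j))) \<and>
           cmod ((\<Sum>j. twist \<kappa> q L (of_int (\<lfloor>c\<rfloor> + 1 + int j))) - ray_integral (of_real c) 1 (twist \<kappa> q L)
                  - ray_integral (of_real c) 1 (twist \<kappa> q (L - of_real (2 * pi / \<kappa>) * \<i>)))
             \<le> C * exp (\<kappa> * c * Re L + exp (Re L) * cos (Im L))"
proof -
  have \<kappa>0: "\<kappa> > 0" using \<kappa> by simp
  define \<phi>m where "\<phi>m = min (pi / 4) (pi / \<kappa>)"
  \<comment> \<open>For angles up to pi/\<kappa> this gap is available on both rays: above because 0
    \<le> Im L and the weight has rate 2 pi, below because Im L \<le> pi/\<kappa> and the remaining
    weight \<open>wm2\<close> has rate 4 pi.\<close>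
  define \<eta> where "\<eta> = pi / \<kappa>"
  have pos: "\<phi>m > 0" "\<eta> > 0" using \<kappa> by (auto simp: \<phi>m_def \<eta>_def)
  have \<eta>2: "\<eta> \<le> pi / 2" unfolding \<eta>_def using \<kappa> by (intro divide_left_mono) auto
  define wm2 where "wm2 = (\<lambda>s. exp (- (2 * of_real pi * \<i> * s)) * lower_weight s)"
  obtain C0 where C0: "C0 > 0" "\<And>\<phi> t. \<phi>m \<le> \<phi> \<Longrightarrow> \<phi> \<le> pi / 2 \<Longrightarrow> t \<ge> 0 \<Longrightarrow>
            cmod (upper_weight (of_real c + of_real t * cis \<phi>)) \<le> C0 * exp (- (2 * pi * t * sin \<phi>)) \<and>
            cmod (lower_weight (of_real c + of_real t * cis (- \<phi>))) \<le> C0 * exp (- (2 * pi * t * sin \<phi>))"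
    using weight_ray_bound[OF c pos(1)] by blast
  note wb = weighted_ray_integral_bound[OF \<kappa>0 q pos(2) pos(1) less_imp_le[OF C0(1)]]
  obtain C1 where C1: "C1 \<ge> 0" "\<And>L sg \<phi> w. (sg = 1 \<or> sg = - 1) \<Longrightarrow> \<phi>m \<le> \<phi> \<Longrightarrow> \<phi> \<le> pi / 2 \<Longrightarrow>
           (\<forall>t\<ge>0. cmod (w (of_real c + of_real t * cis (sg * \<phi>))) \<le> C0 * exp (- (2 * pi * t * sin \<phi>))) \<Longrightarrow>
           continuous_on (range (\<lambda>t. of_real c + of_real t * cis (sg * \<phi>))) w \<Longrightarrow>
           sg * Im L + 2 * pi / \<kappa> - \<phi> \<ge> \<eta> \<Longrightarrow>
           cmod (ray_integral (of_real c) (cis (sg * \<phi>)) (\<lambda>s. twist \<kappa> q L s * w s)) \<le>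
             C1 * exp (\<kappa> * c * Re L + exp (Re L) * cos \<phi>)"
    using wb[of "2 * pi"] by blast
  obtain C2 where C2: "C2 \<ge> 0" "\<And>L sg \<phi> w. (sg = 1 \<or> sg = - 1) \<Longrightarrow> \<phi>m \<le> \<phi> \<Longrightarrow> \<phi> \<le> pi / 2 \<Longrightarrow>
           (\<forall>t\<ge>0. cmod (w (of_real c + of_real t * cis (sg * \<phi>))) \<le> C0 * exp (- (4 * pi * t * sin \<phi>))) \<Longrightarrow>
           continuous_on (range (\<lambda>t. of_real c + of_real t * cis (sg * \<phi>))) w \<Longrightarrow>
           sg * Im L + 4 * pi / \<kappa> - \<phi> \<ge> \<eta> \<Longrightarrow>
           set_integrable lborel {0..} (\<lambda>t. twist \<kappa> q L (of_real c + of_real t * cis (sg * \<phi>)) * w (of_real c + of_real t * cis (sg * \<phi>))) \<and>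
           cmod (ray_integral (of_real c) (cis (sg * \<phi>)) (\<lambda>s. twist \<kappa> q L s * w s)) \<le>
             C2 * exp (\<kappa> * c * Re L + exp (Re L) * cos \<phi>)"
    using wb[of "4 * pi"] by blast
  show ?thesis
  proof (intro exI[of _ "(C1 + C2) * exp 1"] conjI allI impI; (elim conjE)?)
    show "0 \<le> (C1 + C2) * exp 1" using C1(1) C2(1) by simp
  next
    fix L assume L: "0 \<le> Im L" "Im L \<le> pi / \<kappa>"
    have cosL: "cos (Im L) \<ge> 0" using L(1) order_trans[OF L(2) \<eta>2[unfolded \<eta>_def]] pi_gt_zero
      by (intro cos_ge_zero) linarith+
    \<comment> \<open>The gap forces \<phi> \<le> pi/\<kappa>, and Im L \<le> pi/\<kappa> makes the
      extreme choice good enough, as its cosine is at most cos(Im L). Only for \<kappa> = 2 is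
      pi/\<kappa> the forbidden right angle; a nearly vertical ray replaces it, at the price of the
      summand 1.\<close>
    obtain \<phi> where \<phi>: "\<phi>m \<le> \<phi>" "\<phi> < pi / 2" "\<phi> \<le> \<eta>" "exp (Re L) * cos \<phi> \<le> exp (Re L) * cos (Im L) + 1"
    proof (cases "\<kappa> = 2")
      case True
      obtain \<phi> where \<phi>: "pi / 4 \<le> \<phi>" "\<phi> < pi / 2" "exp (Re L) * cos \<phi> \<le> 1"
        using exists_angle_near_right by blast
      have "exp (Re L) * cos \<phi> \<le> exp (Re L) * cos (Im L) + 1"
        using \<phi>(3) cosL by (smt (verit) exp_gt_zero mult_nonneg_nonneg)
      thus ?thesis using True \<phi> by (intro that[of \<phi>]) (auto simp: \<phi>m_def \<eta>_def)
    next
      case False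
      have "\<eta> < pi / 2" unfolding \<eta>_def using False \<kappa> by (intro divide_strict_left_mono) auto
      have "cos \<eta> \<le> cos (Im L)" using L \<eta>2 pi_gt_zero
        by (intro cos_monotone_0_pi_le) (auto simp: \<eta>_def[symmetric])
      hence "exp (Re L) * cos \<eta> \<le> exp (Re L) * cos (Im L)" by (rule mult_left_mono) simp
      hence "exp (Re L) * cos \<eta> \<le> exp (Re L) * cos (Im L) + 1" by linarith
      thus ?thesis using \<open>\<eta> < pi / 2\<close> by (intro that[of \<eta>]) (simp_all only: \<phi>m_def \<eta>_def min.cobounded2 order_refl)
    qed
    have \<phi>0: "0 < \<phi>" using \<phi> pos by linarith
    have sums: "(\<lambda>j. twist \<kappa> q L (of_int (\<lfloor>c\<rfloor> + 1 + int j))) sums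
           (ray_integral (of_real c) 1 (twist \<kappa> q L) + ray_integral (of_real c) (cis \<phi>) (\<lambda>s. twist \<kappa> q L s * upper_weight s)
             + ray_integral (of_real c) (cis (- \<phi>)) (\<lambda>s. twist \<kappa> q L s * lower_weight s))"
      by (rule abel_plana_sector[OF holomorphic_twist[OF q] decays_on_sector_twist[OF \<kappa>0 q \<phi>0 \<phi>(2)] c \<phi>0 \<phi>(2)])
    have gap: "1 * Im L + 2 * pi / \<kappa> - \<phi> \<ge> \<eta>" "- 1 * Im L + 4 * pi / \<kappa> - \<phi> \<ge> \<eta>"
    proof -
      have "2 * pi / \<kappa> = 2 * \<eta>" "4 * pi / \<kappa> = 4 * \<eta>" "Im L \<le> \<eta>" using L by (simp_all add: \<eta>_def)
      thus "1 * Im L + 2 * pi / \<kappa> - \<phi> \<ge> \<eta>" "- 1 * Im L + 4 * pi / \<kappa> - \<phi> \<ge> \<eta>"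
        using L(1) \<phi>(3) pos by linarith+
    qed
    have bd: "C * exp (\<kappa> * c * Re L + exp (Re L) * cos \<phi>) \<le> C * exp 1 * exp (\<kappa> * c * Re L + exp (Re L) * cos (Im L))"
      if "C \<ge> 0" for C
    proof -
      have "exp (\<kappa> * c * Re L + exp (Re L) * cos \<phi>) \<le> exp (1 + (\<kappa> * c * Re L + exp (Re L) * cos (Im L)))" using \<phi> by simp
      also have "\<dots> = exp 1 * exp (\<kappa> * c * Re L + exp (Re L) * cos (Im L))" by (rule exp_add)
      finally show ?thesis using that by (simp only: mult.assoc mult_left_mono)
    qed
    have b1: "cmod (ray_integral (of_real c) (cis \<phi>) (\<lambda>s. twist \<kappa> q L s * upper_weight s)) \<le> C1 * exp 1 * exp (\<kappa> * c * Re L + exp (Re L) * cos (Im L))"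
      using C1(2)[of 1 \<phi> upper_weight L] C0(2)[of \<phi>] \<phi> gap(1) continuous_on_weight_ray(1)[OF c \<phi>0 \<phi>(2)] bd[OF C1(1)]
      by (auto intro: order_trans)
    let ?L' = "L - of_real (2 * pi / \<kappa>) * \<i>"
    have wm2: "set_integrable lborel {0..} (\<lambda>t. twist \<kappa> q L (of_real c + of_real t * cis (- \<phi>)) * wm2 (of_real c + of_real t * cis (- \<phi>))) \<and>
      cmod (ray_integral (of_real c) (cis (- \<phi>)) (\<lambda>s. twist \<kappa> q L s * wm2 s)) \<le> C2 * exp (\<kappa> * c * Re L + exp (Re L) * cos \<phi>)"
    proof -
      have "cmod (wm2 (of_real c + of_real t * cis (-1 * \<phi>))) \<le> C0 * exp (- (4 * pi * t * sin \<phi>))" if t: "t \<ge> 0" for t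
      proof -
        have "cmod (wm2 (of_real c + of_real t * cis (- \<phi>))) =
              exp (- (2 * pi * t * sin \<phi>)) * cmod (lower_weight (of_real c + of_real t * cis (- \<phi>)))"
          unfolding wm2_def norm_mult by (simp add: mult.assoc)
        also have "\<dots> \<le> exp (- (2 * pi * t * sin \<phi>)) * (C0 * exp (- (2 * pi * t * sin \<phi>)))"
          using C0(2)[of \<phi> t] \<phi> t by (intro mult_left_mono) auto
        also have "\<dots> = C0 * (exp (- (2 * pi * t * sin \<phi>)) * exp (- (2 * pi * t * sin \<phi>)))" by (simp only: mult_ac)
        also have "\<dots> = C0 * exp (- (4 * pi * t * sin \<phi>))" unfolding exp_add[symmetric] by simp
        finally show ?thesis by simp
      qed
      moreover have "continuous_on (range (\<lambda>t. of_real c + of_real t * cis (-1 * \<phi>))) wm2"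
        unfolding wm2_def mult_minus1
        by (rule continuous_on_mult[OF _ continuous_on_weight_ray(2)[OF c \<phi>0 \<phi>(2)]]) (intro continuous_intros)
      ultimately show ?thesis
        using C2(2)[of "- 1" \<phi> wm2 L] \<phi> gap(2) by simp
    qed
    have b2: "cmod (ray_integral (of_real c) (cis (- \<phi>)) (\<lambda>s. twist \<kappa> q L s * wm2 s)) \<le> C2 * exp 1 * exp (\<kappa> * c * Re L + exp (Re L) * cos (Im L))"
      using wm2 bd[OF C2(1)] by linarith
    have split: "ray_integral (of_real c) (cis (- \<phi>)) (\<lambda>s. twist \<kappa> q L s * lower_weight s) =
        ray_integral (of_real c) 1 (twist \<kappa> q ?L') + ray_integral (of_real c) (cis (- \<phi>)) (\<lambda>s. twist \<kappa> q L s * wm2 s)"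
    proof -
      have sin: "sin (- \<phi>) \<noteq> 0" using sin_gt_zero[of \<phi>] \<phi>0 \<phi>(2) by simp
      have "twist \<kappa> q L s * lower_weight s = twist \<kappa> q ?L' s + twist \<kappa> q L s * wm2 s" if s: "s \<notin> \<int>" for s
      proof -
        define E where "E = exp (2 * of_real pi * \<i> * s)"
        have E: "E \<noteq> 0" "E \<noteq> 1" using s exp_2pi_i_eq_1_iff[of s] by (auto simp: E_def)
        have "1 / (E - 1) = inverse E + inverse E * (1 / (E - 1))"
          using E by (simp add: field_simps)
        hence "lower_weight s = exp (- (2 * of_real pi * \<i> * s)) + wm2 s"
          unfolding wm2_def E_def exp_minus .
        thus ?thesis using \<kappa>0 by (simp only: twist_shift[symmetric] distrib_left)
      qed
      hence "twist \<kappa> q L (of_real c + of_real t * cis (- \<phi>)) * lower_weight (of_real c + of_real t * cis (- \<phi>)) =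
         twist \<kappa> q ?L' (of_real c + of_real t * cis (- \<phi>)) + twist \<kappa> q L (of_real c + of_real t * cis (- \<phi>)) * wm2 (of_real c + of_real t * cis (- \<phi>))" for t
        using not_Ints_ray[OF c sin] by blast
      hence "ray_integral (of_real c) (cis (- \<phi>)) (\<lambda>s. twist \<kappa> q L s * lower_weight s) =
            ray_integral (of_real c) (cis (- \<phi>)) (\<lambda>s. twist \<kappa> q ?L' s + twist \<kappa> q L s * wm2 s)"
        unfolding ray_integral_def by presburger
      also have "\<dots> = ray_integral (of_real c) (cis (- \<phi>)) (twist \<kappa> q ?L') + ray_integral (of_real c) (cis (- \<phi>)) (\<lambda>s. twist \<kappa> q L s * wm2 s)"
      proof (rule ray_integral_add)
        obtain B where B: "\<And>\<rho> \<psi>. \<rho> \<ge> 0 \<Longrightarrow> \<bar>\<psi>\<bar> \<le> \<phi> \<Longrightarrow> cmod (twist \<kappa> q ?L' (of_real c + of_real \<rho> * cis \<psi>)) \<le> B / (1 + \<rho>)\<^sup>2"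
          using decays_on_sector_twist[OF \<kappa>0 q \<phi>0 \<phi>(2), of ?L'] unfolding decays_on_sector_def by blast
        show "set_integrable lborel {0..} (\<lambda>t. twist \<kappa> q ?L' (of_real c + of_real t * cis (- \<phi>)))"
          using B[of _ "-\<phi>"] \<phi>0
          by (intro ray_integrable[where B = B] continuous_on_ray holomorphic_on_imp_continuous_on holomorphic_twist[OF q]) auto
      qed (use wm2 in blast)
      also have "ray_integral (of_real c) (cis (- \<phi>)) (twist \<kappa> q ?L') = ray_integral (of_real c) 1 (twist \<kappa> q ?L')"
        using \<phi>0 by (intro ray_rotation[OF holomorphic_twist[OF q] decays_on_sector_twist[OF \<kappa>0 q \<phi>0 \<phi>(2)] \<phi>0 \<phi>(2)]) auto
      finally show ?thesis .
    qed
    show "summable (\<lambda>j. twist \<kappa> q L (of_int (\<lfloor>c\<rfloor> + 1 + int j)))" using sums by (rule sums_summable)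
    have eqn: "(\<Sum>j. twist \<kappa> q L (of_int (\<lfloor>c\<rfloor> + 1 + int j))) - ray_integral (of_real c) 1 (twist \<kappa> q L) - ray_integral (of_real c) 1 (twist \<kappa> q ?L')
       = ray_integral (of_real c) (cis \<phi>) (\<lambda>s. twist \<kappa> q L s * upper_weight s)
             + ray_integral (of_real c) (cis (- \<phi>)) (\<lambda>s. twist \<kappa> q L s * wm2 s)"
      unfolding sums_unique[OF sums, symmetric] split by (simp only: algebra_simps)
    show "cmod ((\<Sum>j. twist \<kappa> q L (of_int (\<lfloor>c\<rfloor> + 1 + int j))) - ray_integral (of_real c) 1 (twist \<kappa> q L)
           - ray_integral (of_real c) 1 (twist \<kappa> q ?L')) \<le> (C1 + C2) * exp 1 * exp (\<kappa> * c * Re L + exp (Re L) * cos (Im L))"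
      unfolding eqn distrib_right by (rule order_trans[OF norm_triangle_ineq add_mono[OF b1 b2]])
  qed
qed

text \<open>With d \<le> -2 the integrand is integrable without any weight. The ray is turned to the
  direction Im L of the saddle point, where the linear part of the exponent vanishes; if that
  direction is outside the right half-plane, it is turned almost to the vertical on the same side,
  where the linear part only helps and |Z| cos \<phi> is at most 1.\<close>

lemma ray_integral_twist_bound:
  assumes \<kappa>: "\<kappa> > 0" and q: "gamma_growth \<kappa> c d q" and d: "d \<le> - 2"
  shows "\<exists>C\<ge>0. \<forall>L. cmod (ray_integral (of_real c) 1 (twist \<kappa> q L)) \<le>
           C * exp (\<kappa> * c * Re L + (if \<bar>Im L\<bar> < pi / 2 then exp (Re L) * cos (Im L) else 0))"
proof -
  obtain B where B: "B \<ge> 0" "\<And>L \<phi> t. t \<ge> 0 \<Longrightarrow> \<bar>\<phi>\<bar> \<le> pi / 2 \<Longrightarrow>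
           cmod (twist \<kappa> q L (of_real c + of_real t * cis \<phi>)) \<le>
             exp (\<kappa> * c * Re L) * (B * (1 + \<kappa> * t) powr d *
               exp (exp (Re L) * cos \<phi> - \<kappa> * t * sin \<phi> * (Im L - \<phi>)))"
    using gamma_growth_twist_le[OF \<kappa> q] by blast
  define k where "k = min 1 \<kappa>"
  have k: "k > 0" using \<kappa> by (simp add: k_def)
  have rot: "cmod (ray_integral (of_real c) 1 (twist \<kappa> q L)) \<le> B / k\<^sup>2 * exp (\<kappa> * c * Re L + exp (Re L) * cos \<phi>)"
    if \<phi>: "\<bar>\<phi>\<bar> < pi / 2" and sgn: "sin \<phi> * (Im L - \<phi>) \<ge> 0" for L \<phi>
  proof -
    define \<phi>' where "\<phi>' = (\<bar>\<phi>\<bar> + pi / 2) / 2"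
    have \<phi>': "0 < \<phi>'" "\<phi>' < pi / 2" "\<bar>\<phi>\<bar> \<le> \<phi>'" using \<phi> pi_gt_zero abs_ge_zero[of \<phi>] unfolding \<phi>'_def by (auto simp: field_simps simp del: abs_ge_zero)
    have "ray_integral (of_real c) 1 (twist \<kappa> q L) = ray_integral (of_real c) (cis \<phi>) (twist \<kappa> q L)"
      by (rule ray_rotation[OF holomorphic_twist[OF q] decays_on_sector_twist[OF \<kappa> q \<phi>'(1,2)] \<phi>', symmetric])
    also have "cmod \<dots> \<le> cmod (cis \<phi>) * (B / k\<^sup>2 * exp (\<kappa> * c * Re L + exp (Re L) * cos \<phi>))"
    proof (rule norm_ray_integral_le)
      show "continuous_on {0..} (\<lambda>t. twist \<kappa> q L (of_real c + of_real t * cis \<phi>))"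
        by (intro continuous_on_ray holomorphic_on_imp_continuous_on holomorphic_twist[OF q])
      fix t :: real assume t: "t \<ge> 0"
      have "k * (1 + t) \<le> 1 + \<kappa> * t"
      proof -
        have "k * t \<le> \<kappa> * t" using t by (intro mult_right_mono) (auto simp: k_def)
        moreover have "k \<le> 1" by (simp add: k_def)
        ultimately show ?thesis by (simp add: distrib_left)
      qed
      have 1: "(1 + \<kappa> * t) powr d \<le> 1 / (k * (1 + t))\<^sup>2"
      proof -
        have "(1 + \<kappa> * t) powr d \<le> (1 + \<kappa> * t) powr (- 2)" using d \<kappa> t by (intro powr_mono) auto
        also have "\<dots> \<le> (k * (1 + t)) powr (- 2)"
          using k t \<open>k * (1 + t) \<le> 1 + \<kappa> * t\<close> by (intro powr_mono2') auto
        also have "\<dots> = 1 / (k * (1 + t))\<^sup>2"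
          using k t by (simp add: powr_minus divide_inverse powr_numeral)
        finally show ?thesis .
      qed
      have "\<kappa> * t * (sin \<phi> * (Im L - \<phi>)) \<ge> 0" using \<kappa> t by (intro mult_nonneg_nonneg[OF _ sgn]) auto
      hence 2: "exp (exp (Re L) * cos \<phi> - \<kappa> * t * sin \<phi> * (Im L - \<phi>)) \<le> exp (exp (Re L) * cos \<phi>)"
        by (simp add: mult.assoc)
      have "cmod (twist \<kappa> q L (of_real c + of_real t * cis \<phi>)) \<le>
             exp (\<kappa> * c * Re L) * (B * (1 + \<kappa> * t) powr d *
               exp (exp (Re L) * cos \<phi> - \<kappa> * t * sin \<phi> * (Im L - \<phi>)))"
        using B(2)[of t \<phi> L] t \<phi> by simp
      also have "\<dots> \<le> exp (\<kappa> * c * Re L) * (B * (1 / (k * (1 + t))\<^sup>2) * exp (exp (Re L) * cos \<phi>))"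
        using 1 2 B(1) by (intro mult_left_mono mult_mono) auto
      also have "\<dots> = (B / k\<^sup>2 * exp (\<kappa> * c * Re L + exp (Re L) * cos \<phi>)) / (1 + t)\<^sup>2"
        by (simp add: exp_add power_mult_distrib)
      finally show "cmod (twist \<kappa> q L (of_real c + of_real t * cis \<phi>)) \<le> \<dots>" .
    qed
    finally show ?thesis by simp
  qed
  show ?thesis
  proof (intro exI[of _ "B / k\<^sup>2 * exp 1"] conjI allI)
    show "0 \<le> B / k\<^sup>2 * exp 1" using B(1) by simp
    fix L
    have nn: "B / k\<^sup>2 \<ge> 0" using B(1) by simp
    show "cmod (ray_integral (of_real c) 1 (twist \<kappa> q L)) \<le>
           B / k\<^sup>2 * exp 1 * exp (\<kappa> * c * Re L + (if \<bar>Im L\<bar> < pi / 2 then exp (Re L) * cos (Im L) else 0))"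
    proof (cases "\<bar>Im L\<bar> < pi / 2")
      case True
      have "cmod (ray_integral (of_real c) 1 (twist \<kappa> q L)) \<le> B / k\<^sup>2 * exp (\<kappa> * c * Re L + exp (Re L) * cos (Im L))"
        using rot[OF True] by simp
      also have "\<dots> \<le> B / k\<^sup>2 * (exp 1 * exp (\<kappa> * c * Re L + exp (Re L) * cos (Im L)))"
        using nn by (intro mult_left_mono) auto
      finally show ?thesis using True by (simp add: mult.assoc)
    next
      case False
      obtain \<phi> where \<phi>: "pi / 4 \<le> \<phi>" "\<phi> < pi / 2" "exp (Re L) * cos \<phi> \<le> 1"
        using exists_angle_near_right by blast
      have s: "sin \<phi> \<ge> 0" using \<phi> pi_gt_zero by (intro sin_ge_zero) linarith+
      \<comment> \<open>The angle takes the sign of Im L.\<close>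
      have "\<exists>\<psi>. \<bar>\<psi>\<bar> < pi / 2 \<and> sin \<psi> * (Im L - \<psi>) \<ge> 0 \<and> cos \<psi> = cos \<phi>"
      proof (cases "Im L \<ge> 0")
        case True
        thus ?thesis using False \<phi> s pi_gt_zero by (intro exI[of _ \<phi>]) (auto intro!: mult_nonneg_nonneg)
      next
        case F: False
        have "sin (- \<phi>) * (Im L - - \<phi>) \<ge> 0"
          using F False \<phi> s by (intro mult_nonpos_nonpos) auto
        thus ?thesis using \<phi> pi_gt_zero by (intro exI[of _ "- \<phi>"]) auto
      qed
      then obtain \<psi> where \<psi>: "\<bar>\<psi>\<bar> < pi / 2" "sin \<psi> * (Im L - \<psi>) \<ge> 0" "cos \<psi> = cos \<phi>" by blast
      have "cmod (ray_integral (of_real c) 1 (twist \<kappa> q L)) \<le> B / k\<^sup>2 * exp (\<kappa> * c * Re L + exp (Re L) * cos \<phi>)"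
        using rot[OF \<psi>(1,2)] \<psi>(3) by simp
      also have "\<dots> \<le> B / k\<^sup>2 * exp (1 + \<kappa> * c * Re L)"
        using nn \<phi>(3) by (intro mult_left_mono) auto
      finally show ?thesis using False by (simp add: exp_add mult.assoc)
    qed
  qed
qed

subsection \<open>Exponential expansions of reciprocal Gamma factors\<close>

lemma gamma_growth_mono:
  assumes "gamma_growth \<kappa> c d q" "d \<le> d'"
  shows "gamma_growth \<kappa> c d' q"
proof -
  obtain B where B: "B \<ge> 0" "\<And>u. Re u \<ge> 0 \<Longrightarrow>
        cmod (q (of_real c + u / of_real \<kappa>)) \<le> B * (1 + cmod u) powr d * exp (stirling_exponent u)"
    using assms(1) unfolding gamma_growth_def by blast
  have "cmod (q (of_real c + u / of_real \<kappa>)) \<le> B * (1 + cmod u) powr d' * exp (stirling_exponent u)" if "Re u \<ge> 0" for u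
  proof -
    have "B * (1 + cmod u) powr d * exp (stirling_exponent u) \<le> B * (1 + cmod u) powr d' * exp (stirling_exponent u)"
      using assms(2) B(1) by (intro mult_right_mono mult_left_mono powr_mono) auto
    thus ?thesis using B(2)[OF that] by simp
  qed
  thus ?thesis using assms(1) B(1) unfolding gamma_growth_def by blast
qed

lemma gamma_growth_add:
  assumes "gamma_growth \<kappa> c d p" "gamma_growth \<kappa> c d q"
  shows "gamma_growth \<kappa> c d (\<lambda>s. p s + q s)"
proof -
  obtain A where A: "A \<ge> 0" "\<And>u. Re u \<ge> 0 \<Longrightarrow>
        cmod (p (of_real c + u / of_real \<kappa>)) \<le> A * (1 + cmod u) powr d * exp (stirling_exponent u)"
    using assms(1) unfolding gamma_growth_def by blast
  obtain B where B: "B \<ge> 0" "\<And>u. Re u \<ge> 0 \<Longrightarrow>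
        cmod (q (of_real c + u / of_real \<kappa>)) \<le> B * (1 + cmod u) powr d * exp (stirling_exponent u)"
    using assms(2) unfolding gamma_growth_def by blast
  have "cmod (p (of_real c + u / of_real \<kappa>) + q (of_real c + u / of_real \<kappa>)) \<le> (A + B) * (1 + cmod u) powr d * exp (stirling_exponent u)"
    if "Re u \<ge> 0" for u
    using A(2)[OF that] B(2)[OF that] by (intro order_trans[OF norm_triangle_ineq]) (simp add: algebra_simps)
  moreover have "(\<lambda>s. p s + q s) holomorphic_on UNIV"
    using assms unfolding gamma_growth_def by (intro holomorphic_intros) auto
  ultimately show ?thesis using A(1) B(1) unfolding gamma_growth_def by (intro conjI exI[of _ "A + B"]) auto
qed

lemma gamma_growth_cmult:
  assumes "gamma_growth \<kappa> c d q"
  shows "gamma_growth \<kappa> c d (\<lambda>s. k * q s)"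
proof -
  obtain B where B: "B \<ge> 0" "\<And>u. Re u \<ge> 0 \<Longrightarrow>
        cmod (q (of_real c + u / of_real \<kappa>)) \<le> B * (1 + cmod u) powr d * exp (stirling_exponent u)"
    using assms(1) unfolding gamma_growth_def by blast
  have "cmod (k * q (of_real c + u / of_real \<kappa>)) \<le> (cmod k * B) * (1 + cmod u) powr d * exp (stirling_exponent u)"
    if "Re u \<ge> 0" for u
    unfolding norm_mult using B(2)[OF that] by (simp add: mult.assoc mult_left_mono)
  moreover have "(\<lambda>s. k * q s) holomorphic_on UNIV"
    using assms unfolding gamma_growth_def by (intro holomorphic_intros) auto
  ultimately show ?thesis using B(1) unfolding gamma_growth_def by (intro conjI exI[of _ "cmod k * B"]) auto
qed

lemma gamma_growth_zero: "gamma_growth \<kappa> c d (\<lambda>_. 0)"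
  unfolding gamma_growth_def by (intro conjI exI[of _ 0]) auto

lemma gamma_growth_sum:
  assumes "\<And>j. j \<in> A \<Longrightarrow> gamma_growth \<kappa> c d (q j)"
  shows "gamma_growth \<kappa> c d (\<lambda>s. \<Sum>j\<in>A. q j s)"
  using assms by (induction A rule: infinite_finite_induct) (auto simp: gamma_growth_zero intro: gamma_growth_add)

lemma gamma_growth_rGamma:
  assumes "\<kappa> > 0"
  shows "gamma_growth \<kappa> c (1 - (\<kappa> * c + b)) (\<lambda>s. rGamma (of_real \<kappa> * s + of_real b))"
proof -
  obtain C where C: "\<And>u. Re u \<ge> 0 \<Longrightarrow> cmod (rGamma (u + of_real (\<kappa> * c + b))) \<le> C * (1 + cmod u) powr (1 - (\<kappa> * c + b)) * exp (stirling_exponent u)"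
    using rGamma_growth by blast
  have "cmod (rGamma (of_real \<kappa> * (of_real c + u / of_real \<kappa>) + of_real b)) \<le> \<bar>C\<bar> * (1 + cmod u) powr (1 - (\<kappa> * c + b)) * exp (stirling_exponent u)"
    if "Re u \<ge> 0" for u
  proof -
    have eq: "of_real \<kappa> * (of_real c + u / of_real \<kappa>) + of_real b = u + of_real (\<kappa> * c + b)"
      using assms by (simp add: field_simps)
    have "C * (1 + cmod u) powr (1 - (\<kappa> * c + b)) * exp (stirling_exponent u) \<le> \<bar>C\<bar> * (1 + cmod u) powr (1 - (\<kappa> * c + b)) * exp (stirling_exponent u)"
      by (intro mult_right_mono) auto
    thus ?thesis unfolding eq using C[OF that] by linarith
  qed
  moreover have "(\<lambda>s. rGamma (of_real \<kappa> * s + of_real b)) holomorphic_on UNIV"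
    by (intro holomorphic_intros)
  ultimately show ?thesis unfolding gamma_growth_def by (intro conjI exI[of _ "\<bar>C\<bar>"]) auto
qed

lemma stirling_exponent_ge:
  assumes "Re u \<ge> 0"
  shows "stirling_exponent u \<ge> - (cmod u * ln (1 + cmod u))"
proof (cases "u = 0")
  case False
  have "Re u * ln (cmod u) \<le> cmod u * ln (1 + cmod u)"
  proof -
    have "Re u * ln (cmod u) \<le> Re u * ln (1 + cmod u)"
      using assms False by (intro mult_left_mono ln_mono) auto
    also have "\<dots> \<le> cmod u * ln (1 + cmod u)"
      using abs_Re_le_cmod[of u] by (intro mult_right_mono) auto
    finally show ?thesis .
  qed
  moreover have "Im u * Im (Ln u) \<ge> 0" using False by (rule Im_mult_Im_Ln_nonneg)
  ultimately show ?thesis using False assms by (simp add: stirling_exponent_def)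
qed (simp add: stirling_exponent_def)

text \<open>On a half-disc the comparison function has a positive lower bound, so an entire q
  satisfies the estimate there with a suitable constant. This is needed because the inverse
  factorial expansion gives information for large s only.\<close>

lemma gamma_growth_if_far:
  assumes hol: "q holomorphic_on UNIV"
    and far: "\<And>u. Re u \<ge> 0 \<Longrightarrow> cmod u \<ge> U \<Longrightarrow>
        cmod (q (of_real c + u / of_real \<kappa>)) \<le> B * (1 + cmod u) powr d * exp (stirling_exponent u)"
  shows "gamma_growth \<kappa> c d q"
proof -
  define V where "V = max U 0"
  have "continuous_on (cball 0 V) (\<lambda>u. q (of_real c + u / of_real \<kappa>))"
    by (rule continuous_on_compose2[OF holomorphic_on_imp_continuous_on[OF hol]]) (auto simp: divide_inverse intro!: continuous_intros)
  hence "bounded ((\<lambda>u. q (of_real c + u / of_real \<kappa>)) ` cball 0 V)"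
    by (intro compact_imp_bounded compact_continuous_image) auto
  then obtain D where "\<forall>w\<in>(\<lambda>u. q (of_real c + u / of_real \<kappa>)) ` cball 0 V. cmod w \<le> D"
    unfolding bounded_iff by blast
  hence D: "cmod (q (of_real c + u / of_real \<kappa>)) \<le> D" if "cmod u \<le> V" for u using that by simp
  have V0: "V \<ge> 0" by (simp add: V_def)
  have D0: "D \<ge> 0" by (rule order_trans[OF norm_ge_zero D[of 0]]) (simp add: V0)
  \<comment> \<open>A lower bound for the comparison function on |u| \<le> V; the absolute value of
    d covers both signs of the exponent.\<close>
  define \<epsilon> where "\<epsilon> = (1 + V) powr (- \<bar>d\<bar>) * exp (- (V * ln (1 + V)))"
  have \<epsilon>: "\<epsilon> > 0" using V0 by (auto simp: \<epsilon>_def intro!: mult_pos_pos)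
  have low: "\<epsilon> \<le> (1 + cmod u) powr d * exp (stirling_exponent u)" if u: "Re u \<ge> 0" "cmod u \<le> V" for u
  proof -
    have "(1 + V) powr (- \<bar>d\<bar>) \<le> (1 + cmod u) powr (- \<bar>d\<bar>)" using u by (intro powr_mono2') (auto simp: add_pos_nonneg)
    also have "\<dots> \<le> (1 + cmod u) powr d" by (intro powr_mono) auto
    finally have 1: "(1 + V) powr (- \<bar>d\<bar>) \<le> (1 + cmod u) powr d" .
    have "cmod u * ln (1 + cmod u) \<le> V * ln (1 + V)" using u V0 by (intro mult_mono) (auto simp: add_pos_nonneg)
    hence "- (V * ln (1 + V)) \<le> stirling_exponent u" using stirling_exponent_ge[OF u(1)] by linarith
    with 1 show ?thesis unfolding \<epsilon>_def by (intro mult_mono) auto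
  qed
  have "cmod (q (of_real c + u / of_real \<kappa>)) \<le> (\<bar>B\<bar> + D / \<epsilon>) * (1 + cmod u) powr d * exp (stirling_exponent u)"
    if u: "Re u \<ge> 0" for u
  proof (cases "cmod u \<le> V")
    case True
    have "cmod (q (of_real c + u / of_real \<kappa>)) \<le> D" by (rule D[OF True])
    also have "D = D / \<epsilon> * \<epsilon>" using \<epsilon> by simp
    also have "\<dots> \<le> (\<bar>B\<bar> + D / \<epsilon>) * ((1 + cmod u) powr d * exp (stirling_exponent u))"
      using low[OF u True] \<epsilon> D0 by (intro mult_mono) auto
    finally show ?thesis by (simp only: mult.assoc)
  next
    case False
    have "cmod (q (of_real c + u / of_real \<kappa>)) \<le> B * (1 + cmod u) powr d * exp (stirling_exponent u)"
      using False by (intro far u) (auto simp: V_def)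
    also have "\<dots> \<le> (\<bar>B\<bar> + D / \<epsilon>) * (1 + cmod u) powr d * exp (stirling_exponent u)"
      using D0 \<epsilon> by (intro mult_right_mono) (auto intro: order_trans[OF abs_ge_self])
    finally show ?thesis .
  qed
  moreover have "\<bar>B\<bar> + D / \<epsilon> \<ge> 0" using D0 \<epsilon> by simp
  ultimately show ?thesis unfolding gamma_growth_def using hol by blast
qed

text \<open>Up to finitely many terms the sum is the exponential series at Z = e^L. Terms with
  negative index vanish at the poles of Gamma; if the sum starts at a positive index, each missing
  index is at most c, so the missing term is at most e^(c Re L).\<close>

lemma exp_series_tail_bound:
  fixes c :: real
  defines "n0 \<equiv> \<lfloor>c\<rfloor> + 1"
  assumes L: "Re L \<ge> 0"
  shows "cmod ((\<Sum>j. twist 1 (\<lambda>s. rGamma (s + 1)) L (of_int (n0 + int j))) - exp (exp L))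
           \<le> real (nat n0) * exp (c * Re L)"
proof -
  define f where "f = (\<lambda>j. twist 1 (\<lambda>s. rGamma (s + 1)) L (of_int (n0 + int j)))"
  define g where "g = (\<lambda>j. exp L ^ j /\<^sub>R fact j)"
  have g: "g sums exp (exp L)" unfolding g_def by (rule exp_converges)
  have tw: "twist 1 (\<lambda>s. rGamma (s + 1)) L (of_nat n) = g n" for n
  proof -
    have "rGamma (of_nat n + 1 :: complex) = inverse (fact n)"
      using rGamma_of_int[of "int n + 1", where ?'a = complex] by simp
    moreover have "exp (of_nat n * L) = exp L ^ n" by (rule exp_of_nat_mult)
    ultimately show ?thesis by (simp add: twist_def g_def scaleR_conv_of_real mult.commute)
  qed
  show ?thesis
  proof (cases "n0 \<le> 0")
    case True
    define k where "k = nat (- n0)"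
    have "(\<lambda>j. f (j + k)) = g"
    proof
      fix j
      have *: "complex_of_int (n0 + int (j + k)) = of_nat j" using True by (simp add: k_def)
      show "f (j + k) = g j" unfolding f_def * by (rule tw)
    qed
    hence "(\<lambda>j. f (j + k)) sums exp (exp L)" using g by simp
    hence "f sums (exp (exp L) + (\<Sum>i<k. f i))" unfolding sums_iff_shift .
    moreover have "f i = 0" if "i < k" for i
    proof -
      have "rGamma (complex_of_int (n0 + int i + 1)) = 0"
        unfolding rGamma_of_int using that by (auto simp: k_def)
      thus ?thesis unfolding f_def twist_def by simp
    qed
    ultimately have "f sums exp (exp L)" by simp
    hence "suminf f = exp (exp L)" by (rule sums_unique[symmetric])
    thus ?thesis unfolding f_def[symmetric] by simp
  next
    case False
    define m where "m = nat n0"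
    have fg: "f = (\<lambda>j. g (j + m))"
    proof
      fix j
      have *: "complex_of_int (n0 + int j) = of_nat (j + m)" using False by (simp add: m_def)
      show "f j = g (j + m)" unfolding f_def * by (rule tw)
    qed
    have "g sums (exp (exp L) - (\<Sum>i<m. g i) + (\<Sum>i<m. g i))" using g by simp
    hence "f sums (exp (exp L) - (\<Sum>i<m. g i))" unfolding fg sums_iff_shift .
    hence "suminf f = exp (exp L) - (\<Sum>i<m. g i)" by (rule sums_unique[symmetric])
    hence "suminf f - exp (exp L) = - (\<Sum>i<m. g i)" by simp
    moreover have "cmod (\<Sum>i<m. g i) \<le> real m * exp (c * Re L)"
    proof -
      have "cmod (\<Sum>i<m. g i) \<le> (\<Sum>i<m. exp (c * Re L))"
      proof (rule sum_norm_le)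
        fix i assume i: "i \<in> {..<m}"
        have "cmod (g i) = exp (Re L) ^ i / fact i"
          by (simp add: g_def norm_power divide_inverse mult.commute)
        also have "\<dots> = exp (real i * Re L) / fact i" by (simp add: exp_of_nat_mult)
        also have "\<dots> \<le> exp (real i * Re L)" by (simp add: divide_le_eq fact_ge_1)
        also have "\<dots> \<le> exp (c * Re L)"
        proof -
          have "int i \<le> \<lfloor>c\<rfloor>" using i False unfolding m_def n0_def by auto
          hence "real i \<le> c" by (simp add: le_floor_iff)
          thus ?thesis using L by (simp add: mult_right_mono)
        qed
        finally show "cmod (g i) \<le> exp (c * Re L)" .
      qed
      thus ?thesis by simp
    qed
    ultimately show ?thesis unfolding f_def[symmetric] m_def[symmetric] by simp
  qed
qed

text \<open>Substitution of u = \<kappa> s + b - 1, which moves the initial point to \<kappa> c + b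
  - 1.\<close>

lemma ray_integral_rGamma_scale:
  assumes \<kappa>: "\<kappa> > 0"
  shows "ray_integral (of_real (\<kappa> * c + b - 1)) 1 (twist 1 (\<lambda>s. rGamma (s + 1)) L) =
           of_real \<kappa> * exp (of_real (b - 1) * L) *
             ray_integral (of_real c) 1 (twist \<kappa> (\<lambda>s. rGamma (of_real \<kappa> * s + of_real b)) L)"
proof -
  let ?f = "\<lambda>t. indicator {0..} t *\<^sub>R twist 1 (\<lambda>s. rGamma (s + 1)) L (of_real (\<kappa> * c + b - 1) + of_real t * 1)"
  have "integral\<^sup>L lborel ?f = \<bar>\<kappa>\<bar> *\<^sub>R integral\<^sup>L lborel (\<lambda>t. ?f (0 + \<kappa> * t))"
    using \<kappa> by (intro lborel_integral_real_affine) auto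
  also have "(\<lambda>t. ?f (0 + \<kappa> * t)) = (\<lambda>t. exp (of_real (b - 1) * L) *
       (indicator {0..} t *\<^sub>R twist \<kappa> (\<lambda>s. rGamma (of_real \<kappa> * s + of_real b)) L (of_real c + of_real t * 1)))"
  proof
    fix t
    have "indicator {0..} (\<kappa> * t) = (indicator {0..} t :: real)"
      using \<kappa> by (auto simp: indicator_def zero_le_mult_iff)
    moreover have "twist 1 (\<lambda>s. rGamma (s + 1)) L (of_real (\<kappa> * c + b - 1) + of_real (\<kappa> * t)) =
        exp (of_real (b - 1) * L) * twist \<kappa> (\<lambda>s. rGamma (of_real \<kappa> * s + of_real b)) L (of_real c + of_real t)"
    proof -
      have 1: "of_real (\<kappa> * c + b - 1) + of_real (\<kappa> * t) + 1 = of_real \<kappa> * (of_real c + of_real t) + (of_real b :: complex)"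
        by (simp add: algebra_simps)
      have 2: "of_real 1 * (of_real (\<kappa> * c + b - 1) + of_real (\<kappa> * t)) * L =
          of_real (b - 1) * L + of_real \<kappa> * (of_real c + of_real t) * L"
        by (simp add: algebra_simps)
      show ?thesis unfolding twist_def 1 2 exp_add by (simp only: mult_ac)
    qed
    ultimately show "?f (0 + \<kappa> * t) = exp (of_real (b - 1) * L) *
       (indicator {0..} t *\<^sub>R twist \<kappa> (\<lambda>s. rGamma (of_real \<kappa> * s + of_real b)) L (of_real c + of_real t * 1))"
      by simp
  qed
  also have "\<bar>\<kappa>\<bar> *\<^sub>R integral\<^sup>L lborel \<dots> = of_real \<kappa> * exp (of_real (b - 1) * L) * integral\<^sup>L lborel
       (\<lambda>t. indicator {0..} t *\<^sub>R twist \<kappa> (\<lambda>s. rGamma (of_real \<kappa> * s + of_real b)) L (of_real c + of_real t * 1))"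
    using \<kappa> by (simp add: scaleR_conv_of_real mult.assoc)
  finally show ?thesis unfolding ray_integral_def set_lebesgue_integral_def by simp
qed

text \<open>The summation formula read backwards: for \<kappa> = 1 it says that the integral of
  Z^u/Gamma(u + 1) is close to a sum known in closed form. The summation formula requires a
  non-integral initial point, hence the condition on \<kappa> c + b.\<close>

lemma ray_integral_rGamma:
  assumes \<kappa>: "\<kappa> > 0" and cb: "\<kappa> * c + b \<notin> \<int>"
  shows "\<exists>C\<ge>0. \<forall>L. \<bar>Im L\<bar> \<le> pi \<and> Re L \<ge> 0 \<longrightarrow>
           cmod (ray_integral (of_real c) 1 (twist \<kappa> (\<lambda>s. rGamma (of_real \<kappa> * s + of_real b)) L)
                  - of_real (1 / \<kappa>) * exp (of_real (1 - b) * L) * exp (exp L))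
             \<le> C * exp (\<kappa> * c * Re L)"
proof -
  define c1 where "c1 = \<kappa> * c + b - 1"
  have c1: "c1 \<notin> \<int>" using cb unfolding c1_def by (metis Ints_1 Ints_add diff_add_cancel)
  have gr: "gamma_growth 1 c1 (1 - (1 * c1 + 1)) (\<lambda>s. rGamma (s + 1))"
    using gamma_growth_rGamma[of 1 c1 1] by simp
  \<comment> \<open>For \<kappa> = 1 the choice \<eta> = pi/2 admits exactly the arguments |Im L|
    \<le> pi.\<close>
  obtain C where C: "C \<ge> 0" "\<And>L. \<bar>Im L\<bar> \<le> 2 * pi / 1 - pi / 2 - pi / 2 \<Longrightarrow>
      cmod ((\<Sum>j. twist 1 (\<lambda>s. rGamma (s + 1)) L (of_int (\<lfloor>c1\<rfloor> + 1 + int j))) - ray_integral (of_real c1) 1 (twist 1 (\<lambda>s. rGamma (s + 1)) L))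
             \<le> C * exp (1 * c1 * Re L)"
    using sum_eq_ray_integral[OF zero_less_one gr c1, of "pi / 2"] by auto
  define m where "m = real (nat (\<lfloor>c1\<rfloor> + 1))"
  show ?thesis
  proof (intro exI[of _ "(C + m) / \<kappa>"] conjI allI impI; (elim conjE)?)
    show "0 \<le> (C + m) / \<kappa>" using C(1) \<kappa> by (simp add: m_def)
  next
    fix L assume L: "\<bar>Im L\<bar> \<le> pi" "Re L \<ge> 0"
    let ?I = "ray_integral (of_real c) 1 (twist \<kappa> (\<lambda>s. rGamma (of_real \<kappa> * s + of_real b)) L)"
    let ?I1 = "ray_integral (of_real c1) 1 (twist 1 (\<lambda>s. rGamma (s + 1)) L)"
    let ?S = "\<Sum>j. twist 1 (\<lambda>s. rGamma (s + 1)) L (of_int (\<lfloor>c1\<rfloor> + 1 + int j))"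
    have 1: "cmod (?S - ?I1) \<le> C * exp (c1 * Re L)" using C(2)[of L] L by simp
    have 2: "cmod (?S - exp (exp L)) \<le> m * exp (c1 * Re L)"
      unfolding m_def by (rule exp_series_tail_bound[OF L(2)])
    have "cmod (?I1 - exp (exp L)) = cmod ((?S - exp (exp L)) - (?S - ?I1))" by simp
    also have "\<dots> \<le> m * exp (c1 * Re L) + C * exp (c1 * Re L)"
      by (rule order_trans[OF norm_triangle_ineq4 add_mono[OF 2 1]])
    finally have 3: "cmod (?I1 - exp (exp L)) \<le> (C + m) * exp (c1 * Re L)" by (simp add: distrib_right)
    have "exp (of_real (1 - b) * L) * exp (of_real (b - 1) * L) = 1"
      unfolding exp_add[symmetric] by (simp add: algebra_simps)
    hence "?I = of_real (1 / \<kappa>) * exp (of_real (1 - b) * L) * ?I1"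
      unfolding c1_def ray_integral_rGamma_scale[OF \<kappa>] using \<kappa> by (simp add: field_simps)
    hence "?I - of_real (1 / \<kappa>) * exp (of_real (1 - b) * L) * exp (exp L) =
           of_real (1 / \<kappa>) * exp (of_real (1 - b) * L) * (?I1 - exp (exp L))"
      by (simp only: right_diff_distrib)
    hence "cmod (?I - of_real (1 / \<kappa>) * exp (of_real (1 - b) * L) * exp (exp L)) =
           1 / \<kappa> * exp ((1 - b) * Re L) * cmod (?I1 - exp (exp L))"
      using \<kappa> by (simp add: norm_mult norm_divide)
    also have "\<dots> \<le> 1 / \<kappa> * exp ((1 - b) * Re L) * ((C + m) * exp (c1 * Re L))"
      using 3 \<kappa> by (intro mult_left_mono) auto
    also have "\<dots> = (C + m) / \<kappa> * (exp ((1 - b) * Re L) * exp (c1 * Re L))" by simp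
    also have "exp ((1 - b) * Re L) * exp (c1 * Re L) = exp (\<kappa> * c * Re L)"
      unfolding exp_add[symmetric] by (simp add: c1_def algebra_simps)
    finally show "cmod (?I - of_real (1 / \<kappa>) * exp (of_real (1 - b) * L) * exp (exp L)) \<le> (C + m) / \<kappa> * exp (\<kappa> * c * Re L)" .
  qed
qed

section \<open>The coefficient function of the Struve series and its remainders\<close>

definition struve_coeff :: "real \<Rightarrow> real \<Rightarrow> complex \<Rightarrow> complex" where
  "struve_coeff \<nu> a s = rGamma (s + 3/2) * rGamma (of_real a * s + of_real \<nu> + 3/2)"

text \<open>Since Z^\<kappa> = h \<kappa>^\<kappa> \<zeta>, removing (h \<kappa>^\<kappa>)^s from
  the coefficient makes its product with Z^(\<kappa> s) equal to the term with \<zeta>^s.\<close>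

definition scaled_coeff :: "real \<Rightarrow> real \<Rightarrow> complex \<Rightarrow> complex" where
  "scaled_coeff \<nu> a s = struve_coeff \<nu> a s * exp (- (s * of_real (ln (hpar a * kappa a powr kappa a))))"

text \<open>Given as a difference and not through \<rho>: the difference is visibly entire, whereas
  \<rho> is tied to the expansion for large s only and is not assumed to be holomorphic.\<close>

definition scaled_remainder :: "real \<Rightarrow> real \<Rightarrow> (nat \<Rightarrow> real) \<Rightarrow> nat \<Rightarrow> complex \<Rightarrow> complex" where
  "scaled_remainder \<nu> a c M s = scaled_coeff \<nu> a s - of_real (kappa a * A0 \<nu> a) *
     (\<Sum>j<M. of_real (c j) * rGamma (of_real (kappa a) * s + of_real (vartheta' \<nu> + real j)))"

definition exp_expansion :: "real \<Rightarrow> real \<Rightarrow> (nat \<Rightarrow> real) \<Rightarrow> nat \<Rightarrow> complex \<Rightarrow> complex" where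
  "exp_expansion \<nu> a c M L = of_real (A0 \<nu> a) * exp (exp L) *
     (\<Sum>j<M. of_real (c j) * exp (of_real (vartheta \<nu> - real j) * L))"

lemma hpar_kappa_pos: "a > 0 \<Longrightarrow> hpar a * kappa a powr kappa a > 0"
  by (simp add: hpar_def kappa_def)

text \<open>A half-plane Re s \<ge> c0 with c0 < 0 reaches beyond the imaginary axis, so a sector
  wider than the right half-plane is required. Taking \<epsilon> = pi/3 in the expansion provides
  one.\<close>

lemma scaled_remainder_far:
  assumes a: "a > 0" and c: "inverse_factorial_coeffs \<nu> a c" and M: "M \<ge> 1"
  shows "\<exists>B X. \<forall>s. cmod s \<ge> X \<and> \<bar>Arg s\<bar> \<le> 2 * pi / 3 \<longrightarrow>
           cmod (scaled_remainder \<nu> a c M s) \<le> B * cmod (rGamma (of_real (kappa a) * s + of_real (vartheta' \<nu> + real M)))"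
proof -
  define F where "F = inf at_infinity (principal {s. \<bar>Arg s\<bar> \<le> pi - pi / 3})"
  define w where "w = hpar a * kappa a powr kappa a"
  have w: "w > 0" unfolding w_def by (rule hpar_kappa_pos[OF a])
  from c M obtain \<rho> :: "complex \<Rightarrow> complex" where "\<forall>\<epsilon>>0.
        (\<forall>\<^sub>F s in inf at_infinity (principal {s. \<bar>Arg s\<bar> \<le> pi - \<epsilon>}).
           rGamma (s + 3/2) * rGamma (of_real a * s + of_real \<nu> + 3/2) =
           of_real (kappa a * A0 \<nu> a) * of_real (hpar a * kappa a powr kappa a) powr s *
             ((\<Sum>j<M. of_real (c j) * rGamma (of_real (kappa a) * s + of_real (vartheta' \<nu>) + of_nat j))
              + \<rho> s * rGamma (of_real (kappa a) * s + of_real (vartheta' \<nu>) + of_nat M))) \<and>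
        \<rho> \<in> O[inf at_infinity (principal {s. \<bar>Arg s\<bar> \<le> pi - \<epsilon>})](\<lambda>_. 1)"
    unfolding inverse_factorial_coeffs_def by blast
  hence ev: "\<forall>\<^sub>F s in F. struve_coeff \<nu> a s =
           of_real (kappa a * A0 \<nu> a) * of_real w powr s *
             ((\<Sum>j<M. of_real (c j) * rGamma (of_real (kappa a) * s + of_real (vartheta' \<nu>) + of_nat j))
              + \<rho> s * rGamma (of_real (kappa a) * s + of_real (vartheta' \<nu>) + of_nat M))"
    and O: "\<rho> \<in> O[F](\<lambda>_. 1)"
    unfolding F_def w_def struve_coeff_def using pi_gt_zero by (auto elim!: allE[of _ "pi / 3"])
  from O obtain D where D: "\<forall>\<^sub>F s in F. cmod (\<rho> s) \<le> D * norm (1::complex)"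
    by (rule landau_o.bigE)
  have "\<forall>\<^sub>F s in F. cmod (scaled_remainder \<nu> a c M s) \<le>
          \<bar>kappa a * A0 \<nu> a\<bar> * D * cmod (rGamma (of_real (kappa a) * s + of_real (vartheta' \<nu> + real M)))"
    using ev D
  proof eventually_elim
    case (elim s)
    have "of_real w powr s * exp (- (s * of_real (ln w))) = (1::complex)"
      using w by (simp add: powr_def Ln_of_real exp_add[symmetric])
    hence "scaled_coeff \<nu> a s = of_real (kappa a * A0 \<nu> a) *
             ((\<Sum>j<M. of_real (c j) * rGamma (of_real (kappa a) * s + of_real (vartheta' \<nu>) + of_nat j))
              + \<rho> s * rGamma (of_real (kappa a) * s + of_real (vartheta' \<nu>) + of_nat M))"
      unfolding scaled_coeff_def elim(1) w_def[symmetric] by (simp only: mult_ac) (simp add: mult.assoc[symmetric])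
    hence "scaled_remainder \<nu> a c M s = of_real (kappa a * A0 \<nu> a) *
              (\<rho> s * rGamma (of_real (kappa a) * s + of_real (vartheta' \<nu> + real M)))"
      unfolding scaled_remainder_def by (simp add: add.assoc distrib_left)
    hence "cmod (scaled_remainder \<nu> a c M s) = \<bar>kappa a * A0 \<nu> a\<bar> *
              (cmod (\<rho> s) * cmod (rGamma (of_real (kappa a) * s + of_real (vartheta' \<nu> + real M))))"
      by (simp only: norm_mult norm_of_real)
    also have "\<dots> \<le> \<bar>kappa a * A0 \<nu> a\<bar> * (D * cmod (rGamma (of_real (kappa a) * s + of_real (vartheta' \<nu> + real M))))"
      using elim(2) by (intro mult_left_mono mult_right_mono) auto
    finally show ?case by (simp only: mult.assoc)
  qed
  hence "\<exists>X. \<forall>s. X \<le> cmod s \<longrightarrow> \<bar>Arg s\<bar> \<le> pi - pi / 3 \<longrightarrow> cmod (scaled_remainder \<nu> a c M s) \<le>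
          \<bar>kappa a * A0 \<nu> a\<bar> * D * cmod (rGamma (of_real (kappa a) * s + of_real (vartheta' \<nu> + real M)))"
    unfolding F_def eventually_inf_principal eventually_at_infinity by auto
  moreover have "pi - pi / 3 = 2 * pi / 3" by simp
  ultimately show ?thesis by auto
qed

lemma Arg_le_if_Re_ge:
  assumes "s \<noteq> 0" "Re s \<ge> - cmod s / 2"
  shows "\<bar>Arg s\<bar> \<le> 2 * pi / 3"
proof (rule ccontr)
  assume "\<not> \<bar>Arg s\<bar> \<le> 2 * pi / 3"
  hence 1: "\<bar>Arg s\<bar> > 2 * pi / 3" by simp
  have "\<bar>Arg s\<bar> \<le> pi" using Arg_le_pi[of s] mpi_less_Arg[of s] by linarith
  hence "cos \<bar>Arg s\<bar> < cos (2 * pi / 3)" using 1 by (intro cos_monotone_0_pi) auto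
  also have "cos (2 * pi / 3) = - 1 / 2" using cos_120 by simp
  finally have "cos (Arg s) < - 1 / 2" by simp
  moreover have "Re s = cmod s * cos (Arg s)" using assms cos_Arg[of s] by simp
  ultimately have "Re s < cmod s * (- 1 / 2)" using assms(1) by (simp only: mult_strict_left_mono zero_less_norm_iff not_False_eq_True)
  thus False using assms(2) by simp
qed

lemma gamma_growth_scaled_remainder:
  assumes a: "a > 0" and c: "inverse_factorial_coeffs \<nu> a c" and M: "M \<ge> 1"
  shows "gamma_growth (kappa a) c0 (1 - (kappa a * c0 + (vartheta' \<nu> + real M))) (scaled_remainder \<nu> a c M)"
proof -
  have \<kappa>: "kappa a > 0" using a by (simp add: kappa_def)
  obtain B X where BX: "\<And>s. cmod s \<ge> X \<Longrightarrow> \<bar>Arg s\<bar> \<le> 2 * pi / 3 \<Longrightarrow>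
           cmod (scaled_remainder \<nu> a c M s) \<le> B * cmod (rGamma (of_real (kappa a) * s + of_real (vartheta' \<nu> + real M)))"
    using scaled_remainder_far[OF a c M] by blast
  let ?d = "1 - (kappa a * c0 + (vartheta' \<nu> + real M))"
  obtain B' where B': "B' \<ge> 0" "\<And>u. Re u \<ge> 0 \<Longrightarrow> cmod (rGamma (of_real (kappa a) * (of_real c0 + u / of_real (kappa a)) + of_real (vartheta' \<nu> + real M)))
       \<le> B' * (1 + cmod u) powr ?d * exp (stirling_exponent u)"
    using gamma_growth_rGamma[OF \<kappa>, of c0 "vartheta' \<nu> + real M"] unfolding gamma_growth_def by blast
  show ?thesis
  \<comment> \<open>One |c0| of the three is lost in passing from u/\<kappa> to s = c0 + u/\<kappa>.
    The other two give |s| \<ge> 2 |c0|, hence Re s \<ge> - |c0| \<ge> - |s|/2, which places s in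
    the sector of half-angle 2 pi/3.\<close>
  proof (rule gamma_growth_if_far[where B = "\<bar>B\<bar> * B'" and U = "kappa a * (\<bar>X\<bar> + 3 * \<bar>c0\<bar> + 1)"])
    show "scaled_remainder \<nu> a c M holomorphic_on UNIV"
      unfolding scaled_remainder_def scaled_coeff_def struve_coeff_def by (intro holomorphic_intros)
    fix u assume u: "Re u \<ge> 0" "cmod u \<ge> kappa a * (\<bar>X\<bar> + 3 * \<bar>c0\<bar> + 1)"
    define s where "s = of_real c0 + u / of_real (kappa a)"
    have "cmod (u / of_real (kappa a)) = cmod u / kappa a" using \<kappa> by (simp add: norm_divide)
    also have "\<dots> \<ge> \<bar>X\<bar> + 3 * \<bar>c0\<bar> + 1" using u(2) \<kappa> by (simp add: field_simps)
    finally have "cmod s \<ge> \<bar>X\<bar> + 2 * \<bar>c0\<bar> + 1"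
      using norm_triangle_ineq4[of s "of_real c0"] unfolding s_def by simp
    moreover have "Re s \<ge> - \<bar>c0\<bar>" unfolding s_def using u(1) \<kappa> by (simp add: add_increasing2)
    ultimately have "cmod s \<ge> X" "cmod s > 0" "Re s \<ge> - cmod s / 2" by linarith+
    hence "cmod s \<ge> X" "\<bar>Arg s\<bar> \<le> 2 * pi / 3"
      by (auto intro!: Arg_le_if_Re_ge[simplified])
    hence "cmod (scaled_remainder \<nu> a c M s) \<le> B * cmod (rGamma (of_real (kappa a) * s + of_real (vartheta' \<nu> + real M)))"
      by (rule BX)
    also have "\<dots> \<le> \<bar>B\<bar> * (B' * (1 + cmod u) powr ?d * exp (stirling_exponent u))"
      using B'(2)[OF u(1)] unfolding s_def by (intro mult_mono) auto
    finally show "cmod (scaled_remainder \<nu> a c M (of_real c0 + u / of_real (kappa a))) \<le> \<bar>B\<bar> * B' * (1 + cmod u) powr ?d * exp (stirling_exponent u)"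
      unfolding s_def by (simp only: mult.assoc)
  qed
qed

definition rGamma_term :: "real \<Rightarrow> real \<Rightarrow> nat \<Rightarrow> complex \<Rightarrow> complex" where
  "rGamma_term \<nu> a j s = rGamma (of_real (kappa a) * s + of_real (vartheta' \<nu> + real j))"

lemma scaled_coeff_eq:
  "scaled_coeff \<nu> a s = (\<Sum>j<M. of_real (kappa a * A0 \<nu> a * c j) * rGamma_term \<nu> a j s) + scaled_remainder \<nu> a c M s"
  by (simp add: scaled_remainder_def rGamma_term_def sum_distrib_left mult.assoc)

lemma gamma_growth_rGamma_term:
  assumes "a > 0"
  shows "gamma_growth (kappa a) c0 (1 - (kappa a * c0 + vartheta' \<nu>)) (rGamma_term \<nu> a j)"
  unfolding rGamma_term_def
  by (rule gamma_growth_mono[OF gamma_growth_rGamma]) (use assms in \<open>auto simp: kappa_def\<close>)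

text \<open>The leading term of the expansion together with its remainder already determines the
  size.\<close>

lemma gamma_growth_scaled_coeff:
  assumes a: "a > 0" and c: "inverse_factorial_coeffs \<nu> a c"
  shows "gamma_growth (kappa a) c0 (1 - (kappa a * c0 + vartheta' \<nu>)) (scaled_coeff \<nu> a)"
proof -
  have "scaled_coeff \<nu> a = (\<lambda>s. (\<Sum>j<1. of_real (kappa a * A0 \<nu> a * c j) * rGamma_term \<nu> a j s) + scaled_remainder \<nu> a c 1 s)"
    using scaled_coeff_eq[of \<nu> a _ c 1] by auto
  moreover have "gamma_growth (kappa a) c0 (1 - (kappa a * c0 + vartheta' \<nu>)) \<dots>"
    by (intro gamma_growth_add gamma_growth_sum gamma_growth_cmult gamma_growth_rGamma_term a
        gamma_growth_mono[OF gamma_growth_scaled_remainder[OF a c]]) auto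
  ultimately show ?thesis by simp
qed

lemma twist_integrable:
  assumes \<kappa>: "\<kappa> > 0" and q: "gamma_growth \<kappa> c d q"
  shows "set_integrable lborel {0..} (\<lambda>t. twist \<kappa> q L (of_real c + of_real t * 1))"
proof -
  have p: "0 < pi / 4" "pi / 4 < pi / 2" by auto
  obtain B where B: "\<And>\<rho> \<psi>. \<rho> \<ge> 0 \<Longrightarrow> \<bar>\<psi>\<bar> \<le> pi / 4 \<Longrightarrow> cmod (twist \<kappa> q L (of_real c + of_real \<rho> * cis \<psi>)) \<le> B / (1 + \<rho>)\<^sup>2"
    using decays_on_sector_twist[OF \<kappa> q p, of L] unfolding decays_on_sector_def by blast
  show ?thesis
    using B[of _ 0] by (intro ray_integrable[where B = B] continuous_on_ray holomorphic_on_imp_continuous_on holomorphic_twist[OF q]) auto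
qed

lemma ray_integral_twist_add:
  assumes \<kappa>: "\<kappa> > 0" and "gamma_growth \<kappa> c d p" "gamma_growth \<kappa> c d' q"
  shows "ray_integral (of_real c) 1 (twist \<kappa> (\<lambda>s. p s + q s) L) =
           ray_integral (of_real c) 1 (twist \<kappa> p L) + ray_integral (of_real c) 1 (twist \<kappa> q L)"
proof -
  have "twist \<kappa> (\<lambda>s. p s + q s) L = (\<lambda>s. twist \<kappa> p L s + twist \<kappa> q L s)"
    by (simp add: twist_def fun_eq_iff distrib_right)
  thus ?thesis using ray_integral_add[OF twist_integrable[OF \<kappa> assms(2)] twist_integrable[OF \<kappa> assms(3)]] by simp
qed

lemma ray_integral_twist_sum:
  fixes M :: nat
  assumes \<kappa>: "\<kappa> > 0" and "\<And>j. gamma_growth \<kappa> c d (q j)"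
  shows "ray_integral (of_real c) 1 (twist \<kappa> (\<lambda>s. \<Sum>j<M. of_real (k j) * q j s) L) =
           (\<Sum>j<M. of_real (k j) * ray_integral (of_real c) 1 (twist \<kappa> (q j) L))"
proof (induction M)
  case 0
  thus ?case by (simp add: twist_def ray_integral_def)
next
  case (Suc M)
  have "ray_integral (of_real c) 1 (twist \<kappa> (\<lambda>s. (\<Sum>j<M. of_real (k j) * q j s) + of_real (k M) * q M s) L) =
     ray_integral (of_real c) 1 (twist \<kappa> (\<lambda>s. \<Sum>j<M. of_real (k j) * q j s) L) + ray_integral (of_real c) 1 (twist \<kappa> (\<lambda>s. of_real (k M) * q M s) L)"
    by (rule ray_integral_twist_add[OF \<kappa> gamma_growth_sum gamma_growth_cmult[OF assms(2)]]) (rule gamma_growth_cmult[OF assms(2)])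
  also have "twist \<kappa> (\<lambda>s. of_real (k M) * q M s) L = (\<lambda>s. of_real (k M) * twist \<kappa> (q M) L s)"
    by (simp add: twist_def fun_eq_iff mult.assoc)
  finally show ?case using Suc by (simp add: ray_integral_cmult)
qed

text \<open>Each term of the inverse factorial expansion integrates to a term of the exponential
  expansion; the remainder is estimated on a rotated ray. The lower bound 3 gives the remainder the
  decay exponent -2 needed there, and non-integrality makes \<kappa> c0 + vartheta' + j - 1 an
  admissible initial point for every j.\<close>

lemma ray_integral_scaled_coeff:
  assumes a: "a > 0" and c: "inverse_factorial_coeffs \<nu> a c"
    and c0: "kappa a * c0 + vartheta' \<nu> \<notin> \<int>" and M: "M \<ge> 1" "kappa a * c0 + vartheta' \<nu> + real M \<ge> 3"
  shows "\<exists>C\<ge>0. \<forall>L. \<bar>Im L\<bar> \<le> pi \<and> Re L \<ge> 0 \<longrightarrow>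
           cmod (ray_integral (of_real c0) 1 (twist (kappa a) (scaled_coeff \<nu> a) L) - exp_expansion \<nu> a c M L)
             \<le> C * exp (kappa a * c0 * Re L + exp (Re L) * max 0 (cos (Im L)))"
proof -
  define \<kappa> where "\<kappa> = kappa a"
  have \<kappa>: "\<kappa> > 0" using a by (simp add: \<kappa>_def kappa_def)
  have "\<exists>C\<ge>0. \<forall>L. \<bar>Im L\<bar> \<le> pi \<and> Re L \<ge> 0 \<longrightarrow>
           cmod (ray_integral (of_real c0) 1 (twist \<kappa> (rGamma_term \<nu> a j) L)
                  - of_real (1 / \<kappa>) * exp (of_real (1 - (vartheta' \<nu> + real j)) * L) * exp (exp L))
             \<le> C * exp (\<kappa> * c0 * Re L)" for j
  proof -
    have "\<kappa> * c0 + (vartheta' \<nu> + real j) \<notin> \<int>"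
    proof
      assume "\<kappa> * c0 + (vartheta' \<nu> + real j) \<in> \<int>"
      hence "\<kappa> * c0 + (vartheta' \<nu> + real j) - real j \<in> \<int>" by (intro Ints_diff) auto
      thus False using c0 by (simp add: \<kappa>_def)
    qed
    from ray_integral_rGamma[OF \<kappa> this] show ?thesis
      unfolding \<kappa>_def rGamma_term_def by blast
  qed
  then obtain C where C: "\<And>j. C j \<ge> 0" "\<And>j L. \<bar>Im L\<bar> \<le> pi \<Longrightarrow> Re L \<ge> 0 \<Longrightarrow>
           cmod (ray_integral (of_real c0) 1 (twist \<kappa> (rGamma_term \<nu> a j) L)
                  - of_real (1 / \<kappa>) * exp (of_real (1 - (vartheta' \<nu> + real j)) * L) * exp (exp L))
             \<le> C j * exp (\<kappa> * c0 * Re L)"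
    by metis
  have d: "1 - (kappa a * c0 + (vartheta' \<nu> + real M)) \<le> - 2" using M by simp
  obtain C' where C': "C' \<ge> 0" "\<And>L. cmod (ray_integral (of_real c0) 1 (twist \<kappa> (scaled_remainder \<nu> a c M) L)) \<le>
           C' * exp (\<kappa> * c0 * Re L + (if \<bar>Im L\<bar> < pi / 2 then exp (Re L) * cos (Im L) else 0))"
    using ray_integral_twist_bound[OF \<kappa> gamma_growth_scaled_remainder[OF a c M(1), of c0, folded \<kappa>_def] d[folded \<kappa>_def]] by blast
  define k where "k = (\<lambda>j. \<kappa> * A0 \<nu> a * c j)"
  define D where "D = (\<Sum>j<M. \<bar>k j\<bar> * C j) + C'"
  show ?thesis
  proof (intro exI[of _ D] conjI allI impI; (elim conjE)?)
    show "0 \<le> D" unfolding D_def using C(1) C'(1) by (intro add_nonneg_nonneg sum_nonneg) auto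
  next
    fix L assume L: "\<bar>Im L\<bar> \<le> pi" "Re L \<ge> 0"
    define I where "I = (\<lambda>j. ray_integral (of_real c0) 1 (twist \<kappa> (rGamma_term \<nu> a j) L))"
    define E where "E = (\<lambda>j. of_real (1 / \<kappa>) * exp (of_real (1 - (vartheta' \<nu> + real j)) * L) * exp (exp L))"
    define J where "J = ray_integral (of_real c0) 1 (twist \<kappa> (scaled_remainder \<nu> a c M) L)"
    let ?m = "exp (\<kappa> * c0 * Re L + exp (Re L) * max 0 (cos (Im L)))"
    have "scaled_coeff \<nu> a = (\<lambda>s. (\<Sum>j<M. of_real (k j) * rGamma_term \<nu> a j s) + scaled_remainder \<nu> a c M s)"
      using scaled_coeff_eq[of \<nu> a _ c M] by (auto simp: k_def \<kappa>_def)
    hence "ray_integral (of_real c0) 1 (twist \<kappa> (scaled_coeff \<nu> a) L) =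
        ray_integral (of_real c0) 1 (twist \<kappa> (\<lambda>s. \<Sum>j<M. of_real (k j) * rGamma_term \<nu> a j s) L) + J"
      unfolding J_def
      using ray_integral_twist_add[OF \<kappa> gamma_growth_sum[OF gamma_growth_cmult[OF gamma_growth_rGamma_term[OF a, folded \<kappa>_def]]]
          gamma_growth_scaled_remainder[OF a c M(1), folded \<kappa>_def]] by simp
    also have "ray_integral (of_real c0) 1 (twist \<kappa> (\<lambda>s. \<Sum>j<M. of_real (k j) * rGamma_term \<nu> a j s) L) = (\<Sum>j<M. of_real (k j) * I j)"
      unfolding I_def by (rule ray_integral_twist_sum[OF \<kappa> gamma_growth_rGamma_term[OF a, folded \<kappa>_def]])
    finally have int: "ray_integral (of_real c0) 1 (twist \<kappa> (scaled_coeff \<nu> a) L) = (\<Sum>j<M. of_real (k j) * I j) + J" .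
    have "exp_expansion \<nu> a c M L = (\<Sum>j<M. of_real (k j) * E j)"
    proof -
      have "of_real (k j) * E j = of_real (A0 \<nu> a) * exp (exp L) * (of_real (c j) * exp (of_real (vartheta \<nu> - real j) * L))" for j
      proof -
        have *: "1 - (vartheta' \<nu> + real j) = vartheta \<nu> - real j" by (simp add: vartheta'_def)
        show ?thesis unfolding k_def E_def * using \<kappa> by simp
      qed
      thus ?thesis unfolding exp_expansion_def by (simp only: sum_distrib_left)
    qed
    hence "ray_integral (of_real c0) 1 (twist \<kappa> (scaled_coeff \<nu> a) L) - exp_expansion \<nu> a c M L = (\<Sum>j<M. of_real (k j) * (I j - E j)) + J"
      unfolding int by (simp add: sum_subtractf right_diff_distrib)
    also have "cmod \<dots> \<le> (\<Sum>j<M. \<bar>k j\<bar> * C j * ?m) + C' * ?m"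
    proof (rule order_trans[OF norm_triangle_ineq add_mono])
      show "cmod (\<Sum>j<M. of_real (k j) * (I j - E j)) \<le> (\<Sum>j<M. \<bar>k j\<bar> * C j * ?m)"
      proof (rule sum_norm_le)
        fix j
        have "cmod (I j - E j) \<le> C j * exp (\<kappa> * c0 * Re L)" unfolding I_def E_def by (rule C(2)[OF L])
        also have "\<dots> \<le> C j * ?m" using C(1) by (intro mult_left_mono) auto
        finally show "cmod (of_real (k j) * (I j - E j)) \<le> \<bar>k j\<bar> * C j * ?m"
          by (simp add: norm_mult mult.assoc mult_left_mono)
      qed
      have "cmod J \<le> C' * exp (\<kappa> * c0 * Re L + (if \<bar>Im L\<bar> < pi / 2 then exp (Re L) * cos (Im L) else 0))"
        unfolding J_def by (rule C'(2))
      also have "\<dots> \<le> C' * ?m" using C'(1) by (intro mult_left_mono) auto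
      finally show "cmod J \<le> C' * ?m" .
    qed
    also have "\<dots> = D * ?m" by (simp add: D_def distrib_right sum_distrib_right)
    finally show "cmod (ray_integral (of_real c0) 1 (twist (kappa a) (scaled_coeff \<nu> a) L) - exp_expansion \<nu> a c M L)
             \<le> D * exp (kappa a * c0 * Re L + exp (Re L) * max 0 (cos (Im L)))" by (simp only: \<kappa>_def)
  qed
qed

subsection \<open>The generalised Struve function\<close>

text \<open>For \<kappa> < 2 the number \<eta> = pi/\<kappa> - pi/2 is positive, and with it the
  one-integral formula covers |Im L| up to 2 pi/\<kappa> - pi/2 - \<eta> = pi/\<kappa>, that is, the
  whole range of arguments.\<close>

lemma struve_sum_core_less_2:
  assumes a: "a > 0" "kappa a < 2" and c: "inverse_factorial_coeffs \<nu> a c"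
    and c0: "c0 \<notin> \<int>" "kappa a * c0 + vartheta' \<nu> \<notin> \<int>" and M: "M \<ge> 1" "kappa a * c0 + vartheta' \<nu> + real M \<ge> 3"
  shows "\<exists>C\<ge>0. \<forall>L. 0 \<le> Im L \<and> Im L \<le> pi / kappa a \<and> Re L \<ge> 0 \<longrightarrow>
           summable (\<lambda>j. twist (kappa a) (scaled_coeff \<nu> a) L (of_int (\<lfloor>c0\<rfloor> + 1 + int j))) \<and>
           cmod ((\<Sum>j. twist (kappa a) (scaled_coeff \<nu> a) L (of_int (\<lfloor>c0\<rfloor> + 1 + int j))) - exp_expansion \<nu> a c M L)
             \<le> C * exp (kappa a * c0 * Re L + exp (Re L) * max 0 (cos (Im L)))"
proof -
  have \<kappa>: "kappa a > 0" "kappa a \<ge> 1" using a by (simp_all add: kappa_def)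
  define \<eta> where "\<eta> = pi / kappa a - pi / 2"
  have \<eta>: "\<eta> > 0" using a \<kappa> by (simp add: \<eta>_def field_simps)
  have le_pi: "pi / kappa a \<le> pi" using \<kappa> by (simp add: field_simps)
  let ?S = "\<lambda>L. \<Sum>j. twist (kappa a) (scaled_coeff \<nu> a) L (of_int (\<lfloor>c0\<rfloor> + 1 + int j))"
  let ?I = "\<lambda>L. ray_integral (of_real c0) 1 (twist (kappa a) (scaled_coeff \<nu> a) L)"
  obtain C1 where C1: "C1 \<ge> 0" "\<And>L. \<bar>Im L\<bar> \<le> 2 * pi / kappa a - pi / 2 - \<eta> \<Longrightarrow>
           summable (\<lambda>j. twist (kappa a) (scaled_coeff \<nu> a) L (of_int (\<lfloor>c0\<rfloor> + 1 + int j))) \<and>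
           cmod (?S L - ?I L) \<le> C1 * exp (kappa a * c0 * Re L)"
    using sum_eq_ray_integral[OF \<kappa>(1) gamma_growth_scaled_coeff[OF a(1) c] c0(1) \<eta>] by blast
  obtain C2 where C2: "C2 \<ge> 0" "\<And>L. \<bar>Im L\<bar> \<le> pi \<Longrightarrow> Re L \<ge> 0 \<Longrightarrow>
           cmod (?I L - exp_expansion \<nu> a c M L) \<le> C2 * exp (kappa a * c0 * Re L + exp (Re L) * max 0 (cos (Im L)))"
    using ray_integral_scaled_coeff[OF a(1) c c0(2) M] by blast
  show ?thesis
  proof (intro exI[of _ "C1 + C2"] conjI allI impI; (elim conjE)?)
    show "0 \<le> C1 + C2" using C1 C2 by simp
  next
    fix L assume L: "0 \<le> Im L" "Im L \<le> pi / kappa a" "0 \<le> Re L"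
    have "2 * pi / kappa a = pi / kappa a + pi / kappa a" by simp
    hence 1: "\<bar>Im L\<bar> \<le> 2 * pi / kappa a - pi / 2 - \<eta>" using L unfolding \<eta>_def by linarith
    have 2: "\<bar>Im L\<bar> \<le> pi" using L le_pi by linarith
    show "summable (\<lambda>j. twist (kappa a) (scaled_coeff \<nu> a) L (of_int (\<lfloor>c0\<rfloor> + 1 + int j)))"
      using C1(2)[OF 1] by blast
    let ?m = "exp (kappa a * c0 * Re L + exp (Re L) * max 0 (cos (Im L)))"
    have "?S L - exp_expansion \<nu> a c M L = (?S L - ?I L) + (?I L - exp_expansion \<nu> a c M L)" by simp
    also have "cmod \<dots> \<le> C1 * ?m + C2 * ?m"
    proof (rule order_trans[OF norm_triangle_ineq add_mono])
      have "C1 * exp (kappa a * c0 * Re L) \<le> C1 * ?m" using C1(1) by (intro mult_left_mono) auto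
      thus "cmod (?S L - ?I L) \<le> C1 * ?m" using C1(2)[OF 1] by linarith
      show "cmod (?I L - exp_expansion \<nu> a c M L) \<le> C2 * ?m" by (rule C2(2)[OF 2 L(3)])
    qed
    finally show "cmod (?S L - exp_expansion \<nu> a c M L) \<le> (C1 + C2) * ?m" by (simp only: distrib_right)
  qed
qed

lemma struve_sum_core_ge_2:
  assumes a: "a > 0" "kappa a \<ge> 2" and c: "inverse_factorial_coeffs \<nu> a c"
    and c0: "c0 \<notin> \<int>" "kappa a * c0 + vartheta' \<nu> \<notin> \<int>" and M: "M \<ge> 1" "kappa a * c0 + vartheta' \<nu> + real M \<ge> 3"
  shows "\<exists>C\<ge>0. \<forall>L. 0 \<le> Im L \<and> Im L \<le> pi / kappa a \<and> Re L \<ge> 0 \<longrightarrow>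
           summable (\<lambda>j. twist (kappa a) (scaled_coeff \<nu> a) L (of_int (\<lfloor>c0\<rfloor> + 1 + int j))) \<and>
           cmod ((\<Sum>j. twist (kappa a) (scaled_coeff \<nu> a) L (of_int (\<lfloor>c0\<rfloor> + 1 + int j))) - exp_expansion \<nu> a c M L
                  - exp_expansion \<nu> a c M (L - of_real (2 * pi / kappa a) * \<i>))
             \<le> C * exp (kappa a * c0 * Re L + exp (Re L) * max 0 (cos (Im L)))"
proof -
  have \<kappa>: "kappa a > 0" using a by simp
  have le_pi: "pi / kappa a \<le> pi / 2" using a by (intro divide_left_mono) auto
  let ?S = "\<lambda>L. \<Sum>j. twist (kappa a) (scaled_coeff \<nu> a) L (of_int (\<lfloor>c0\<rfloor> + 1 + int j))"
  let ?I = "\<lambda>L. ray_integral (of_real c0) 1 (twist (kappa a) (scaled_coeff \<nu> a) L)"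
  let ?L' = "\<lambda>L. L - of_real (2 * pi / kappa a) * \<i>"
  obtain C1 where C1: "C1 \<ge> 0" "\<And>L. 0 \<le> Im L \<Longrightarrow> Im L \<le> pi / kappa a \<Longrightarrow>
           summable (\<lambda>j. twist (kappa a) (scaled_coeff \<nu> a) L (of_int (\<lfloor>c0\<rfloor> + 1 + int j))) \<and>
           cmod (?S L - ?I L - ?I (?L' L)) \<le> C1 * exp (kappa a * c0 * Re L + exp (Re L) * cos (Im L))"
    using sum_eq_two_ray_integrals[OF a(2) gamma_growth_scaled_coeff[OF a(1) c] c0(1)]
    by (elim exE conjE) (rule that, assumption, simp only:)
  obtain C2 where C2: "C2 \<ge> 0" "\<And>L. \<bar>Im L\<bar> \<le> pi \<Longrightarrow> Re L \<ge> 0 \<Longrightarrow>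
           cmod (?I L - exp_expansion \<nu> a c M L) \<le> C2 * exp (kappa a * c0 * Re L + exp (Re L) * max 0 (cos (Im L)))"
    using ray_integral_scaled_coeff[OF a(1) c c0(2) M] by blast
  show ?thesis
  proof (intro exI[of _ "C1 + C2 + C2"] conjI allI impI; (elim conjE)?)
    show "0 \<le> C1 + C2 + C2" using C1 C2 by simp
  next
    fix L assume L: "0 \<le> Im L" "Im L \<le> pi / kappa a" "0 \<le> Re L"
    have 2: "\<bar>Im L\<bar> \<le> pi" using L le_pi by linarith
    have ImL': "Im (?L' L) = Im L - 2 * (pi / kappa a)" "Re (?L' L) = Re L" by simp_all
    have 3: "\<bar>Im (?L' L)\<bar> \<le> pi" unfolding ImL' using L le_pi by linarith
    \<comment> \<open>Since Im L \<le> pi/\<kappa>, the shifted direction is at least as far from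
      the positive axis as the original one, so its error is covered by the bound for L.\<close>
    have "cos (Im (?L' L)) = cos (2 * (pi / kappa a) - Im L)" unfolding ImL' by (metis cos_minus minus_diff_eq)
    also have "\<dots> \<le> cos (Im L)"
      using L le_pi by (intro cos_monotone_0_pi_le) linarith+
    finally have cos': "max 0 (cos (Im (?L' L))) \<le> max 0 (cos (Im L))" by simp
    show "summable (\<lambda>j. twist (kappa a) (scaled_coeff \<nu> a) L (of_int (\<lfloor>c0\<rfloor> + 1 + int j)))"
      using C1(2)[OF L(1,2)] by blast
    let ?m = "exp (kappa a * c0 * Re L + exp (Re L) * max 0 (cos (Im L)))"
    have "?S L - exp_expansion \<nu> a c M L - exp_expansion \<nu> a c M (?L' L) =
       (?S L - ?I L - ?I (?L' L)) + (?I L - exp_expansion \<nu> a c M L) + (?I (?L' L) - exp_expansion \<nu> a c M (?L' L))" by simp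
    also have "cmod \<dots> \<le> C1 * ?m + C2 * ?m + C2 * ?m"
    proof (intro order_trans[OF norm_triangle_ineq add_mono])
      have "C1 * exp (kappa a * c0 * Re L + exp (Re L) * cos (Im L)) \<le> C1 * ?m" using C1(1) by (intro mult_left_mono) auto
      thus "cmod (?S L - ?I L - ?I (?L' L)) \<le> C1 * ?m" using C1(2)[OF L(1,2)] by linarith
      show "cmod (?I L - exp_expansion \<nu> a c M L) \<le> C2 * ?m" by (rule C2(2)[OF 2 L(3)])
      have "cmod (?I (?L' L) - exp_expansion \<nu> a c M (?L' L)) \<le> C2 * exp (kappa a * c0 * Re (?L' L) + exp (Re (?L' L)) * max 0 (cos (Im (?L' L))))"
        using L(3) by (intro C2(2) 3) simp
      also have "\<dots> \<le> C2 * ?m"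
        unfolding ImL'(2) using cos' C2(1) by (intro mult_left_mono) (auto simp del: minus_complex.sel times_complex.sel)
      finally show "cmod (?I (?L' L) - exp_expansion \<nu> a c M (?L' L)) \<le> C2 * ?m" .
    qed
    finally show "cmod (?S L - exp_expansion \<nu> a c M L - exp_expansion \<nu> a c M (?L' L)) \<le> (C1 + C2 + C2) * ?m"
      by (simp only: distrib_right)
  qed
qed

section \<open>The logarithm of Z and the truncated exponential expansions\<close>

definition Zlog :: "real \<Rightarrow> real \<Rightarrow> real \<Rightarrow> complex" where
  "Zlog a r \<theta> = of_real (ln (Zmod a r)) + of_real (Zarg a \<theta>) * \<i>"

lemma Zlog_sel [simp]: "Re (Zlog a r \<theta>) = ln (Zmod a r)" "Im (Zlog a r \<theta>) = Zarg a \<theta>"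
  by (simp_all add: Zlog_def)

lemma Zmod_pos: "a > 0 \<Longrightarrow> r > 0 \<Longrightarrow> Zmod a r > 0"
  by (simp add: Zmod_def kappa_def hpar_def)

lemma ln_Zmod:
  assumes "a > 0" "r > 0"
  shows "kappa a * ln (Zmod a r) = ln (hpar a * kappa a powr kappa a) + ln r"
proof -
  have "kappa a > 0" "hpar a > 0" using assms by (auto simp: kappa_def hpar_def)
  thus ?thesis using assms by (simp add: Zmod_def ln_mult ln_powr algebra_simps)
qed

lemma Zvar_eq: "a > 0 \<Longrightarrow> r > 0 \<Longrightarrow> Zvar a r \<theta> = exp (Zlog a r \<theta>)"
  using Zmod_pos[of a r] by (simp add: Zvar_def rcis_def Zlog_def exp_add cis_conv_exp mult.commute exp_of_real)

lemma Zpow_eq: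
  assumes "a > 0" "r > 0"
  shows "Zpow a p r \<theta> = exp (of_real p * Zlog a r \<theta>)"
proof -
  have "exp (of_real p * Zlog a r \<theta>) = exp (of_real (p * ln (Zmod a r))) * exp (\<i> * of_real (p * Zarg a \<theta>))"
    by (simp add: Zlog_def exp_add[symmetric] algebra_simps)
  also have "exp (of_real (p * ln (Zmod a r))) = complex_of_real (Zmod a r powr p)"
    using Zmod_pos[OF assms] by (simp add: powr_def flip: exp_of_real)
  finally show ?thesis by (simp add: Zpow_def rcis_def cis_conv_exp)
qed

lemma E_trunc_eq:
  assumes "a > 0" "r > 0"
  shows "E_trunc \<nu> a c M r \<theta> = exp_expansion \<nu> a c M (Zlog a r \<theta>)"
proof -
  let ?L = "Zlog a r \<theta>"
  have "exp (of_real (vartheta \<nu> - real j) * ?L) = exp (of_real (vartheta \<nu>) * ?L) / exp ?L ^ j" for j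
    unfolding exp_of_nat_mult[symmetric] exp_diff[symmetric] by (simp add: algebra_simps)
  hence "of_real (c j) * exp (of_real (vartheta \<nu> - real j) * ?L) = exp (of_real (vartheta \<nu>) * ?L) * (of_real (c j) / exp ?L ^ j)" for j
    by (metis mult.commute times_divide_eq_left times_divide_eq_right)
  thus ?thesis
    unfolding E_trunc_def exp_expansion_def Zvar_eq[OF assms] Zpow_eq[OF assms]
    by (simp add: sum_distrib_left mult.assoc mult.left_commute)
qed

text \<open>The contribution of a single exponential expansion to
  \<open>compound_error\<close>.\<close>

definition exp_error :: "real \<Rightarrow> real \<Rightarrow> nat \<Rightarrow> real \<Rightarrow> real \<Rightarrow> real" where
  "exp_error \<nu> a M r \<theta> = cmod (Zpow a (vartheta \<nu> - real M) r \<theta> * exp (Zvar a r \<theta>))"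

lemma exp_error_eq:
  assumes "a > 0" "r > 0"
  shows "exp_error \<nu> a M r \<theta> = exp ((vartheta \<nu> - real M) * ln (Zmod a r) + Zmod a r * cos (Zarg a \<theta>))"
proof -
  have "cmod (Zpow a (vartheta \<nu> - real M) r \<theta>) = exp ((vartheta \<nu> - real M) * ln (Zmod a r))"
    unfolding Zpow_eq[OF assms] by simp
  moreover have "cmod (exp (Zvar a r \<theta>)) = exp (Zmod a r * cos (Zarg a \<theta>))"
    by (simp add: Zvar_def)
  ultimately show ?thesis unfolding exp_error_def norm_mult by (simp add: exp_add)
qed

text \<open>For |Z| \<ge> 1 all dropped terms are dominated by the first of them. Hence estimates
  may be carried out with as many terms as convenient and cut back to M0 at the end.\<close>

lemma exp_expansion_diff_le:
  assumes "M0 \<le> M"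
  shows "\<exists>C\<ge>0. \<forall>L. Re L \<ge> 0 \<longrightarrow> cmod (exp_expansion \<nu> a c M L - exp_expansion \<nu> a c M0 L) \<le>
           C * exp ((vartheta \<nu> - real M0) * Re L + exp (Re L) * cos (Im L))"
proof (intro exI[of _ "\<bar>A0 \<nu> a\<bar> * (\<Sum>j=M0..<M. \<bar>c j\<bar>)"] conjI allI impI)
  show "0 \<le> \<bar>A0 \<nu> a\<bar> * (\<Sum>j=M0..<M. \<bar>c j\<bar>)" by (intro mult_nonneg_nonneg sum_nonneg) auto
  fix L assume L: "Re L \<ge> 0"
  let ?e = "\<lambda>j. complex_of_real (c j) * exp (of_real (vartheta \<nu> - real j) * L)"
  have "(\<Sum>j<M. ?e j) - (\<Sum>j<M0. ?e j) = (\<Sum>j=M0..<M. ?e j)"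
    using sum_diff_nat_ivl[of 0 M0 M ?e] assms by (simp add: atLeast0LessThan)
  hence "exp_expansion \<nu> a c M L - exp_expansion \<nu> a c M0 L = of_real (A0 \<nu> a) * exp (exp L) * (\<Sum>j=M0..<M. ?e j)"
    unfolding exp_expansion_def right_diff_distrib[symmetric] by (simp only:)
  hence "cmod (exp_expansion \<nu> a c M L - exp_expansion \<nu> a c M0 L) = \<bar>A0 \<nu> a\<bar> * exp (exp (Re L) * cos (Im L)) * cmod (\<Sum>j=M0..<M. ?e j)"
    by (simp add: norm_mult Re_exp)
  moreover have "cmod (\<Sum>j=M0..<M. ?e j) \<le> (\<Sum>j=M0..<M. \<bar>c j\<bar> * exp ((vartheta \<nu> - real M0) * Re L))"
  proof (rule sum_norm_le)
    fix j assume "j \<in> {M0..<M}"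
    hence "(vartheta \<nu> - real j) * Re L \<le> (vartheta \<nu> - real M0) * Re L" using L by (intro mult_right_mono) auto
    thus "cmod (?e j) \<le> \<bar>c j\<bar> * exp ((vartheta \<nu> - real M0) * Re L)"
      by (simp add: norm_mult mult_left_mono)
  qed
  ultimately have "cmod (exp_expansion \<nu> a c M L - exp_expansion \<nu> a c M0 L) \<le>
      \<bar>A0 \<nu> a\<bar> * exp (exp (Re L) * cos (Im L)) * (\<Sum>j=M0..<M. \<bar>c j\<bar> * exp ((vartheta \<nu> - real M0) * Re L))"
    by (simp only: mult_left_mono abs_ge_zero exp_ge_zero mult_nonneg_nonneg)
  thus "cmod (exp_expansion \<nu> a c M L - exp_expansion \<nu> a c M0 L) \<le>
      \<bar>A0 \<nu> a\<bar> * (\<Sum>j=M0..<M. \<bar>c j\<bar>) * exp ((vartheta \<nu> - real M0) * Re L + exp (Re L) * cos (Im L))"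
    by (simp only: sum_distrib_right[symmetric] exp_add mult_ac)
qed

lemma exp_expansion_le:
  "\<exists>C\<ge>0. \<forall>L. Re L \<ge> 0 \<longrightarrow> cmod (exp_expansion \<nu> a c M L) \<le> C * exp (vartheta \<nu> * Re L + exp (Re L) * cos (Im L))"
  using exp_expansion_diff_le[of 0 M \<nu> a c] by (simp add: exp_expansion_def)

text \<open>The reflection formula at half-integers; it converts the factor 1/Gamma(n + 3/2) at n =
  -k - 1 into the numerator Gamma(k + 1/2) of the algebraic expansion.\<close>

lemma rGamma_half_minus: "rGamma (1/2 - real k) = (- 1) ^ k * Gamma (real k + 1/2) / pi"
proof (induction k)
  case 0
  have "sqrt pi * sqrt pi = pi" by simp
  thus ?case by (simp add: rGamma_inverse_Gamma Gamma_one_half_real field_simps)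
next
  case (Suc k)
  have "rGamma (1/2 - real (Suc k)) = (1/2 - real (Suc k)) * rGamma (1/2 - real (Suc k) + 1)"
    by (rule rGamma_plus1[symmetric])
  also have "1/2 - real (Suc k) + 1 = 1/2 - real k" by simp
  finally have 1: "rGamma (1/2 - real (Suc k)) = (1/2 - real (Suc k)) * ((- 1) ^ k * Gamma (real k + 1/2) / pi)"
    unfolding Suc .
  have "real k + 1/2 \<notin> \<int>\<^sub>\<le>\<^sub>0" by (auto elim!: nonpos_Ints_cases)
  hence "Gamma (real k + 1/2 + 1) = (real k + 1/2) * Gamma (real k + 1/2)" by (rule Gamma_plus1)
  moreover have "real (Suc k) + 1/2 = real k + 1/2 + 1" by simp
  ultimately have 2: "Gamma (real (Suc k) + 1/2) = (real k + 1/2) * Gamma (real k + 1/2)" by (simp only:)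
  show ?case unfolding 1 2 by (simp add: algebra_simps)
qed

text \<open>With \<rho> = ln |Z| the function is |Z|^k e^(-\<delta> |Z|): an exponentially small
  factor absorbs every power of |Z|.\<close>

lemma exp_absorb:
  fixes k \<delta> :: real
  assumes "\<delta> > 0"
  shows "\<exists>C>0. \<forall>\<rho>\<ge>0. exp (k * \<rho> - \<delta> * exp \<rho>) \<le> C"
proof (rule bounded_above_on_atLeast_0)
  show "((\<lambda>\<rho>. exp (k * \<rho> - \<delta> * exp \<rho>)) \<longlongrightarrow> 0) at_top" using assms by real_asymp
qed (intro continuous_intros)

section \<open>The series, its terms of negative index and the algebraic expansion\<close>

definition struve_sum :: "real \<Rightarrow> real \<Rightarrow> complex \<Rightarrow> complex" where
  "struve_sum \<nu> a x = (\<Sum>n. of_real (rGamma (real n + 3/2) * rGamma (a * real n + \<nu> + 3/2)) * x ^ n)"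

lemma twist_scaled_coeff_of_int:
  assumes "a > 0" "r > 0"
  shows "twist (kappa a) (scaled_coeff \<nu> a) (Zlog a r \<theta>) (of_int n) =
           struve_coeff \<nu> a (of_int n) * exp (of_int n * (of_real (ln r) + of_real \<theta> * \<i>))"
proof -
  define w where "w = hpar a * kappa a powr kappa a"
  have k: "kappa a > 0" using assms by (simp add: kappa_def)
  have "of_real (kappa a) * Zlog a r \<theta> = of_real (kappa a * ln (Zmod a r)) + of_real \<theta> * \<i>"
    using k by (simp add: Zlog_def Zarg_def algebra_simps)
  hence "of_real (kappa a) * of_int n * Zlog a r \<theta> = of_int n * of_real (ln w) + of_int n * (of_real (ln r) + of_real \<theta> * \<i>)"
    unfolding ln_Zmod[OF assms] w_def[symmetric] by (simp add: algebra_simps)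
  hence "exp (- (of_int n * of_real (ln w))) * exp (of_real (kappa a) * of_int n * Zlog a r \<theta>) =
         exp (of_int n * (of_real (ln r) + of_real \<theta> * \<i>))"
    by (simp only: exp_add[symmetric]) simp
  thus ?thesis unfolding twist_def scaled_coeff_def w_def[symmetric] by (simp only: mult.assoc)
qed

lemma exp_of_nat_log_rcis:
  assumes "r > 0"
  shows "exp (of_nat n * (of_real (ln r) + of_real \<theta> * \<i>)) = rcis r \<theta> ^ n"
  using assms by (simp add: exp_of_nat_mult rcis_def exp_add cis_conv_exp exp_of_real mult.commute)

lemma twist_scaled_coeff_of_nat:
  assumes "a > 0" "r > 0"
  shows "twist (kappa a) (scaled_coeff \<nu> a) (Zlog a r \<theta>) (of_int (int n)) =
           of_real (rGamma (real n + 3/2) * rGamma (a * real n + \<nu> + 3/2)) * rcis r \<theta> ^ n"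
proof -
  have 1: "complex_of_int (int n) + 3/2 = of_real (real n + 3/2)"
     "of_real a * complex_of_int (int n) + of_real \<nu> + 3/2 = of_real (a * real n + \<nu> + 3/2)" by simp_all
  show ?thesis
    unfolding twist_scaled_coeff_of_int[OF assms] struve_coeff_def 1 rGamma_complex_of_real
    using exp_of_nat_log_rcis[OF assms(2), of n \<theta>] by simp
qed

text \<open>The reflection formula contributes (-1)^k and the rotation \<zeta> = - \<zeta> e^(-pi i)
  contributes (-1)^(k + 1); together they leave the minus sign.\<close>

lemma twist_scaled_coeff_neg:
  assumes "a > 0" "r > 0"
  shows "twist (kappa a) (scaled_coeff \<nu> a) (Zlog a r \<theta>) (of_int (- int (Suc k))) =
           - (of_real (1 / pi) * (of_real (Gamma (real k + 1/2) * rGamma (\<nu> + 3/2 - a * (1 + real k)))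
                               / rcis r (\<theta> - pi) ^ (k + 1)))"
proof -
  have 1: "complex_of_int (- int (Suc k)) + 3/2 = of_real (1/2 - real k)"
     "of_real a * complex_of_int (- int (Suc k)) + of_real \<nu> + 3/2 = of_real (\<nu> + 3/2 - a * (1 + real k))"
    by (simp_all add: algebra_simps)
  have 2: "exp (of_int (- int (Suc k)) * (of_real (ln r) + of_real \<theta> * \<i>)) = inverse (rcis r \<theta> ^ Suc k)"
    unfolding exp_of_nat_log_rcis[OF assms(2), symmetric] exp_minus[symmetric] of_int_minus
      of_int_of_nat_eq mult_minus_left ..
  have "rcis r \<theta> = - rcis r (\<theta> - pi)"
    by (simp add: complex_eq_iff)
  hence 3: "rcis r \<theta> ^ Suc k = (- 1) ^ Suc k * rcis r (\<theta> - pi) ^ (k + 1)"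
    by (simp only: power_minus[of "rcis r (\<theta> - pi)"] Suc_eq_plus1)
  have 4: "inverse ((- 1 :: complex) ^ Suc k) = (- 1) ^ Suc k"
    by (simp flip: power_inverse)
  have "(- 1 :: complex) ^ k * (- 1) ^ Suc k = - 1"
    by (simp flip: power_add power_mult_distrib)
  thus ?thesis
    unfolding twist_scaled_coeff_of_int[OF assms] struve_coeff_def 1 2 3 rGamma_complex_of_real rGamma_half_minus
      inverse_mult_distrib 4 by (simp add: field_simps)
qed

text \<open>Starting the sum at n = -K instead of n = 0 adds K terms whose total is minus the
  truncated algebraic expansion, which therefore reappears with a plus sign.\<close>

lemma struve_sum_eq:
  fixes a \<nu> r \<theta> :: real and K :: nat
  assumes a: "a > 0" and r: "r > 0"
  defines "F \<equiv> \<lambda>j. twist (kappa a) (scaled_coeff \<nu> a) (Zlog a r \<theta>) (of_int (- int K + int j))"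
  assumes sm: "summable F"
  shows "struve_sum \<nu> a (rcis r \<theta>) = suminf F + H_trunc \<nu> a K r (\<theta> - pi)"
    and "summable (\<lambda>n. of_real (rGamma (real n + 3/2) * rGamma (a * real n + \<nu> + 3/2)) * rcis r \<theta> ^ n)"
proof -
  have Fj: "F (j + K) = of_real (rGamma (real j + 3/2) * rGamma (a * real j + \<nu> + 3/2)) * rcis r \<theta> ^ j" for j
    unfolding F_def using twist_scaled_coeff_of_nat[OF a r, of \<nu> \<theta> j] by simp
  show "summable (\<lambda>n. of_real (rGamma (real n + 3/2) * rGamma (a * real n + \<nu> + 3/2)) * rcis r \<theta> ^ n)"
    using sm unfolding summable_iff_shift[of F K, symmetric] Fj .
  have "struve_sum \<nu> a (rcis r \<theta>) = (\<Sum>j. F (j + K))" unfolding struve_sum_def Fj ..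
  moreover have "(\<Sum>i<K. F i) = - H_trunc \<nu> a K r (\<theta> - pi)"
  proof -
    have "(\<Sum>i<K. F i) = (\<Sum>k<K. F (K - Suc k))" by (rule sum.nat_diff_reindex[symmetric])
    also have "\<dots> = (\<Sum>k<K. - (of_real (1 / pi) * (of_real (Gamma (real k + 1/2) * rGamma (\<nu> + 3/2 - a * (1 + real k)))
                               / rcis r (\<theta> - pi) ^ (k + 1))))"
    proof (rule sum.cong)
      fix k assume "k \<in> {..<K}"
      hence "- int K + int (K - Suc k) = - int (Suc k)" by auto
      thus "F (K - Suc k) = - (of_real (1 / pi) * (of_real (Gamma (real k + 1/2) * rGamma (\<nu> + 3/2 - a * (1 + real k)))
                               / rcis r (\<theta> - pi) ^ (k + 1)))"
        unfolding F_def by (simp only: twist_scaled_coeff_neg[OF a r])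
    qed simp
    also have "\<dots> = - H_trunc \<nu> a K r (\<theta> - pi)" unfolding H_trunc_def sum_negf sum_distrib_left ..
    finally show ?thesis .
  qed
  ultimately show "struve_sum \<nu> a (rcis r \<theta>) = suminf F + H_trunc \<nu> a K r (\<theta> - pi)"
    using suminf_split_initial_segment[OF sm, of K] by simp
qed

lemma H_trunc_diff_le:
  assumes "K \<le> K'"
  shows "\<exists>C\<ge>0. \<forall>r \<theta>. r \<ge> 1 \<longrightarrow> cmod (H_trunc \<nu> a K' r \<theta> - H_trunc \<nu> a K r \<theta>) \<le> C * (1 / r ^ (K + 1))"
proof -
  define b where "b = (\<lambda>k. Gamma (real k + 1/2) * rGamma (\<nu> + 3/2 - a * (1 + real k)))"
  show ?thesis
  proof (intro exI[of _ "1 / pi * (\<Sum>k=K..<K'. \<bar>b k\<bar>)"] conjI allI impI)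
    show "0 \<le> 1 / pi * (\<Sum>k=K..<K'. \<bar>b k\<bar>)" by (intro mult_nonneg_nonneg sum_nonneg) auto
    fix r \<theta> :: real assume r: "r \<ge> 1"
    let ?t = "\<lambda>k. of_real (b k) / rcis r \<theta> ^ (k + 1)"
    have "(\<Sum>k<K'. ?t k) - (\<Sum>k<K. ?t k) = (\<Sum>k=K..<K'. ?t k)"
      using sum_diff_nat_ivl[of 0 K K' ?t] assms by (simp add: atLeast0LessThan)
    hence "H_trunc \<nu> a K' r \<theta> - H_trunc \<nu> a K r \<theta> = of_real (1 / pi) * (\<Sum>k=K..<K'. ?t k)"
      unfolding H_trunc_def b_def right_diff_distrib[symmetric] by (simp only:)
    hence "cmod (H_trunc \<nu> a K' r \<theta> - H_trunc \<nu> a K r \<theta>) = 1 / pi * cmod (\<Sum>k=K..<K'. ?t k)"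
      by (simp only: norm_mult norm_of_real) simp
    also have "\<dots> \<le> 1 / pi * (\<Sum>k=K..<K'. \<bar>b k\<bar> * (1 / r ^ (K + 1)))"
    proof (intro mult_left_mono sum_norm_le)
      fix k assume "k \<in> {K..<K'}"
      hence "r ^ (K + 1) \<le> r ^ (k + 1)" using r by (intro power_increasing) auto
      hence "1 / r ^ (k + 1) \<le> 1 / r ^ (K + 1)" using r by (intro divide_left_mono) auto
      moreover have "cmod (?t k) = \<bar>b k\<bar> * (1 / r ^ (k + 1))" using r by (simp add: norm_divide norm_power norm_mult power_mult_distrib)
      ultimately show "cmod (?t k) \<le> \<bar>b k\<bar> * (1 / r ^ (K + 1))" by (simp only: mult_left_mono abs_ge_zero)
    qed simp
    finally show "cmod (H_trunc \<nu> a K' r \<theta> - H_trunc \<nu> a K r \<theta>) \<le> 1 / pi * (\<Sum>k=K..<K'. \<bar>b k\<bar>) * (1 / r ^ (K + 1))"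
      by (simp only: sum_distrib_right mult.assoc)
  qed
qed

lemma exists_base_point:
  assumes a: "a > 0"
  shows "\<exists>c0. - real K - 1 < c0 \<and> c0 < - real K \<and> kappa a * c0 + vartheta' \<nu> \<notin> \<int>"
proof (cases "kappa a * (- real K - 1/2) + vartheta' \<nu> \<in> \<int>")
  case False
  thus ?thesis by (intro exI[of _ "- real K - 1/2"]) auto
next
  case True
  have k: "kappa a > 1" using a by (simp add: kappa_def)
  \<comment> \<open>The added summand moves \<kappa> c0 by exactly 1/2, away from the integer found
    at the midpoint, and \<kappa> > 1 keeps c0 within the interval.\<close>
  define c0 where "c0 = - real K - 1/2 + 1 / (2 * kappa a)"
  have "0 < 1 / (2 * kappa a)" "1 / (2 * kappa a) < 1/2" using k by (simp_all add: field_simps)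
  hence "- real K - 1 < c0" "c0 < - real K" unfolding c0_def by linarith+
  moreover have "kappa a * c0 + vartheta' \<nu> \<notin> \<int>"
  proof
    assume "kappa a * c0 + vartheta' \<nu> \<in> \<int>"
    hence "kappa a * c0 + vartheta' \<nu> - (kappa a * (- real K - 1/2) + vartheta' \<nu>) \<in> \<int>"
      using True by (rule Ints_diff)
    also have "kappa a * c0 + vartheta' \<nu> - (kappa a * (- real K - 1/2) + vartheta' \<nu>) = 1/2"
      using k by (simp add: c0_def field_simps)
    finally obtain n :: int where "1/2 = real_of_int n" by (auto elim: Ints_cases)
    hence "2 * n = 1" by linarith
    thus False by presburger
  qed
  ultimately show ?thesis by blast
qed

text \<open>
  For \<open>\<kappa> < 2\<close> the second exponential expansion never matters: where it is not exponentially
  small it is exponentially smaller than the first one.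
\<close>

lemma cos_second_less:
  assumes \<kappa>: "1 < \<kappa>" "\<kappa> < 2"
  shows "\<exists>\<delta>>0. \<forall>\<theta>. 0 \<le> \<theta> \<and> \<theta> \<le> pi \<longrightarrow>
           cos ((\<theta> - 2 * pi) / \<kappa>) \<le> cos (\<theta> / \<kappa>) - \<delta> \<or> cos ((\<theta> - 2 * pi) / \<kappa>) \<le> - \<delta>"
proof -
  \<comment> \<open>The rotation by - 2 pi/\<kappa>, made positive by adding 2 pi; for 1 < \<kappa>
    < 2 it lies between 0 and pi.\<close>
  define \<mu> where "\<mu> = 2 * pi - 2 * pi / \<kappa>"
  have "pi / \<kappa> > pi / 2" and pi_\<kappa>: "pi / \<kappa> < pi" using \<kappa> by (simp_all add: field_simps)
  moreover have "\<mu> = 2 * pi - 2 * (pi / \<kappa>)" by (simp add: \<mu>_def)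
  ultimately have \<mu>: "0 < \<mu>" "\<mu> < pi" by linarith+
  \<comment> \<open>The two entries belong to the two alternatives. If \<psi> + \<mu> \<le> pi, the
    difference of the cosines is 2 sin(\<psi> + \<mu>/2) sin(\<mu>/2). Otherwise the second
    direction has distance at least pi/\<kappa> > pi/2 from the positive axis.\<close>
  define \<delta> where "\<delta> = min (2 * (sin (\<mu> / 2))\<^sup>2) (- cos (pi / \<kappa>))"
  have "sin (\<mu> / 2) > 0" using \<mu> by (intro sin_gt_zero) auto
  moreover have "cos (pi / \<kappa>) < cos (pi / 2)"
    using \<open>pi / \<kappa> > pi / 2\<close> \<open>pi / \<kappa> < pi\<close> by (intro cos_monotone_0_pi) auto
  ultimately have \<delta>: "\<delta> > 0" by (simp add: \<delta>_def)
  have "cos ((\<theta> - 2 * pi) / \<kappa>) \<le> cos (\<theta> / \<kappa>) - \<delta> \<or> cos ((\<theta> - 2 * pi) / \<kappa>) \<le> - \<delta>"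
    if \<theta>: "0 \<le> \<theta>" "\<theta> \<le> pi" for \<theta>
  proof -
    define \<psi> where "\<psi> = \<theta> / \<kappa>"
    have \<psi>: "0 \<le> \<psi>" "\<psi> \<le> pi / \<kappa>" using \<theta> \<kappa> by (auto simp: \<psi>_def divide_right_mono)
    have "(\<theta> - 2 * pi) / \<kappa> = \<psi> + \<mu> - 2 * pi" by (simp add: \<psi>_def \<mu>_def diff_divide_distrib)
    hence eq: "cos ((\<theta> - 2 * pi) / \<kappa>) = cos (\<psi> + \<mu>)" by (simp only: cos_minus cos_periodic) (simp add: cos_diff)
    show ?thesis
    proof (cases "\<psi> + \<mu> \<le> pi")
      case True
      have "cos \<psi> - cos (\<psi> + \<mu>) = 2 * sin (\<psi> + \<mu> / 2) * sin (\<mu> / 2)"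
        using cos_diff_cos[of \<psi> "\<psi> + \<mu>"] by (simp add: field_simps)
      moreover have "sin (\<psi> + \<mu> / 2) \<ge> sin (\<mu> / 2)"
      proof (cases "\<psi> + \<mu> / 2 \<le> pi / 2")
        case True
        thus ?thesis using \<psi> \<mu> by (intro sin_monotone_2pi_le) auto
      next
        case False
        have "sin (\<mu> / 2) \<le> sin (pi - (\<psi> + \<mu> / 2))"
          using False \<open>\<psi> + \<mu> \<le> pi\<close> \<mu> by (intro sin_monotone_2pi_le) auto
        thus ?thesis by simp
      qed
      hence "2 * sin (\<psi> + \<mu> / 2) * sin (\<mu> / 2) \<ge> 2 * (sin (\<mu> / 2))\<^sup>2"
        using \<open>sin (\<mu> / 2) > 0\<close> by (simp add: power2_eq_square)
      ultimately have "cos (\<psi> + \<mu>) \<le> cos \<psi> - \<delta>" unfolding \<delta>_def by linarith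
      thus ?thesis unfolding eq by (simp add: \<psi>_def)
    next
      case False
      have "cos (\<psi> + \<mu>) = cos (2 * pi - (\<psi> + \<mu>))" by (simp add: cos_diff)
      also have "\<dots> \<le> cos (pi / \<kappa>)"
        using False \<psi> \<open>pi / \<kappa> < pi\<close> \<mu> \<kappa> by (intro cos_monotone_0_pi_le) (auto simp: \<mu>_def)
      also have "\<dots> \<le> - \<delta>" by (simp add: \<delta>_def)
      finally show ?thesis unfolding eq by simp
    qed
  qed
  thus ?thesis using \<delta> by blast
qed

section \<open>The expansion for the upper signs\<close>

lemma exp_neg_Zmod_power:
  assumes "a > 0" "r > 0"
  shows "exp (- (real n * kappa a * ln (Zmod a r))) = exp (- (real n * ln (hpar a * kappa a powr kappa a))) * (1 / r ^ n)"
proof -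
  have "real n * kappa a * ln (Zmod a r) = real n * ln (hpar a * kappa a powr kappa a) + real n * ln r"
    using ln_Zmod[OF assms] by (metis distrib_left mult.assoc)
  hence "exp (- (real n * kappa a * ln (Zmod a r))) = exp (- (real n * ln (hpar a * kappa a powr kappa a))) * exp (- (real n * ln r))"
    by (simp only: minus_add_distrib exp_add)
  also have "exp (- (real n * ln r)) = 1 / r ^ n"
    using assms by (simp add: exp_minus exp_of_nat_mult divide_inverse)
  finally show ?thesis .
qed

text \<open>The estimates are made with longer truncations K' and M and then shortened to K, M0 and
  M1; the terms dropped are covered by the respective errors.\<close>

lemma struve_expansion_upper:
  assumes a: "a > 0" and c: "inverse_factorial_coeffs \<nu> a c"
  shows "\<exists>C X. C \<ge> 0 \<and> X > 0 \<and> (\<forall>r \<theta>. r \<ge> X \<and> 0 \<le> \<theta> \<and> \<theta> \<le> pi \<longrightarrow> Zmod a r \<ge> 1 \<and>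
           summable (\<lambda>n. of_real (rGamma (real n + 3/2) * rGamma (a * real n + \<nu> + 3/2)) * rcis r \<theta> ^ n) \<and>
           cmod (struve_sum \<nu> a (rcis r \<theta>) - H_trunc \<nu> a K r (\<theta> - pi)
                  - E_trunc \<nu> a c M0 r \<theta> - E_trunc \<nu> a c M1 r (\<theta> - 2 * pi))
             \<le> C * (exp_error \<nu> a M0 r \<theta> + exp_error \<nu> a M1 r (\<theta> - 2 * pi) + 1 / r ^ (K + 1)))"
proof -
  define \<kappa> where "\<kappa> = kappa a"
  have \<kappa>: "\<kappa> > 1" using a by (simp add: \<kappa>_def kappa_def)
  define w where "w = hpar a * \<kappa> powr \<kappa>"
  have w: "w > 0" using hpar_kappa_pos[OF a] by (simp add: w_def \<kappa>_def)
  \<comment> \<open>Because c0 < - K' and \<kappa> > 1, the two requirements make |Z|^(\<kappa> c0)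
    at most |Z|^(-\<kappa> (K + 1)) and at most |Z|^(vartheta - M0) when |Z| \<ge> 1.\<close>
  obtain K' :: nat where K': "real K' \<ge> real K + 1" "real K' \<ge> real M0 - vartheta \<nu>"
    using real_arch_simple[of "max (real K + 1) (real M0 - vartheta \<nu>)"] by auto
  obtain c0 where c0: "- real K' - 1 < c0" "c0 < - real K'" "\<kappa> * c0 + vartheta' \<nu> \<notin> \<int>"
    using exists_base_point[OF a, of K' \<nu>] unfolding \<kappa>_def by blast
  have fl: "\<lfloor>c0\<rfloor> + 1 = - int K'"
  proof -
    have "\<lfloor>c0\<rfloor> = - int K' - 1" using c0 by (intro floor_unique) auto
    thus ?thesis by simp
  qed
  have c0Z: "c0 \<notin> \<int>"
  proof
    assume "c0 \<in> \<int>"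
    then obtain n where "c0 = of_int n" by (auto elim: Ints_cases)
    hence "n = - int K' - 1" using fl by simp
    thus False using c0(1) \<open>c0 = of_int n\<close> by simp
  qed
  obtain M'' :: nat where M'': "real M'' \<ge> 3 - (\<kappa> * c0 + vartheta' \<nu>)" using real_arch_simple by blast
  define M where "M = Max {M'', M0, M1, 1}"
  have M: "M \<ge> 1" "M0 \<le> M" "M1 \<le> M" "M'' \<le> M" by (simp_all add: M_def)
  have M3: "\<kappa> * c0 + vartheta' \<nu> + real M \<ge> 3" using M'' M(4) by linarith
  note core_prems = c c0Z c0(3)[unfolded \<kappa>_def] M(1) M3[unfolded \<kappa>_def]
  let ?S = "\<lambda>L. \<Sum>j. twist \<kappa> (scaled_coeff \<nu> a) L (of_int (- int K' + int j))"
  let ?sm = "\<lambda>L. summable (\<lambda>j. twist \<kappa> (scaled_coeff \<nu> a) L (of_int (- int K' + int j)))"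
  let ?L' = "\<lambda>L. L - of_real (2 * pi / \<kappa>) * \<i>"
  define err where "err = (\<lambda>\<rho> \<psi>. exp ((vartheta \<nu> - real M0) * \<rho> + exp \<rho> * cos \<psi>) + exp (- (real (K + 1) * \<kappa> * \<rho>)))"
  \<comment> \<open>A nonnegative cosine lets the exponential summand of \<open>err\<close>
    dominate, a negative one the algebraic summand.\<close>
  have err_main: "exp (\<kappa> * c0 * \<rho> + exp \<rho> * max 0 (cos \<psi>)) \<le> err \<rho> \<psi>" if \<rho>: "\<rho> \<ge> 0" for \<rho> \<psi>
  proof -
    have kc: "\<kappa> * c0 \<le> 1 * (- real K')"
      using mult_right_mono_neg[of 1 \<kappa> c0] c0 \<kappa> by linarith
    have "\<kappa> * c0 \<le> vartheta \<nu> - real M0" using kc K' by linarith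
    hence 1: "\<kappa> * c0 * \<rho> \<le> (vartheta \<nu> - real M0) * \<rho>" using \<rho> by (intro mult_right_mono) auto
    have "c0 \<le> - real (K + 1)" using c0 K' by simp
    hence "\<kappa> * c0 \<le> \<kappa> * - real (K + 1)" using \<kappa> by (intro mult_left_mono) auto
    hence "\<kappa> * c0 * \<rho> \<le> \<kappa> * - real (K + 1) * \<rho>" using \<rho> by (intro mult_right_mono) auto
    hence 2: "\<kappa> * c0 * \<rho> \<le> - (real (K + 1) * \<kappa> * \<rho>)" by (simp only: mult_minus_right mult_minus_left mult_ac)
    show ?thesis
    proof (cases "cos \<psi> \<ge> 0")
      case True
      hence "exp (\<kappa> * c0 * \<rho> + exp \<rho> * max 0 (cos \<psi>)) \<le> exp ((vartheta \<nu> - real M0) * \<rho> + exp \<rho> * cos \<psi>)"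
        using 1 by simp
      thus ?thesis unfolding err_def using exp_gt_zero[of "- (real (K + 1) * \<kappa> * \<rho>)"] by linarith
    next
      case False
      hence "exp (\<kappa> * c0 * \<rho> + exp \<rho> * max 0 (cos \<psi>)) \<le> exp (- (real (K + 1) * \<kappa> * \<rho>))"
        using 2 by simp
      thus ?thesis unfolding err_def using exp_gt_zero[of "(vartheta \<nu> - real M0) * \<rho> + exp \<rho> * cos \<psi>"] by linarith
    qed
  qed
  \<comment> \<open>Brings both ranges of \<kappa> to the same form: for \<kappa> < 2 the second
    expansion is subtracted as well, being itself of the order of the error.\<close>
  have core: "\<exists>C\<ge>0. \<forall>L. 0 \<le> Im L \<and> Im L \<le> pi / \<kappa> \<and> Re L \<ge> 0 \<longrightarrow> ?sm L \<and>
         cmod (?S L - exp_expansion \<nu> a c M L - exp_expansion \<nu> a c M (?L' L)) \<le> C * err (Re L) (Im L)"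
  proof (cases "\<kappa> \<ge> 2")
    case True
    obtain C where C: "C \<ge> 0" "\<And>L. 0 \<le> Im L \<Longrightarrow> Im L \<le> pi / \<kappa> \<Longrightarrow> Re L \<ge> 0 \<Longrightarrow> ?sm L \<and>
         cmod (?S L - exp_expansion \<nu> a c M L - exp_expansion \<nu> a c M (?L' L)) \<le> C * exp (\<kappa> * c0 * Re L + exp (Re L) * max 0 (cos (Im L)))"
      using struve_sum_core_ge_2[OF a True[unfolded \<kappa>_def] core_prems, unfolded fl, folded \<kappa>_def]
      by (elim exE conjE) (rule that, assumption, simp only:)
    show ?thesis
    proof (intro exI[of _ C] conjI allI impI C(1); (elim conjE)?)
      fix L assume L: "0 \<le> Im L" "Im L \<le> pi / \<kappa>" "0 \<le> Re L"
      show "?sm L" using C(2)[OF L] by blast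
      have "C * exp (\<kappa> * c0 * Re L + exp (Re L) * max 0 (cos (Im L))) \<le> C * err (Re L) (Im L)"
        using C(1) err_main L(3) by (intro mult_left_mono)
      thus "cmod (?S L - exp_expansion \<nu> a c M L - exp_expansion \<nu> a c M (?L' L)) \<le> C * err (Re L) (Im L)"
        using C(2)[OF L] by linarith
    qed
  next
    case False
    hence \<kappa>2: "\<kappa> < 2" by simp
    obtain C where C: "C \<ge> 0" "\<And>L. 0 \<le> Im L \<Longrightarrow> Im L \<le> pi / \<kappa> \<Longrightarrow> Re L \<ge> 0 \<Longrightarrow> ?sm L \<and>
         cmod (?S L - exp_expansion \<nu> a c M L) \<le> C * exp (\<kappa> * c0 * Re L + exp (Re L) * max 0 (cos (Im L)))"
      using struve_sum_core_less_2[OF a \<kappa>2[unfolded \<kappa>_def] core_prems, unfolded fl, folded \<kappa>_def]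
      by (elim exE conjE) (rule that, assumption, simp only:)
    obtain C1 where C1: "C1 \<ge> 0" "\<And>L. Re L \<ge> 0 \<Longrightarrow> cmod (exp_expansion \<nu> a c M L) \<le> C1 * exp (vartheta \<nu> * Re L + exp (Re L) * cos (Im L))"
      using exp_expansion_le by blast
    obtain \<delta> where \<delta>: "\<delta> > 0" "\<And>\<theta>. 0 \<le> \<theta> \<Longrightarrow> \<theta> \<le> pi \<Longrightarrow>
           cos ((\<theta> - 2 * pi) / \<kappa>) \<le> cos (\<theta> / \<kappa>) - \<delta> \<or> cos ((\<theta> - 2 * pi) / \<kappa>) \<le> - \<delta>"
      using cos_second_less[OF \<kappa> \<kappa>2] by blast
    \<comment> \<open>B1 serves the case that the second exponential is smaller than the first by
      e^(-\<delta> |Z|), which absorbs |Z|^M0. B2 serves the case that it is at most e^(-\<delta>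
      |Z|), which absorbs the power missing to |Z|^(-\<kappa> (K + 1)).\<close>
    obtain B1 where B1: "B1 > 0" "\<And>\<rho>. \<rho> \<ge> 0 \<Longrightarrow> exp (real M0 * \<rho> - \<delta> * exp \<rho>) \<le> B1"
      using exp_absorb[OF \<delta>(1)] by blast
    obtain B2 where B2: "B2 > 0" "\<And>\<rho>. \<rho> \<ge> 0 \<Longrightarrow> exp ((vartheta \<nu> + real (K + 1) * \<kappa>) * \<rho> - \<delta> * exp \<rho>) \<le> B2"
      using exp_absorb[OF \<delta>(1)] by blast
    show ?thesis
    proof (intro exI[of _ "C + C1 * (B1 + B2)"] conjI allI impI; (elim conjE)?)
      show "0 \<le> C + C1 * (B1 + B2)" using C(1) C1(1) B1(1) B2(1) by simp
    next
      fix L assume L: "0 \<le> Im L" "Im L \<le> pi / \<kappa>" "0 \<le> Re L"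
      show "?sm L" using C(2)[OF L] by blast
      have 1: "cmod (?S L - exp_expansion \<nu> a c M L) \<le> C * err (Re L) (Im L)"
      proof -
        have "C * exp (\<kappa> * c0 * Re L + exp (Re L) * max 0 (cos (Im L))) \<le> C * err (Re L) (Im L)"
          using C(1) err_main L(3) by (intro mult_left_mono)
        thus ?thesis using C(2)[OF L] by linarith
      qed
      define \<theta> where "\<theta> = \<kappa> * Im L"
      have \<theta>: "0 \<le> \<theta>" "\<theta> \<le> pi" "\<theta> / \<kappa> = Im L" using L \<kappa> by (auto simp: \<theta>_def field_simps)
      have Im: "Im (?L' L) = (\<theta> - 2 * pi) / \<kappa>" and Re: "Re (?L' L) = Re L"
        using \<theta>(3) by (simp_all add: diff_divide_distrib)
      let ?\<rho> = "Re L"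
      have "exp (vartheta \<nu> * ?\<rho> + exp ?\<rho> * cos (Im (?L' L))) \<le> (B1 + B2) * err ?\<rho> (Im L)"
        using \<delta>(2)[OF \<theta>(1,2)]
      proof
        assume "cos ((\<theta> - 2 * pi) / \<kappa>) \<le> cos (\<theta> / \<kappa>) - \<delta>"
        hence "exp ?\<rho> * cos (Im (?L' L)) \<le> exp ?\<rho> * (cos (Im L) - \<delta>)"
          unfolding Im \<theta>(3) by (intro mult_left_mono) auto
        hence "vartheta \<nu> * ?\<rho> + exp ?\<rho> * cos (Im (?L' L)) \<le> (real M0 * ?\<rho> - \<delta> * exp ?\<rho>) + ((vartheta \<nu> - real M0) * ?\<rho> + exp ?\<rho> * cos (Im L))"
          by (simp only: algebra_simps)
        hence "exp (vartheta \<nu> * ?\<rho> + exp ?\<rho> * cos (Im (?L' L))) \<le> exp (real M0 * ?\<rho> - \<delta> * exp ?\<rho>) * exp ((vartheta \<nu> - real M0) * ?\<rho> + exp ?\<rho> * cos (Im L))"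
          unfolding exp_add[symmetric] by (simp only: exp_le_cancel_iff)
        also have "\<dots> \<le> (B1 + B2) * err ?\<rho> (Im L)"
          using B1(2)[OF L(3)] B2(1) B1(1) unfolding err_def by (intro mult_mono) auto
        finally show ?thesis .
      next
        assume "cos ((\<theta> - 2 * pi) / \<kappa>) \<le> - \<delta>"
        hence "exp ?\<rho> * cos (Im (?L' L)) \<le> exp ?\<rho> * (- \<delta>)"
          unfolding Im by (intro mult_left_mono) auto
        hence "vartheta \<nu> * ?\<rho> + exp ?\<rho> * cos (Im (?L' L)) \<le> ((vartheta \<nu> + real (K + 1) * \<kappa>) * ?\<rho> - \<delta> * exp ?\<rho>) + - (real (K + 1) * \<kappa> * ?\<rho>)"
          by (simp only: algebra_simps)
        hence "exp (vartheta \<nu> * ?\<rho> + exp ?\<rho> * cos (Im (?L' L))) \<le> exp ((vartheta \<nu> + real (K + 1) * \<kappa>) * ?\<rho> - \<delta> * exp ?\<rho>) * exp (- (real (K + 1) * \<kappa> * ?\<rho>))"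
          unfolding exp_add[symmetric] by (simp only: exp_le_cancel_iff)
        also have "\<dots> \<le> (B1 + B2) * err ?\<rho> (Im L)"
          using B2(2)[OF L(3)] B2(1) B1(1) unfolding err_def by (intro mult_mono) auto
        finally show ?thesis .
      qed
      hence "C1 * exp (vartheta \<nu> * ?\<rho> + exp ?\<rho> * cos (Im (?L' L))) \<le> C1 * ((B1 + B2) * err ?\<rho> (Im L))"
        using C1(1) by (intro mult_left_mono)
      moreover have "cmod (exp_expansion \<nu> a c M (?L' L)) \<le> C1 * exp (vartheta \<nu> * ?\<rho> + exp ?\<rho> * cos (Im (?L' L)))"
        using C1(2)[of "?L' L"] L(3) unfolding Re by blast
      ultimately have 2: "cmod (exp_expansion \<nu> a c M (?L' L)) \<le> C1 * ((B1 + B2) * err ?\<rho> (Im L))" by linarith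
      have "cmod (?S L - exp_expansion \<nu> a c M L - exp_expansion \<nu> a c M (?L' L)) \<le> C * err ?\<rho> (Im L) + C1 * ((B1 + B2) * err ?\<rho> (Im L))"
        by (rule order_trans[OF norm_triangle_ineq4 add_mono[OF 1 2]])
      thus "cmod (?S L - exp_expansion \<nu> a c M L - exp_expansion \<nu> a c M (?L' L)) \<le> (C + C1 * (B1 + B2)) * err ?\<rho> (Im L)"
        by (simp only: distrib_right mult.assoc)
    qed
  qed
  then obtain C where C: "C \<ge> 0" "\<And>L. 0 \<le> Im L \<Longrightarrow> Im L \<le> pi / \<kappa> \<Longrightarrow> Re L \<ge> 0 \<Longrightarrow> ?sm L \<and>
         cmod (?S L - exp_expansion \<nu> a c M L - exp_expansion \<nu> a c M (?L' L)) \<le> C * err (Re L) (Im L)"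
    by (elim exE conjE) (rule that, assumption, simp only:)
  obtain D0 where D0: "D0 \<ge> 0" "\<And>L. Re L \<ge> 0 \<Longrightarrow> cmod (exp_expansion \<nu> a c M L - exp_expansion \<nu> a c M0 L) \<le>
           D0 * exp ((vartheta \<nu> - real M0) * Re L + exp (Re L) * cos (Im L))"
    using exp_expansion_diff_le[OF M(2)] by blast
  obtain D1 where D1: "D1 \<ge> 0" "\<And>L. Re L \<ge> 0 \<Longrightarrow> cmod (exp_expansion \<nu> a c M L - exp_expansion \<nu> a c M1 L) \<le>
           D1 * exp ((vartheta \<nu> - real M1) * Re L + exp (Re L) * cos (Im L))"
    using exp_expansion_diff_le[OF M(3)] by blast
  have "K \<le> K'" using K' by linarith
  then obtain D2 where D2: "D2 \<ge> 0" "\<And>r \<theta>. r \<ge> 1 \<Longrightarrow> cmod (H_trunc \<nu> a K' r \<theta> - H_trunc \<nu> a K r \<theta>) \<le> D2 * (1 / r ^ (K + 1))"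
    using H_trunc_diff_le[of K K'] by blast
  define W where "W = exp (- (real (K + 1) * ln w))"
  define T where "T = C * (1 + W) + D0 + D1 + D2"
  \<comment> \<open>As |Z|^\<kappa> = w r, the bound r \<ge> 1/w ensures |Z| \<ge> 1, that is, Re L
    \<ge> 0; the bound r \<ge> 1 serves the algebraic expansion.\<close>
  define X where "X = max 1 (1 / w)"
  have W: "W > 0" by (simp add: W_def)
  have "Zmod a r \<ge> 1 \<and>
           summable (\<lambda>n. of_real (rGamma (real n + 3/2) * rGamma (a * real n + \<nu> + 3/2)) * rcis r \<theta> ^ n) \<and>
           cmod (struve_sum \<nu> a (rcis r \<theta>) - H_trunc \<nu> a K r (\<theta> - pi)
                  - E_trunc \<nu> a c M0 r \<theta> - E_trunc \<nu> a c M1 r (\<theta> - 2 * pi))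
             \<le> T * (exp_error \<nu> a M0 r \<theta> + exp_error \<nu> a M1 r (\<theta> - 2 * pi) + 1 / r ^ (K + 1))"
    if r: "r \<ge> X" and \<theta>: "0 \<le> \<theta>" "\<theta> \<le> pi" for r \<theta>
  proof -
    have r1: "r \<ge> 1" "r > 0" using r by (auto simp: X_def)
    define \<rho> where "\<rho> = ln (Zmod a r)"
    have "r * w \<ge> 1" using r w by (simp add: X_def field_simps)
    hence "ln (r * w) \<ge> 0" by simp
    moreover have "ln (r * w) = ln w + ln r" using r1 w by (simp add: ln_mult)
    moreover have "\<kappa> * \<rho> = ln w + ln r" unfolding \<rho>_def \<kappa>_def w_def by (rule ln_Zmod[OF a r1(2)])
    ultimately have "\<kappa> * \<rho> \<ge> 0" by simp
    hence \<rho>: "\<rho> \<ge> 0" using \<kappa> by (simp add: zero_le_mult_iff)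
    have expo: "exp \<rho> = Zmod a r" using Zmod_pos[OF a r1(2)] by (simp add: \<rho>_def)
    have Z1: "Zmod a r \<ge> 1" using \<rho> expo by (metis one_le_exp_iff)
    define L where "L = Zlog a r \<theta>"
    have Lsel: "Re L = \<rho>" "Im L = \<theta> / \<kappa>" by (simp_all add: L_def \<rho>_def \<kappa>_def Zarg_def)
    have L'eq: "?L' L = Zlog a r (\<theta> - 2 * pi)"
      by (simp add: L_def Zlog_def Zarg_def \<kappa>_def diff_divide_distrib algebra_simps)
    have Lc: "0 \<le> Im L" "Im L \<le> pi / \<kappa>" "0 \<le> Re L"
      using \<theta> \<kappa> \<rho> by (auto simp: Lsel divide_right_mono)
    define e0 e1 h where "e0 = exp_error \<nu> a M0 r \<theta>" and "e1 = exp_error \<nu> a M1 r (\<theta> - 2 * pi)" and "h = 1 / r ^ (K + 1)"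
    have e0: "e0 = exp ((vartheta \<nu> - real M0) * Re L + exp (Re L) * cos (Im L))"
      unfolding e0_def exp_error_eq[OF a r1(2)] Lsel expo by (simp add: \<rho>_def Zarg_def \<kappa>_def)
    have e1: "e1 = exp ((vartheta \<nu> - real M1) * Re (?L' L) + exp (Re (?L' L)) * cos (Im (?L' L)))"
      unfolding e1_def exp_error_eq[OF a r1(2)] L'eq using Zmod_pos[OF a r1(2)] by simp
    have h: "exp (- (real (K + 1) * \<kappa> * \<rho>)) = W * h"
      unfolding \<rho>_def \<kappa>_def W_def h_def w_def by (rule exp_neg_Zmod_power[OF a r1(2)])
    have pos: "e0 \<ge> 0" "e1 \<ge> 0" "h \<ge> 0" using r1 by (simp_all add: e0 e1 h_def)
    have err: "err (Re L) (Im L) \<le> (1 + W) * (e0 + e1 + h)"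
      unfolding err_def Lsel(1) h using e0 pos W by (simp add: Lsel(1) algebra_simps)
    have sm: "?sm L" using C(2)[OF Lc] by blast
    have Seq: "struve_sum \<nu> a (rcis r \<theta>) = ?S L + H_trunc \<nu> a K' r (\<theta> - pi)"
      unfolding L_def \<kappa>_def by (rule struve_sum_eq(1)[OF a r1(2)]) (use sm in \<open>simp only: L_def \<kappa>_def\<close>)
    have summ: "summable (\<lambda>n. of_real (rGamma (real n + 3/2) * rGamma (a * real n + \<nu> + 3/2)) * rcis r \<theta> ^ n)"
      by (rule struve_sum_eq(2)[OF a r1(2)]) (use sm in \<open>simp only: L_def \<kappa>_def\<close>)
    have "struve_sum \<nu> a (rcis r \<theta>) - H_trunc \<nu> a K r (\<theta> - pi) - E_trunc \<nu> a c M0 r \<theta> - E_trunc \<nu> a c M1 r (\<theta> - 2 * pi)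
       = (?S L - exp_expansion \<nu> a c M L - exp_expansion \<nu> a c M (?L' L))
         + (exp_expansion \<nu> a c M L - exp_expansion \<nu> a c M0 L) + (exp_expansion \<nu> a c M (?L' L) - exp_expansion \<nu> a c M1 (?L' L))
         + (H_trunc \<nu> a K' r (\<theta> - pi) - H_trunc \<nu> a K r (\<theta> - pi))"
      unfolding Seq E_trunc_eq[OF a r1(2)] L'eq[symmetric] L_def[symmetric] by simp
    also have "cmod \<dots> \<le> C * ((1 + W) * (e0 + e1 + h)) + D0 * (e0 + e1 + h) + D1 * (e0 + e1 + h) + D2 * (e0 + e1 + h)"
    proof (intro order_trans[OF norm_triangle_ineq add_mono])
      have "C * err (Re L) (Im L) \<le> C * ((1 + W) * (e0 + e1 + h))" using err C(1) by (intro mult_left_mono)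
      thus "cmod (?S L - exp_expansion \<nu> a c M L - exp_expansion \<nu> a c M (?L' L)) \<le> C * ((1 + W) * (e0 + e1 + h))"
        using C(2)[OF Lc] by linarith
      have "D0 * e0 \<le> D0 * (e0 + e1 + h)" using D0(1) pos by (intro mult_left_mono) auto
      thus "cmod (exp_expansion \<nu> a c M L - exp_expansion \<nu> a c M0 L) \<le> D0 * (e0 + e1 + h)"
        using D0(2)[OF Lc(3)] unfolding e0 by linarith
      have "D1 * e1 \<le> D1 * (e0 + e1 + h)" using D1(1) pos by (intro mult_left_mono) auto
      moreover have "Re (?L' L) \<ge> 0" using Lc(3) by simp
      ultimately show "cmod (exp_expansion \<nu> a c M (?L' L) - exp_expansion \<nu> a c M1 (?L' L)) \<le> D1 * (e0 + e1 + h)"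
        using D1(2)[of "?L' L"] unfolding e1 by linarith
      have "D2 * h \<le> D2 * (e0 + e1 + h)" using D2(1) pos by (intro mult_left_mono) auto
      thus "cmod (H_trunc \<nu> a K' r (\<theta> - pi) - H_trunc \<nu> a K r (\<theta> - pi)) \<le> D2 * (e0 + e1 + h)"
        using D2(2)[OF r1(1), of "\<theta> - pi"] unfolding h_def by linarith
    qed
    also have "\<dots> = T * (e0 + e1 + h)" by (simp only: T_def distrib_right mult.assoc)
    finally show ?thesis using Z1 summ unfolding e0_def e1_def h_def by blast
  qed
  moreover have "T \<ge> 0" "X > 0" using C(1) D0(1) D1(1) D2(1) W by (auto simp: T_def X_def)
  ultimately show ?thesis by blast
qed

section \<open>Conjugation symmetry and the lower signs\<close>

lemma E_trunc_cnj: "E_trunc \<nu> a c M r (- \<theta>) = cnj (E_trunc \<nu> a c M r \<theta>)"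
proof -
  have "Zpow a p r (- \<theta>) = cnj (Zpow a p r \<theta>)" for p
    by (simp add: Zpow_def Zarg_def rcis_def flip: cis_cnj)
  moreover have "Zvar a r (- \<theta>) = cnj (Zvar a r \<theta>)"
    by (simp add: Zvar_def Zarg_def rcis_def flip: cis_cnj)
  ultimately show ?thesis by (simp add: E_trunc_def exp_cnj)
qed

lemma H_trunc_cnj: "H_trunc \<nu> a K r (- \<theta>) = cnj (H_trunc \<nu> a K r \<theta>)"
proof -
  have "rcis r (- \<theta>) = cnj (rcis r \<theta>)" by (simp add: rcis_def flip: cis_cnj)
  thus ?thesis by (simp add: H_trunc_def)
qed

lemma exp_error_minus: "exp_error \<nu> a M r (- \<theta>) = exp_error \<nu> a M r \<theta>"
  by (simp add: exp_error_def norm_mult Zpow_def Zvar_def Zarg_def)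

lemma struve_sum_cnj:
  assumes "summable (\<lambda>n. of_real (rGamma (real n + 3/2) * rGamma (a * real n + \<nu> + 3/2)) * x ^ n)"
  shows "struve_sum \<nu> a (cnj x) = cnj (struve_sum \<nu> a x)"
  using sums_unique[OF sums_cnj[THEN iffD2, OF summable_sums[OF assms]]]
  by (simp add: struve_sum_def)

text \<open>All coefficients are real, so changing the sign of \<theta> conjugates the series and
  both expansions, and the shift by - 2 pi becomes one by + 2 pi. The absolute errors are
  unchanged.\<close>

lemma struve_expansion:
  fixes \<sigma> :: int
  assumes a: "a > 0" and c: "inverse_factorial_coeffs \<nu> a c" and \<sigma>: "\<sigma> = 1 \<or> \<sigma> = - 1"
  shows "\<exists>C X. C \<ge> 0 \<and> X > 0 \<and> (\<forall>r \<theta>. r \<ge> X \<and> 0 \<le> of_int \<sigma> * \<theta> \<and> of_int \<sigma> * \<theta> \<le> pi \<longrightarrow> Zmod a r \<ge> 1 \<and>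
           cmod (struve_sum \<nu> a (rcis r \<theta>) - H_trunc \<nu> a K r (\<theta> - of_int \<sigma> * pi)
                  - E_trunc \<nu> a c M0 r \<theta> - E_trunc \<nu> a c M1 r (\<theta> + 2 * pi * of_int (- \<sigma>)))
             \<le> C * (exp_error \<nu> a M0 r \<theta> + exp_error \<nu> a M1 r (\<theta> + 2 * pi * of_int (- \<sigma>)) + 1 / r ^ (K + 1)))"
proof -
  obtain C X where CX: "C \<ge> 0" "X > 0" and
    bound: "\<And>r \<theta>. r \<ge> X \<Longrightarrow> 0 \<le> \<theta> \<Longrightarrow> \<theta> \<le> pi \<Longrightarrow> Zmod a r \<ge> 1 \<and>
           summable (\<lambda>n. of_real (rGamma (real n + 3/2) * rGamma (a * real n + \<nu> + 3/2)) * rcis r \<theta> ^ n) \<and>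
           cmod (struve_sum \<nu> a (rcis r \<theta>) - H_trunc \<nu> a K r (\<theta> - pi)
                  - E_trunc \<nu> a c M0 r \<theta> - E_trunc \<nu> a c M1 r (\<theta> - 2 * pi))
             \<le> C * (exp_error \<nu> a M0 r \<theta> + exp_error \<nu> a M1 r (\<theta> - 2 * pi) + 1 / r ^ (K + 1))"
    using struve_expansion_upper[OF a c, where K = K and ?M0.0 = M0 and ?M1.0 = M1]
    by (elim exE conjE) (rule that, assumption+, simp only:)
  show ?thesis
  proof (rule exI[of _ C], rule exI[of _ X], intro conjI allI impI CX; (elim conjE)?)
    fix r \<theta> :: real assume r: "X \<le> r" and \<theta>: "0 \<le> of_int \<sigma> * \<theta>" "of_int \<sigma> * \<theta> \<le> pi"
    show "1 \<le> Zmod a r" using bound[OF r \<theta>] by blast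
    show "cmod (struve_sum \<nu> a (rcis r \<theta>) - H_trunc \<nu> a K r (\<theta> - of_int \<sigma> * pi)
                  - E_trunc \<nu> a c M0 r \<theta> - E_trunc \<nu> a c M1 r (\<theta> + 2 * pi * of_int (- \<sigma>)))
             \<le> C * (exp_error \<nu> a M0 r \<theta> + exp_error \<nu> a M1 r (\<theta> + 2 * pi * of_int (- \<sigma>)) + 1 / r ^ (K + 1))"
      using \<sigma>
    proof
      assume "\<sigma> = 1"
      thus ?thesis using bound[OF r, of \<theta>] \<theta> by simp
    next
      assume s: "\<sigma> = - 1"
      define \<theta>' where "\<theta>' = - \<theta>"
      have \<theta>': "0 \<le> \<theta>'" "\<theta>' \<le> pi" using \<theta> by (auto simp: s \<theta>'_def)
      note b = bound[OF r \<theta>']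
      have "rcis r \<theta> = cnj (rcis r \<theta>')" by (simp add: \<theta>'_def rcis_def flip: cis_cnj)
      hence 1: "struve_sum \<nu> a (rcis r \<theta>) = cnj (struve_sum \<nu> a (rcis r \<theta>'))"
        using b by (simp only: struve_sum_cnj)
      have 2: "H_trunc \<nu> a K r (\<theta> - of_int \<sigma> * pi) = cnj (H_trunc \<nu> a K r (\<theta>' - pi))"
        unfolding H_trunc_cnj[symmetric] by (simp add: s \<theta>'_def add.commute)
      have 3: "E_trunc \<nu> a c M0 r \<theta> = cnj (E_trunc \<nu> a c M0 r \<theta>')"
        "E_trunc \<nu> a c M1 r (\<theta> + 2 * pi * of_int (- \<sigma>)) = cnj (E_trunc \<nu> a c M1 r (\<theta>' - 2 * pi))"
        unfolding E_trunc_cnj[symmetric] by (simp_all add: s \<theta>'_def add.commute)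
      have 4: "exp_error \<nu> a M0 r \<theta> = exp_error \<nu> a M0 r \<theta>'"
        "exp_error \<nu> a M1 r (\<theta> + 2 * pi * of_int (- \<sigma>)) = exp_error \<nu> a M1 r (\<theta>' - 2 * pi)"
        using exp_error_minus[of \<nu> a M0 r \<theta>'] exp_error_minus[of \<nu> a M1 r "\<theta>' - 2 * pi"] by (simp_all add: s \<theta>'_def add.commute)
      show ?thesis unfolding 1 2 3 4 complex_cnj_diff[symmetric] complex_mod_cnj using b by blast
    qed
  qed
qed

text \<open>
  The remaining expansions for \<open>\<kappa> > 2\<close> are exponentially smaller than the one with \<open>n = 0\<close>;
  the minimality of \<open>N\<close> keeps their arguments below \<open>3\<pi>/2\<close>.
\<close>

lemma cos_other_le:
  fixes N n \<sigma> :: int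
  assumes \<kappa>: "\<kappa> > 2" and N: "2 * real_of_int N - 1 \<le> \<kappa> / 2"
    and n: "- N \<le> n" "n \<le> N" "n \<noteq> 0" "n \<noteq> - \<sigma>" and \<sigma>: "\<sigma> = 1 \<or> \<sigma> = - 1"
    and \<theta>: "0 \<le> of_int \<sigma> * \<theta>" "of_int \<sigma> * \<theta> \<le> pi"
  shows "cos ((\<theta> + 2 * pi * of_int n) / \<kappa>) \<le> cos (\<theta> / \<kappa>) - (cos (pi / \<kappa>) - max 0 (cos (2 * pi / \<kappa>)))"
proof -
  define b where "b = \<bar>\<theta> + 2 * pi * of_int n\<bar>"
  have abs\<theta>: "\<bar>\<theta>\<bar> \<le> pi" using \<theta> \<sigma> by auto
  \<comment> \<open>With n = 0 and n = - \<sigma> excluded, \<sigma> n is at least 1 or at most -2.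
    In the first case the shift moves \<theta> further away from zero, in the second it overshoots
    by at least 3 pi.\<close>
  have "b \<ge> 2 * pi"
  proof (cases "of_int \<sigma> * n > 0")
    case True
    hence "\<sigma> * n \<ge> 1" by simp
    hence "real_of_int (\<sigma> * n) \<ge> 1" by linarith
    hence "2 * pi * real_of_int (\<sigma> * n) \<ge> 2 * pi * 1" by (intro mult_left_mono) auto
    hence "of_int \<sigma> * \<theta> + 2 * pi * real_of_int (\<sigma> * n) \<ge> 2 * pi" using \<theta> by linarith
    moreover have "b = \<bar>of_int \<sigma> * \<theta> + 2 * pi * real_of_int (\<sigma> * n)\<bar>" using \<sigma> by (auto simp: b_def)
    ultimately show ?thesis by linarith
  next
    case False
    hence "\<sigma> * n \<le> - 2" using n \<sigma> by auto
    hence "real_of_int (\<sigma> * n) \<le> - 2" by linarith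
    hence "2 * pi * real_of_int (\<sigma> * n) \<le> 2 * pi * - 2" by (intro mult_left_mono) auto
    hence "of_int \<sigma> * \<theta> + 2 * pi * real_of_int (\<sigma> * n) \<le> - (2 * pi)" using \<theta> by linarith
    moreover have "b = \<bar>of_int \<sigma> * \<theta> + 2 * pi * real_of_int (\<sigma> * n)\<bar>" using \<sigma> by (auto simp: b_def)
    ultimately show ?thesis by linarith
  qed
  \<comment> \<open>Divided by \<kappa> > 2 this is below 3 pi/2, so that beyond pi the cosine is
    still not positive.\<close>
  moreover have "b \<le> pi * \<kappa> / 2 + 2 * pi"
  proof -
    have "b \<le> \<bar>\<theta>\<bar> + \<bar>2 * pi * of_int n\<bar>" unfolding b_def by (rule abs_triangle_ineq)
    also have "\<bar>2 * pi * of_int n\<bar> = 2 * pi * \<bar>real_of_int n\<bar>" by (simp add: abs_mult)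
    also have "\<dots> \<le> 2 * pi * real_of_int N" using n by (intro mult_left_mono) auto
    also have "\<dots> = pi * (2 * real_of_int N - 1) + pi" by (simp add: algebra_simps)
    also have "\<dots> \<le> pi * (\<kappa> / 2) + pi" using N by simp
    finally show ?thesis using abs\<theta> by simp
  qed
  ultimately have b: "2 * pi / \<kappa> \<le> b / \<kappa>" "b / \<kappa> \<le> (pi * \<kappa> / 2 + 2 * pi) / \<kappa>"
    using \<kappa> by (simp_all only: divide_right_mono less_imp_le order_less_trans[OF zero_less_numeral])
  have k1: "pi / \<kappa> < pi / 2" using \<kappa> by (simp add: field_simps)
  have k2: "2 * pi / \<kappa> = 2 * (pi / \<kappa>)" by simp
  have "(pi * \<kappa> / 2 + 2 * pi) / \<kappa> = pi / 2 + 2 * (pi / \<kappa>)" using \<kappa> by (simp add: field_simps)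
  hence b2: "b / \<kappa> \<le> 3 * pi / 2" using b k1 by linarith
  have "cos ((\<theta> + 2 * pi * of_int n) / \<kappa>) = cos (b / \<kappa>)"
  proof -
    have "\<bar>(\<theta> + 2 * pi * of_int n) / \<kappa>\<bar> = b / \<kappa>" using \<kappa> by (simp add: b_def)
    thus ?thesis by (metis cos_abs_real)
  qed
  also have "\<dots> \<le> max 0 (cos (2 * pi / \<kappa>))"
  proof (cases "b / \<kappa> \<le> pi")
    case True
    have "cos (b / \<kappa>) \<le> cos (2 * pi / \<kappa>)" using b True \<kappa> by (intro cos_monotone_0_pi_le) auto
    thus ?thesis by simp
  next
    case False
    have "0 \<le> cos (b / \<kappa> - pi)" using False b2 pi_gt_zero by (intro cos_ge_zero) linarith+
    also have "cos (b / \<kappa> - pi) = - cos (b / \<kappa>)" by (simp add: cos_diff)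
    finally show ?thesis by simp
  qed
  finally have "cos ((\<theta> + 2 * pi * of_int n) / \<kappa>) \<le> max 0 (cos (2 * pi / \<kappa>))" .
  moreover have "cos (pi / \<kappa>) \<le> cos (\<theta> / \<kappa>)"
  proof -
    have "\<bar>\<theta> / \<kappa>\<bar> \<le> pi / \<kappa>" using abs\<theta> \<kappa> by (simp add: divide_right_mono)
    hence "cos (pi / \<kappa>) \<le> cos \<bar>\<theta> / \<kappa>\<bar>" using k1 pi_gt_zero by (intro cos_monotone_0_pi_le) linarith+
    thus ?thesis by (simp only: cos_abs_real)
  qed
  ultimately show ?thesis by linarith
qed

text \<open>The difference \<delta> of the cosines is positive because pi/\<kappa> < pi/2 and the
  cosine decreases up to 2 pi/\<kappa> < pi. The gain e^(-\<delta> |Z|) pays for the factor |Z|^M0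
  that separates the leading term from the error of the expansion with n = 0.\<close>

lemma E_trunc_other_le:
  fixes N n \<sigma> :: int
  assumes a: "a > 0" and \<kappa>: "kappa a > 2" and N: "2 * real_of_int N - 1 \<le> kappa a / 2"
    and n: "- N \<le> n" "n \<le> N" "n \<noteq> 0" "n \<noteq> - \<sigma>" and \<sigma>: "\<sigma> = 1 \<or> \<sigma> = - 1"
  shows "\<exists>C\<ge>0. \<forall>r \<theta>. r > 0 \<and> Zmod a r \<ge> 1 \<and> 0 \<le> of_int \<sigma> * \<theta> \<and> of_int \<sigma> * \<theta> \<le> pi \<longrightarrow>
           cmod (E_trunc \<nu> a c M r (\<theta> + 2 * pi * of_int n)) \<le> C * exp_error \<nu> a M0 r \<theta>"
proof -
  define \<delta> where "\<delta> = cos (pi / kappa a) - max 0 (cos (2 * pi / kappa a))"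
  have k1: "pi / kappa a < pi / 2" "0 < pi / kappa a" using \<kappa> by (simp_all add: field_simps)
  have "cos (pi / kappa a) > 0" using k1 pi_gt_zero by (intro cos_gt_zero) auto
  moreover have "cos (2 * (pi / kappa a)) < cos (pi / kappa a)"
    by (rule cos_monotone_0_pi) (use k1 in linarith)+
  ultimately have \<delta>: "\<delta> > 0" by (simp add: \<delta>_def)
  obtain B where B: "B > 0" "\<And>\<rho>. \<rho> \<ge> 0 \<Longrightarrow> exp (real M0 * \<rho> - \<delta> * exp \<rho>) \<le> B"
    using exp_absorb[OF \<delta>] by blast
  obtain C where C: "C \<ge> 0" "\<And>L. Re L \<ge> 0 \<Longrightarrow> cmod (exp_expansion \<nu> a c M L) \<le> C * exp (vartheta \<nu> * Re L + exp (Re L) * cos (Im L))"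
    using exp_expansion_le by blast
  show ?thesis
  proof (intro exI[of _ "C * B"] conjI allI impI; (elim conjE)?)
    show "0 \<le> C * B" using B C by simp
  next
    fix r \<theta> :: real assume r: "0 < r" "1 \<le> Zmod a r" and \<theta>: "0 \<le> of_int \<sigma> * \<theta>" "of_int \<sigma> * \<theta> \<le> pi"
    define \<rho> where "\<rho> = ln (Zmod a r)"
    have \<rho>: "\<rho> \<ge> 0" "exp \<rho> = Zmod a r" using r by (auto simp: \<rho>_def)
    let ?x = "cos (Zarg a (\<theta> + 2 * pi * of_int n))"
    have "?x \<le> cos (Zarg a \<theta>) - \<delta>"
      unfolding Zarg_def \<delta>_def by (rule cos_other_le[OF \<kappa> N n \<sigma> \<theta>])
    hence "exp \<rho> * ?x \<le> exp \<rho> * (cos (Zarg a \<theta>) - \<delta>)" by (intro mult_left_mono) auto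
    hence "vartheta \<nu> * \<rho> + exp \<rho> * ?x \<le> (real M0 * \<rho> - \<delta> * exp \<rho>) + ((vartheta \<nu> - real M0) * \<rho> + exp \<rho> * cos (Zarg a \<theta>))"
      by (simp only: algebra_simps)
    hence "exp (vartheta \<nu> * \<rho> + exp \<rho> * ?x) \<le> exp (real M0 * \<rho> - \<delta> * exp \<rho>) * exp ((vartheta \<nu> - real M0) * \<rho> + exp \<rho> * cos (Zarg a \<theta>))"
      unfolding exp_add[symmetric] by (simp only: exp_le_cancel_iff)
    also have "\<dots> \<le> B * exp ((vartheta \<nu> - real M0) * \<rho> + exp \<rho> * cos (Zarg a \<theta>))"
      by (intro mult_right_mono B(2) \<rho>(1)) simp
    also have "exp ((vartheta \<nu> - real M0) * \<rho> + exp \<rho> * cos (Zarg a \<theta>)) = exp_error \<nu> a M0 r \<theta>"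
      unfolding exp_error_eq[OF a r(1)] \<rho>(2) by (simp add: \<rho>_def)
    finally have "C * exp (vartheta \<nu> * \<rho> + exp \<rho> * ?x) \<le> C * (B * exp_error \<nu> a M0 r \<theta>)"
      using C(1) by (intro mult_left_mono)
    moreover have "cmod (E_trunc \<nu> a c M r (\<theta> + 2 * pi * of_int n)) \<le> C * exp (vartheta \<nu> * \<rho> + exp \<rho> * ?x)"
      using C(2)[of "Zlog a r (\<theta> + 2 * pi * of_int n)"] \<rho>(1) unfolding E_trunc_eq[OF a r(1)] by (simp add: \<rho>_def)
    ultimately show "cmod (E_trunc \<nu> a c M r (\<theta> + 2 * pi * of_int n)) \<le> C * B * exp_error \<nu> a M0 r \<theta>"
      by (simp only: mult.assoc)
  qed
qed

section \<open>The compound expansion of the generalised Struve function\<close>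

lemma struve_L_eq:
  assumes "z \<noteq> 0"
  shows "(z / 2) powr of_real (- \<nu> - 1) * struve_L \<nu> a z = struve_sum \<nu> a (rcis (cmod (z\<^sup>2 / 4)) (2 * Arg z))"
proof -
  have 1: "(z / 2) powr of_real (- \<nu> - 1) * (z / 2) powr of_real (\<nu> + 1) = 1"
    using assms by (simp flip: powr_add)
  have 2: "(z / 2) ^ (2 * n) = rcis (cmod (z\<^sup>2 / 4)) (2 * Arg z) ^ n" for n
  proof -
    have "z\<^sup>2 / 4 = rcis (cmod z) (Arg z) ^ 2 / 4" by (simp add: rcis_cmod_Arg)
    also have "\<dots> = rcis (cmod (z\<^sup>2 / 4)) (2 * Arg z)"
      by (simp add: cis_mult power2_eq_square rcis_def norm_mult norm_divide)
    finally have "(z / 2)\<^sup>2 = rcis (cmod (z\<^sup>2 / 4)) (2 * Arg z)" by (simp add: power_divide)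
    thus ?thesis by (simp add: power_mult)
  qed
  have "(\<Sum>n. (z / 2) ^ (2 * n) * of_real (rGamma (real n + 3/2) * rGamma (a * real n + \<nu> + 3/2))) =
        struve_sum \<nu> a (rcis (cmod (z\<^sup>2 / 4)) (2 * Arg z))"
    unfolding struve_sum_def 2 by (simp only: mult.commute)
  thus ?thesis
    unfolding struve_L_def by (simp only: mult.assoc[symmetric] 1 mult_1_left)
qed

text \<open>The expansions with n = 0 and n = - \<sigma> come from the analysis of the series; the
  remaining ones may be added since each of them is bounded by the error of the one with n = 0. This
  treats both ranges of \<kappa> at once.\<close>

lemma compound_expansionI:
  fixes \<sigma> :: int
  assumes a: "a > 0" and c: "inverse_factorial_coeffs \<nu> a c" and \<sigma>: "\<sigma> = 1 \<or> \<sigma> = - 1"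
    and I: "finite I" "0 \<in> I" "- \<sigma> \<in> I"
    and other: "\<And>n M M0. n \<in> I - {0, - \<sigma>} \<Longrightarrow> \<exists>C\<ge>0. \<forall>r \<theta>. r > 0 \<and> Zmod a r \<ge> 1 \<and> 0 \<le> of_int \<sigma> * \<theta> \<and> of_int \<sigma> * \<theta> \<le> pi \<longrightarrow>
           cmod (E_trunc \<nu> a c M r (\<theta> + 2 * pi * of_int n)) \<le> C * exp_error \<nu> a M0 r \<theta>"
  shows "compound_expansion \<nu> a c \<sigma> I (\<lambda>z. (z / 2) powr of_real (- \<nu> - 1) * struve_L \<nu> a z)"
  unfolding compound_expansion_def
proof (intro allI)
  fix M :: "int \<Rightarrow> nat" and K :: nat
  define J where "J = I - {0, - \<sigma>}"
  have I_eq: "I = insert 0 (insert (- \<sigma>) J)" and J: "0 \<notin> J" "- \<sigma> \<notin> J" "finite J" "0 \<noteq> - \<sigma>"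
    using I \<sigma> by (auto simp: J_def)
  obtain C X where C: "C \<ge> 0" "X > 0" "\<And>r \<theta>. r \<ge> X \<Longrightarrow> 0 \<le> of_int \<sigma> * \<theta> \<Longrightarrow> of_int \<sigma> * \<theta> \<le> pi \<Longrightarrow> Zmod a r \<ge> 1 \<and>
           cmod (struve_sum \<nu> a (rcis r \<theta>) - H_trunc \<nu> a K r (\<theta> - of_int \<sigma> * pi)
                  - E_trunc \<nu> a c (M 0) r \<theta> - E_trunc \<nu> a c (M (- \<sigma>)) r (\<theta> + 2 * pi * of_int (- \<sigma>)))
             \<le> C * (exp_error \<nu> a (M 0) r \<theta> + exp_error \<nu> a (M (- \<sigma>)) r (\<theta> + 2 * pi * of_int (- \<sigma>)) + 1 / r ^ (K + 1))"
    using struve_expansion[OF a c \<sigma>, where K = K and ?M0.0 = "M 0" and ?M1.0 = "M (- \<sigma>)"]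
    by (elim exE conjE) (rule that, assumption+, simp only:)
  have "\<forall>n\<in>J. \<exists>D\<ge>0. \<forall>r \<theta>. r > 0 \<and> Zmod a r \<ge> 1 \<and> 0 \<le> of_int \<sigma> * \<theta> \<and> of_int \<sigma> * \<theta> \<le> pi \<longrightarrow>
           cmod (E_trunc \<nu> a c (M n) r (\<theta> + 2 * pi * of_int n)) \<le> D * exp_error \<nu> a (M 0) r \<theta>"
    using other unfolding J_def by blast
  from bchoice[OF this] obtain D where D: "\<And>n. n \<in> J \<Longrightarrow> D n \<ge> 0" "\<And>n r \<theta>. n \<in> J \<Longrightarrow> r > 0 \<Longrightarrow> Zmod a r \<ge> 1 \<Longrightarrow> 0 \<le> of_int \<sigma> * \<theta> \<Longrightarrow> of_int \<sigma> * \<theta> \<le> pi \<Longrightarrow>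
           cmod (E_trunc \<nu> a c (M n) r (\<theta> + 2 * pi * of_int n)) \<le> D n * exp_error \<nu> a (M 0) r \<theta>"
    by blast
  define T where "T = C + (\<Sum>n\<in>J. D n)"
  have SD: "(\<Sum>n\<in>J. D n) \<ge> 0" using D(1) by (intro sum_nonneg)
  have main: "cmod (struve_sum \<nu> a (rcis r \<theta>) - compound_trunc \<nu> a c \<sigma> I M K r \<theta>) \<le> T * compound_error \<nu> a I M K r \<theta>"
    if r: "r \<ge> X" and \<theta>: "0 \<le> of_int \<sigma> * \<theta>" "of_int \<sigma> * \<theta> \<le> pi" for r \<theta>
  proof -
    have r0: "r > 0" using r C(2) by linarith
    have Z: "Zmod a r \<ge> 1" using C(3)[OF r \<theta>] by blast
    define e0 e1 h where "e0 = exp_error \<nu> a (M 0) r \<theta>" and "e1 = exp_error \<nu> a (M (- \<sigma>)) r (\<theta> + 2 * pi * of_int (- \<sigma>))"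
      and "h = 1 / r ^ (K + 1)"
    have pos: "e0 \<ge> 0" "e1 \<ge> 0" "h \<ge> 0" using r0 by (simp_all add: e0_def e1_def h_def exp_error_def)
    define eJ where "eJ = (\<Sum>n\<in>J. exp_error \<nu> a (M n) r (\<theta> + 2 * pi * of_int n))"
    have eJ: "eJ \<ge> 0" unfolding eJ_def by (intro sum_nonneg) (simp add: exp_error_def)
    have err: "compound_error \<nu> a I M K r \<theta> = e0 + e1 + eJ + h"
      unfolding compound_error_def exp_error_def[symmetric] I_eq using J
      by (simp add: e0_def e1_def h_def eJ_def)
    define SJ where "SJ = (\<Sum>n\<in>J. E_trunc \<nu> a c (M n) r (\<theta> + 2 * pi * of_int n))"
    have tr: "struve_sum \<nu> a (rcis r \<theta>) - compound_trunc \<nu> a c \<sigma> I M K r \<theta> =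
       (struve_sum \<nu> a (rcis r \<theta>) - H_trunc \<nu> a K r (\<theta> - of_int \<sigma> * pi)
                  - E_trunc \<nu> a c (M 0) r \<theta> - E_trunc \<nu> a c (M (- \<sigma>)) r (\<theta> + 2 * pi * of_int (- \<sigma>))) - SJ"
      unfolding compound_trunc_def I_eq using J by (simp add: SJ_def)
    have b1: "cmod SJ \<le> (\<Sum>n\<in>J. D n) * e0"
      unfolding SJ_def sum_distrib_right e0_def using D(2)[OF _ r0 Z \<theta>] by (intro sum_norm_le) auto
    have "cmod (struve_sum \<nu> a (rcis r \<theta>) - compound_trunc \<nu> a c \<sigma> I M K r \<theta>) \<le> C * (e0 + e1 + h) + (\<Sum>n\<in>J. D n) * e0"
      unfolding tr using C(3)[OF r \<theta>] by (intro order_trans[OF norm_triangle_ineq4 add_mono[OF _ b1]]) (simp add: e0_def e1_def h_def)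
    also have "\<dots> \<le> C * (e0 + e1 + eJ + h) + (\<Sum>n\<in>J. D n) * (e0 + e1 + eJ + h)"
      using pos eJ C(1) SD by (intro add_mono[OF mult_left_mono mult_left_mono]) linarith+
    also have "\<dots> = T * compound_error \<nu> a I M K r \<theta>" by (simp add: T_def err distrib_right)
    finally show ?thesis .
  qed
  have "\<forall>\<^sub>F z in inf at_infinity (principal {z. 0 \<le> of_int \<sigma> * Arg z \<and> of_int \<sigma> * Arg z \<le> pi / 2}).
      norm (cmod ((z / 2) powr of_real (- \<nu> - 1) * struve_L \<nu> a z - compound_trunc \<nu> a c \<sigma> I M K (cmod (z\<^sup>2 / 4)) (2 * Arg z)))
        \<le> T * norm (compound_error \<nu> a I M K (cmod (z\<^sup>2 / 4)) (2 * Arg z))"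
    unfolding eventually_inf_principal eventually_at_infinity
  \<comment> \<open>From |z|/2 \<ge> max(1, X) follows |\<zeta>| = (|z|/2)^2 \<ge> X; the 1
    guarantees that squaring does not decrease the bound.\<close>
  proof (intro exI[of _ "2 * max 1 X"] allI impI)
    fix z :: complex assume z: "2 * max 1 X \<le> cmod z" and Arg: "z \<in> {z. 0 \<le> of_int \<sigma> * Arg z \<and> of_int \<sigma> * Arg z \<le> pi / 2}"
    have "(max 1 X)\<^sup>2 \<le> (cmod z / 2)\<^sup>2" using z by (intro power_mono) auto
    moreover have "max 1 X * 1 \<le> max 1 X * max 1 X" by (intro mult_left_mono) auto
    ultimately have r: "X \<le> cmod (z\<^sup>2 / 4)" by (simp add: power2_eq_square norm_mult norm_divide)
    have z0: "z \<noteq> 0" using z by auto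
    have "cmod ((z / 2) powr of_real (- \<nu> - 1) * struve_L \<nu> a z - compound_trunc \<nu> a c \<sigma> I M K (cmod (z\<^sup>2 / 4)) (2 * Arg z))
        \<le> T * compound_error \<nu> a I M K (cmod (z\<^sup>2 / 4)) (2 * Arg z)"
      unfolding struve_L_eq[OF z0] using Arg by (intro main r) (auto simp: mult.commute mult.left_commute)
    also have "\<dots> \<le> T * norm (compound_error \<nu> a I M K (cmod (z\<^sup>2 / 4)) (2 * Arg z))"
      using C(1) SD by (intro mult_left_mono) (auto simp: T_def)
    finally show "norm (cmod ((z / 2) powr of_real (- \<nu> - 1) * struve_L \<nu> a z - compound_trunc \<nu> a c \<sigma> I M K (cmod (z\<^sup>2 / 4)) (2 * Arg z)))
        \<le> T * norm (compound_error \<nu> a I M K (cmod (z\<^sup>2 / 4)) (2 * Arg z))" by simp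
  qed
  thus "(\<lambda>z. cmod ((z / 2) powr of_real (- \<nu> - 1) * struve_L \<nu> a z - compound_trunc \<nu> a c \<sigma> I M K (cmod (z\<^sup>2 / 4)) (2 * Arg z)))
        \<in> O[inf at_infinity (principal {z. 0 \<le> of_int \<sigma> * Arg z \<and> of_int \<sigma> * Arg z \<le> pi / 2})](
          \<lambda>z. compound_error \<nu> a I M K (cmod (z\<^sup>2 / 4)) (2 * Arg z))"
    by (rule bigoI)
qed

theorem theorem3:
  fixes \<nu> a :: real and c :: "nat \<Rightarrow> real" and N \<sigma> :: int
  assumes a: "a > 0"
    and c: "inverse_factorial_coeffs \<nu> a c"
    and N: "2 * real_of_int N + 1 > kappa a / 2"
    and N_least: "\<And>m :: int. 2 * real_of_int m + 1 > kappa a / 2 \<Longrightarrow> N \<le> m"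
    and \<sigma>: "\<sigma> = 1 \<or> \<sigma> = - 1"
  shows "(1 < kappa a \<and> kappa a \<le> 2 \<longrightarrow>
            compound_expansion \<nu> a c \<sigma> {0, - \<sigma>}
              (\<lambda>z. (z / 2) powr of_real (- \<nu> - 1) * struve_L \<nu> a z)) \<and>
         (kappa a > 2 \<longrightarrow>
            compound_expansion \<nu> a c \<sigma> {- N..N}
              (\<lambda>z. (z / 2) powr of_real (- \<nu> - 1) * struve_L \<nu> a z))"
proof (intro conjI impI)
  show "compound_expansion \<nu> a c \<sigma> {0, - \<sigma>} (\<lambda>z. (z / 2) powr of_real (- \<nu> - 1) * struve_L \<nu> a z)"
    by (rule compound_expansionI[OF a c \<sigma>]) auto
next
  assume \<kappa>: "kappa a > 2"
  have "real_of_int N > 0" using N \<kappa> by linarith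
  \<comment> \<open>Puts the two relevant indices 0 and - \<sigma> into
    \<open>{- N..N}\<close>.\<close>
  hence N1: "N \<ge> 1" by simp
  \<comment> \<open>Minimality of N in the form used here: N - 1 violates the strict
    inequality.\<close>
  have N2: "2 * real_of_int N - 1 \<le> kappa a / 2"
  proof (rule ccontr)
    assume "\<not> ?thesis"
    hence "2 * real_of_int (N - 1) + 1 > kappa a / 2" by simp
    from N_least[OF this] show False by simp
  qed
  show "compound_expansion \<nu> a c \<sigma> {- N..N} (\<lambda>z. (z / 2) powr of_real (- \<nu> - 1) * struve_L \<nu> a z)"
    using N1 \<sigma> by (intro compound_expansionI[OF a c \<sigma>] E_trunc_other_le[OF a \<kappa> N2 _ _ _ _ \<sigma>]) auto
qed

end
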